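(* Let $p\in(1,\infty)$ and let $\mu_p$ be the probability measure $d\mu_p=\frac{e^{-\beta d^p}}{Z}d\lambda$ on $\mathbb{R}^N$, $\beta\in(0,\infty)$. Suppose that $0<\frac1\sigma\le|\nabla d|\le1$ for some $\sigma\in[1,\infty)$, and $\Delta d\le K+\beta p\,\varepsilon\,d^{p-1}$ outside the unit ball $\{d<1\}$ for some $K\in[0,\infty)$, $\varepsilon\in[0,\frac1{\sigma^2})$, and let $C,D\in(0,\infty)$ be constants such that $$\int|f|d^{p-1}d\mu_p\le C\int|\nabla f|d\mu_p+D\int|f|d\mu_p\qquad\text{for all } f\in\mathcal{L}.$$ Let $d\mu=\frac{e^{-W-V}}{Z'}d\mu_p$ be a probability measure defined with a differentiable potential $W$ satisfying $$|\nabla W|\le\delta d^{p-1}+\gamma_\delta$$ with some constants $\delta<1/C$ and $\gamma_\delta\in(0,\infty)$, and suppose that $V$ is a measurable function such that $\mathrm{osc}(V)\equiv\max V-\min V<\infty$. Then there exist constants $C',D'\in(0,\infty)$ such that for every $f\in\mathcal{L}$ $$\int|f|d^{p-1}d\mu\le C'\int|\nabla f|d\mu+D'\int|f|d\mu .$$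
   Context: Setting. $\lambda$ is Lebesgue measure on $\mathbb{R}^N$. $\nabla=(X_1,\dots,X_k)$ is a finite collection of smooth, possibly noncommuting, vector fields on $\mathbb{R}^N$, each with zero divergence with respect to $\lambda$; $\nabla f=(X_1f,\dots,X_kf)$, $|\nabla f|=(\sum_i (X_if)^2)^{1/2}$ and $\Delta=\sum_i X_i^2$. $\mathcal{L}$ denotes the class of continuous functions $f:\mathbb{R}^N\to\mathbb{R}$ whose distributional derivatives $X_if$ are all in $L^\infty_{loc}$. $d:\mathbb{R}^N\to[0,\infty)$ is the distance from a fixed point (the origin) in some metric; it is assumed that $d\in\mathcal{L}$ and that the balls $\{d\le R\}$ are compact. Bounds on $|\nabla d|$ are understood almost everywhere, and the upper bound on $\Delta d$ in the sense of distributions on $\{d>1\}$. $Z,Z'$ are normalisation constants. Integrals on the right-hand side are allowed to be $+\infty$. *)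

theory Defs
  imports "HOL-Probability.Probability"
begin

primrec Ck :: "nat \<Rightarrow> ('a::euclidean_space \<Rightarrow> 'b::real_normed_vector) \<Rightarrow> bool" where
  "Ck 0 f \<longleftrightarrow> continuous_on UNIV f"
| "Ck (Suc n) f \<longleftrightarrow>
     (\<forall>x. f differentiable (at x)) \<and> (\<forall>v. Ck n (\<lambda>x. frechet_derivative f (at x) v))"

definition smooth :: "('a::euclidean_space \<Rightarrow> 'b::real_normed_vector) \<Rightarrow> bool" where
  "smooth f \<longleftrightarrow> (\<forall>n. Ck n f)"

definition supp :: "('a::euclidean_space \<Rightarrow> real) \<Rightarrow> 'a set" where
  "supp f = closure {x. f x \<noteq> 0}"

definition test_function :: "('a::euclidean_space \<Rightarrow> real) \<Rightarrow> bool" where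
  "test_function \<phi> \<longleftrightarrow> smooth \<phi> \<and> compact (supp \<phi>)"

definition vf_div :: "('a::euclidean_space \<Rightarrow> 'a) \<Rightarrow> 'a \<Rightarrow> real" where
  "vf_div Y x = (\<Sum>b\<in>Basis. frechet_derivative Y (at x) b \<bullet> b)"

text \<open>A vector field acting on a (classically differentiable) function as a first order
  differential operator, and the formal adjoint of that operator with respect to Lebesgue measure.\<close>

definition vf_deriv :: "('a::euclidean_space \<Rightarrow> 'a) \<Rightarrow> ('a \<Rightarrow> real) \<Rightarrow> 'a \<Rightarrow> real" where
  "vf_deriv Y f x = frechet_derivative f (at x) (Y x)"

definition vf_adjoint :: "('a::euclidean_space \<Rightarrow> 'a) \<Rightarrow> ('a \<Rightarrow> real) \<Rightarrow> 'a \<Rightarrow> real" where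
  "vf_adjoint Y \<phi> x = - vf_deriv Y \<phi> x - vf_div Y x * \<phi> x"

definition classical_grad ::
    "('k::finite \<Rightarrow> 'a::euclidean_space \<Rightarrow> 'a) \<Rightarrow> ('a \<Rightarrow> real) \<Rightarrow> 'a \<Rightarrow> real ^ 'k" where
  "classical_grad X f x = (\<chi> i. vf_deriv (X i) f x)"

definition Linfty_loc :: "('a::euclidean_space \<Rightarrow> real) \<Rightarrow> bool" where
  "Linfty_loc g \<longleftrightarrow> g \<in> borel_measurable lebesgue \<and>
     (\<forall>S. compact S \<longrightarrow> (\<exists>B. AE x in lebesgue. x \<in> S \<longrightarrow> \<bar>g x\<bar> \<le> B))"

text \<open>Only meaningful for locally integrable \<open>f\<close> and \<open>g\<close>, as the Bochner integral of a
  non-integrable function is 0; below \<open>f\<close> is continuous and \<open>g\<close> is locally bounded.\<close>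

definition has_distr_deriv ::
    "('a::euclidean_space \<Rightarrow> 'a) \<Rightarrow> ('a \<Rightarrow> real) \<Rightarrow> ('a \<Rightarrow> real) \<Rightarrow> bool" where
  "has_distr_deriv Y f g \<longleftrightarrow> (\<forall>\<phi>. test_function \<phi> \<longrightarrow>
     (LINT x|lebesgue. f x * vf_adjoint Y \<phi> x) = (LINT x|lebesgue. g x * \<phi> x))"

definition class_L ::
    "('k::finite \<Rightarrow> 'a::euclidean_space \<Rightarrow> 'a) \<Rightarrow> ('a \<Rightarrow> real) set" where
  "class_L X = {f. continuous_on UNIV f \<and> (\<forall>i. \<exists>g. Linfty_loc g \<and> has_distr_deriv (X i) f g)}"

text \<open>For \<open>f\<close> in \<open>class_L X\<close> the following is some representative of the distributional gradient;
  it is determined up to Lebesgue null sets, so it is only used under integrals against absolutely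
  continuous measures and in almost everywhere statements.\<close>

definition grad ::
    "('k::finite \<Rightarrow> 'a::euclidean_space \<Rightarrow> 'a) \<Rightarrow> ('a \<Rightarrow> real) \<Rightarrow> 'a \<Rightarrow> real ^ 'k" where
  "grad X f x = (\<chi> i. (SOME g. Linfty_loc g \<and> has_distr_deriv (X i) f g) x)"

text \<open>\<open>\<Delta>f \<le> h\<close> as distributions on the open set \<open>U\<close>, where \<open>\<Delta>\<close> is the sum of the squares of
  the \<open>X i\<close>.\<close>

definition distr_laplacian_le ::
    "('k::finite \<Rightarrow> 'a::euclidean_space \<Rightarrow> 'a) \<Rightarrow> 'a set \<Rightarrow> ('a \<Rightarrow> real) \<Rightarrow> ('a \<Rightarrow> real) \<Rightarrow> bool" where
  "distr_laplacian_le X U f h \<longleftrightarrow>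
     (\<forall>\<phi>. test_function \<phi> \<and> (\<forall>x. 0 \<le> \<phi> x) \<and> supp \<phi> \<subseteq> U \<longrightarrow>
       (LINT x|lebesgue. f x * (\<Sum>i\<in>UNIV. vf_adjoint (X i) (vf_adjoint (X i) \<phi>) x))
         \<le> (LINT x|lebesgue. h x * \<phi> x))"

definition osc :: "('a \<Rightarrow> real) \<Rightarrow> ereal" where
  "osc V = (SUP x. ereal (V x)) - (INF x. ereal (V x))"

end

theory Submission
  imports Defs
begin

text \<open>
  Apply the inequality for \<open>\<mu>p\<close> to \<open>f \<kappa> e\<^sup>-\<^sup>W\<close>, where \<open>\<kappa>\<close> is a cutoff that equals 1 on \<open>{d \<le> T}\<close>. The gradient
  of \<open>W\<close> produces a term \<open>C \<delta> \<integral> |f| \<kappa> d\<^sup>p\<^sup>-\<^sup>1 e\<^sup>-\<^sup>W d\<mu>p\<close>, which is finite because of the cutoff and is absorbed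
  since \<open>C \<delta> < 1\<close>; then \<open>T \<rightarrow> \<infinity>\<close>. The bounded potential \<open>V\<close> changes all integrals by bounded factors.

  The cutoff is a function of a mollification of \<open>d\<close>, whose derivatives along the fields are controlled by
  Friedrichs' commutator estimate. The Leibniz rule for \<open>f \<kappa> e\<^sup>-\<^sup>W\<close> is delicate because \<open>W\<close> is merely
  differentiable: away from the given fields its derivatives need not be locally integrable. It amounts to
  \<open>\<integral> f Y w + g w = 0\<close> for \<open>w\<close> differentiable with compact support and \<open>Y w\<close> bounded, where \<open>g\<close> is the weak
  derivative of \<open>f\<close> along \<open>Y\<close>. Replace \<open>f Y w\<close> by a lower semicontinuous majorant \<open>H\<close> with almost the same
  integral. If the integral were negative, repeated bisection of a cube would yield cubes shrinking to a point
  \<open>x\<close> on each of which the localized functional stays below \<open>-\<epsilon>\<close> times the volume. But near \<open>x\<close> one may replace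
  \<open>w\<close> by its first order Taylor polynomial, for which the localized functional is nonnegative up to small
  errors by the definition of the weak derivative.
\<close>

section \<open>Smooth functions and a smooth step\<close>

text \<open>The multiplier in the product rule has to be differentiable, while \<open>d\<close> only
  lies in \<open>class_L X\<close>; hence the mollification in the cutoff. The bound on the gradient
  of the cutoff enters \<open>D'\<close>, so it must not depend on T. The bisection has the pattern
  of Goursat's theorem. It closes because of scaling: on a cube of side s the derivative of a
  plateau has mass of order s^(N-1), whatever the width r of its edge, and the Taylor error of w at
  x is o(s). The product is o(s^N), which is less than \<epsilon> times the volume. Bisection also
  needs exact additivity over subcubes although only smooth functions may be tested; the plateaus
  are shaped so that they telescope. The majorant is there because Y w need not be continuous. The
  Taylor polynomial gives the continuous function f(y) D(Y y), where D is the derivative of w at x.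
  At y = x it is at most H(x), and lower semicontinuity keeps H(y), up to a small error, above it
  for y near x.\<close>

lemma Ck_imp_continuous: "Ck n f \<Longrightarrow> continuous_on UNIV f"
proof (cases n)
  case (Suc m)
  assume "Ck n f"
  then show ?thesis
    unfolding Suc by (intro differentiable_imp_continuous_on) (simp add: differentiable_on_def)
qed simp

lemma Ck_Suc_imp: "Ck (Suc n) f \<Longrightarrow> Ck n f"
proof (induction n arbitrary: f)
  case 0
  then have "Ck (Suc 0) f" .
  then show ?case using Ck_imp_continuous[of "Suc 0" f] by (simp only: Ck.simps(1))
next
  case (Suc n)
  have "Ck n (\<lambda>x. frechet_derivative f (at x) v)" for v
    using Suc.prems by (intro Suc.IH) simp
  then show ?case using Suc.prems by simp
qed

text \<open>The closure proofs for \<open>Ck\<close> exhibit a derivative explicitly; this form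
  removes the choice hidden in \<open>frechet_derivative\<close>.\<close>

lemma Ck_Suc_iff_has_derivative:
  assumes "\<And>x. (f has_derivative f' x) (at x)"
  shows "Ck (Suc n) f \<longleftrightarrow> (\<forall>v. Ck n (\<lambda>x. f' x v))"
proof -
  have "frechet_derivative f (at x) = f' x" for x
    using frechet_derivative_at[OF assms] by simp
  moreover have "f differentiable (at x)" for x
    using assms differentiable_def by blast
  ultimately show ?thesis by simp
qed

lemma Ck_const: "Ck n (\<lambda>x. c)"
proof (induction n arbitrary: c)
  case (Suc n)
  show ?case by (subst Ck_Suc_iff_has_derivative[where f' = "\<lambda>x v. 0"]) (auto simp: Suc)
qed auto

lemma Ck_bounded_linear: "bounded_linear f \<Longrightarrow> Ck n f"
proof (cases n)
  case (Suc m)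
  assume f: "bounded_linear f"
  show ?thesis unfolding Suc
    by (subst Ck_Suc_iff_has_derivative[where f' = "\<lambda>x v. f v"])
       (auto simp: Ck_const bounded_linear_imp_has_derivative f)
qed (auto intro: linear_continuous_on)

lemma Ck_add: "Ck n f \<Longrightarrow> Ck n g \<Longrightarrow> Ck n (\<lambda>x. f x + g x)"
proof (induction n arbitrary: f g)
  case (Suc n)
  have "((\<lambda>x. f x + g x) has_derivative
      (\<lambda>v. frechet_derivative f (at x) v + frechet_derivative g (at x) v)) (at x)" for x
    using Suc.prems by (intro has_derivative_add) (auto simp: frechet_derivative_works)
  then show ?case
    using Suc by (subst Ck_Suc_iff_has_derivative) auto
qed (auto intro: continuous_intros)

lemma Ck_mult:
  fixes f g :: "'a::euclidean_space \<Rightarrow> real"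
  shows "Ck n f \<Longrightarrow> Ck n g \<Longrightarrow> Ck n (\<lambda>x. f x * g x)"
proof (induction n arbitrary: f g)
  case (Suc n)
  have "((\<lambda>x. f x * g x) has_derivative
      (\<lambda>v. f x * frechet_derivative g (at x) v + frechet_derivative f (at x) v * g x)) (at x)" for x
    using Suc.prems by (intro has_derivative_mult) (auto simp: frechet_derivative_works)
  moreover have "Ck n f" "Ck n g" using Suc.prems by (auto intro: Ck_Suc_imp)
  ultimately show ?case
    using Suc by (subst Ck_Suc_iff_has_derivative) (auto intro!: Ck_add Suc.IH)
qed (auto intro: continuous_intros)

text \<open>The induction closes because the derivative is a product of a derivative of
  \<open>f\<close> and two copies of the inverse, which the induction hypothesis already covers at
  order \<open>n\<close>.\<close>

lemma Ck_inverse: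
  fixes f :: "'a::euclidean_space \<Rightarrow> real"
  assumes "\<And>x. f x \<noteq> 0"
  shows "Ck n f \<Longrightarrow> Ck n (\<lambda>x. inverse (f x))"
proof (induction n)
  case 0
  then show ?case using assms by (auto intro!: continuous_intros)
next
  case (Suc n)
  have "((\<lambda>x. inverse (f x)) has_derivative
      (\<lambda>v. - (inverse (f x) * frechet_derivative f (at x) v * inverse (f x)))) (at x)" for x
    using Suc.prems assms by (intro Deriv.has_derivative_inverse) (auto simp: frechet_derivative_works)
  then have *: "((\<lambda>x. inverse (f x)) has_derivative
      (\<lambda>v. (-1) * (inverse (f x) * frechet_derivative f (at x) v * inverse (f x)))) (at x)" for x
    by simp
  have "Ck n (\<lambda>x. inverse (f x))" using Suc Ck_Suc_imp by blast
  then show ?case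
    using Suc.prems unfolding Ck_Suc_iff_has_derivative[OF *]
    by (intro allI Ck_mult Ck_const) auto
qed

lemma Ck_compose_affine:
  fixes f :: "'a::euclidean_space \<Rightarrow> 'b::real_normed_vector"
    and L :: "'c::euclidean_space \<Rightarrow> 'a"
  assumes L: "bounded_linear L"
  shows "Ck n f \<Longrightarrow> Ck n (\<lambda>x. f (L x + c))"
proof (induction n arbitrary: f)
  case 0
  then show ?case
    using linear_continuous_on[OF L]
    by (auto intro!: continuous_on_compose2[where g = f and t = UNIV] continuous_intros)
next
  case (Suc n)
  have "((\<lambda>x. f (L x + c)) has_derivative (\<lambda>v. frechet_derivative f (at (L x + c)) (L v))) (at x)" for x
  proof -
    have "((\<lambda>x. L x + c) has_derivative L) (at x)"
      using bounded_linear_imp_has_derivative[OF L] by (auto intro!: derivative_eq_intros)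
    moreover have "(f has_derivative frechet_derivative f (at (L x + c))) (at (L x + c))"
      using Suc.prems by (auto simp: frechet_derivative_works)
    ultimately show ?thesis by (rule has_derivative_compose)
  qed
  then show ?case
    using Suc by (subst Ck_Suc_iff_has_derivative) auto
qed

lemma Ck_prod:
  fixes f :: "'i \<Rightarrow> 'a::euclidean_space \<Rightarrow> real"
  assumes "\<And>i. i \<in> A \<Longrightarrow> Ck n (f i)"
  shows "Ck n (\<lambda>x. \<Prod>i\<in>A. f i x)"
  using assms
  by (induction A rule: infinite_finite_induct) (auto simp: Ck_const intro!: Ck_mult)

lemma smooth_mult:
  fixes f g :: "'a::euclidean_space \<Rightarrow> real"
  shows "smooth f \<Longrightarrow> smooth g \<Longrightarrow> smooth (\<lambda>x. f x * g x)"
  by (simp add: smooth_def Ck_mult)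

lemma smooth_differentiable: "smooth f \<Longrightarrow> f differentiable (at x)"
  unfolding smooth_def by (metis Ck.simps(2))

lemma smooth_continuous_derivative:
  "smooth f \<Longrightarrow> continuous_on UNIV (\<lambda>x. frechet_derivative f (at x) v)"
  unfolding smooth_def by (metis Ck.simps)

lemma smooth_continuous: "smooth f \<Longrightarrow> continuous_on A f"
  unfolding smooth_def using Ck_imp_continuous continuous_on_subset by blast

lemma smooth_has_derivative: "smooth f \<Longrightarrow> (f has_derivative frechet_derivative f (at x)) (at x)"
  by (simp add: smooth_differentiable flip: frechet_derivative_works)

lemma has_derivative_cong_open:
  assumes "open U" "x \<in> U" "\<And>y. y \<in> U \<Longrightarrow> f y = (g y :: 'b::real_normed_vector)"
  shows "(f has_derivative f') (at x) \<longleftrightarrow> (g has_derivative f') (at x)"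
  using assms by (metis has_derivative_transform_within_open)

section \<open>A smooth monotone step built from exp(-1/t)\<close>

text \<open>\<open>P = 1\<close> gives the classical flat function. The polynomial in 1/t is carried
  along because it makes the family closed under differentiation.\<close>

definition flat_exp :: "real poly \<Rightarrow> real \<Rightarrow> real" where
  "flat_exp P t = (if t > 0 then poly P (1 / t) * exp (- (1 / t)) else 0)"


text \<open>With s = 1/t the quotient becomes s P(s) / exp s; the \<open>pCons 0\<close> is the
  factor s coming from the division by t. This is the difference quotient at 0.\<close>

lemma flat_exp_quotient_tendsto: "((\<lambda>t. flat_exp P t / t) \<longlongrightarrow> 0) (at 0)"
proof -
  have "((\<lambda>s. \<Sum>i\<le>degree (pCons 0 P). coeff (pCons 0 P) i * (s ^ i / exp s)) \<longlongrightarrow>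
      (\<Sum>i\<le>degree (pCons 0 P). coeff (pCons 0 P) i * 0)) at_top"
    by (intro tendsto_intros tendsto_power_div_exp_0)
  then have "((\<lambda>s::real. poly (pCons 0 P) s / exp s) \<longlongrightarrow> 0) at_top"
    unfolding poly_altdef sum_divide_distrib by simp
  from filterlim_compose[OF this filterlim_inverse_at_top_right]
  have "((\<lambda>t. poly (pCons 0 P) (inverse t) / exp (inverse t)) \<longlongrightarrow> 0) (at_right 0)" .
  moreover have "\<forall>\<^sub>F t in at_right 0. poly (pCons 0 P) (inverse t) / exp (inverse t) = flat_exp P t / t"
    by (auto simp: eventually_at_filter flat_exp_def exp_minus field_simps)
  ultimately have "((\<lambda>t. flat_exp P t / t) \<longlongrightarrow> 0) (at_right 0)"
    by (rule Lim_transform_eventually)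
  moreover have "((\<lambda>t. flat_exp P t / t) \<longlongrightarrow> 0) (at_left 0)"
    by (rule Lim_transform_eventually[OF tendsto_const])
       (auto simp: eventually_at_filter flat_exp_def)
  ultimately show ?thesis by (simp add: filterlim_split_at)
qed

text \<open>Differentiating P(1/t) exp(-1/t) gives (P - P')(1/t) exp(-1/t) / t^2, and
  \<open>[:0, 0, 1:]\<close> is the factor 1/t^2.\<close>

lemma flat_exp_has_derivative:
  "(flat_exp P has_real_derivative flat_exp ((P - pderiv P) * [:0, 0, 1:]) t) (at t)"
proof -
  consider "t > 0" | "t < 0" | "t = 0" by linarith
  then show ?thesis
  proof cases
    case 1
    have inv: "((\<lambda>t. 1 / t) has_real_derivative - ((1 / t)\<^sup>2)) (at t)"
      using 1 by (auto intro!: derivative_eq_intros simp: power2_eq_square)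
    have "((\<lambda>t. poly P (1 / t) * exp (- (1 / t))) has_real_derivative
        poly (pderiv P) (1 / t) * - ((1 / t)\<^sup>2) * exp (- (1 / t))
          + exp (- (1 / t)) * (1 / t)\<^sup>2 * poly P (1 / t)) (at t)"
      by (rule DERIV_cong[OF DERIV_mult[OF DERIV_chain2[OF poly_DERIV inv]
            DERIV_chain2[OF DERIV_exp DERIV_minus[OF inv]]]]) (simp add: algebra_simps)
    also have "poly (pderiv P) (1 / t) * - ((1 / t)\<^sup>2) * exp (- (1 / t))
          + exp (- (1 / t)) * (1 / t)\<^sup>2 * poly P (1 / t)
        = flat_exp ((P - pderiv P) * [:0, 0, 1:]) t"
      using 1 by (simp add: flat_exp_def algebra_simps power2_eq_square)
    finally have "((\<lambda>t. poly P (1 / t) * exp (- (1 / t))) has_real_derivative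
        flat_exp ((P - pderiv P) * [:0, 0, 1:]) t) (at t)" .
    then show ?thesis
      by (rule has_field_derivative_transform_within_open[where S = "{0<..}"])
        (use 1 in \<open>auto simp: flat_exp_def\<close>)
  next
    case 2
    show ?thesis
      by (rule has_field_derivative_transform_within_open[where S = "{..<0}" and f = "\<lambda>t. 0"])
         (use 2 in \<open>auto simp: flat_exp_def\<close>)
  next
    case 3
    then show ?thesis
      using flat_exp_quotient_tendsto[of P] by (simp add: DERIV_def flat_exp_def)
  qed
qed

lemma Ck_flat_exp: "Ck n (flat_exp P)"
proof (induction n arbitrary: P)
  case 0
  show ?case
    using flat_exp_has_derivative
    by (auto intro!: continuous_at_imp_continuous_on DERIV_isCont)
next
  case (Suc n)
  let ?Q = "(P - pderiv P) * [:0, 0, 1:]"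
  have "(flat_exp P has_derivative (\<lambda>v. flat_exp ?Q t * v)) (at t)" for t
    using flat_exp_has_derivative[of P t] by (simp add: has_field_derivative_def)
  from Ck_Suc_iff_has_derivative[OF this] show ?case
    by (auto intro!: Ck_mult Suc Ck_const)
qed

text \<open>The denominator is positive everywhere since t and 1 - t cannot both be
  nonpositive.\<close>

definition smooth_step :: "real \<Rightarrow> real" where
  "smooth_step t = flat_exp 1 t * inverse (flat_exp 1 t + flat_exp 1 (1 - t))"

lemma flat_exp_one_nonneg: "0 \<le> flat_exp 1 t"
  and flat_exp_one_pos_iff: "0 < flat_exp 1 t \<longleftrightarrow> 0 < t"
  by (auto simp: flat_exp_def)

lemma flat_exp_one_mono: "s \<le> t \<Longrightarrow> flat_exp 1 s \<le> flat_exp 1 t"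
  by (auto simp: flat_exp_def frac_le)

lemma flat_exp_sum_pos: "0 < flat_exp 1 t + flat_exp 1 (1 - t)"
  using flat_exp_one_nonneg[of t] flat_exp_one_nonneg[of "1 - t"]
    flat_exp_one_pos_iff[of t] flat_exp_one_pos_iff[of "1 - t"] by force

lemma smooth_step_smooth: "smooth smooth_step"
proof -
  have "Ck n (\<lambda>t. flat_exp 1 (1 - t))" for n
    using Ck_compose_affine[OF bounded_linear_minus[OF bounded_linear_ident] Ck_flat_exp, of n 1 1]
    by (simp add: add.commute)
  then show ?thesis
    using flat_exp_sum_pos unfolding smooth_def smooth_step_def
    by (auto intro!: Ck_mult Ck_inverse Ck_add Ck_flat_exp simp: less_imp_neq[symmetric])
qed

lemma smooth_step_eq_0: "t \<le> 0 \<Longrightarrow> smooth_step t = 0"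
  by (simp add: smooth_step_def flat_exp_def)

lemma smooth_step_eq_1: "1 \<le> t \<Longrightarrow> smooth_step t = 1"
  by (simp add: smooth_step_def flat_exp_def)

lemma smooth_step_mono:
  assumes "s \<le> t" shows "smooth_step s \<le> smooth_step t"
proof -
  have "flat_exp 1 s * flat_exp 1 (1 - t) \<le> flat_exp 1 t * flat_exp 1 (1 - s)"
    using assms by (intro mult_mono flat_exp_one_mono flat_exp_one_nonneg) auto
  then show ?thesis
    using flat_exp_sum_pos[of s] flat_exp_sum_pos[of t]
    by (simp add: smooth_step_def field_simps)
qed

lemma smooth_step_bounds: "0 \<le> smooth_step t" "smooth_step t \<le> 1"
  using smooth_step_mono[of "min t 0" t] smooth_step_mono[of t "max t 1"]
    smooth_step_eq_0[of "min t 0"] smooth_step_eq_1[of "max t 1"] by auto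

lemma smooth_step_has_derivative:
  "(smooth_step has_real_derivative deriv smooth_step t) (at t)"
  using smooth_differentiable[OF smooth_step_smooth]
  by (simp add: DERIV_deriv_iff_real_differentiable)

lemma deriv_smooth_step_eq_0:
  assumes "t \<notin> {0..1}" shows "deriv smooth_step t = 0"
proof -
  consider "t < 0" | "t > 1" using assms by force
  then have "(smooth_step has_real_derivative 0) (at t)"
  proof cases
    case 1
    show ?thesis
      by (rule has_field_derivative_transform_within_open[where S = "{..<0}" and f = "\<lambda>t. 0"])
         (use 1 in \<open>auto simp: smooth_step_eq_0\<close>)
  next
    case 2
    show ?thesis
      by (rule has_field_derivative_transform_within_open[where S = "{1<..}" and f = "\<lambda>t. 1"])
         (use 2 in \<open>auto simp: smooth_step_eq_1\<close>)
  qed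
  then show ?thesis by (rule DERIV_imp_deriv)
qed

lemma continuous_deriv_smooth_step: "continuous_on A (deriv smooth_step)"
proof -
  have "frechet_derivative smooth_step (at t) 1 = deriv smooth_step t" for t
    using frechet_derivative_at[OF smooth_step_has_derivative[of t, unfolded has_field_derivative_def]]
    by (metis mult.right_neutral)
  then show ?thesis
    using smooth_continuous_derivative[OF smooth_step_smooth, of 1]
    by (auto intro: continuous_on_subset)
qed

lemma deriv_smooth_step_bound: obtains M where "0 < M" "\<And>t. \<bar>deriv smooth_step t\<bar> \<le> M"
proof -
  have "compact (deriv smooth_step ` {0..1})"
    by (intro compact_continuous_image continuous_deriv_smooth_step) auto
  then obtain M where M: "0 < M" "\<And>t. t \<in> {0..1} \<Longrightarrow> \<bar>deriv smooth_step t\<bar> \<le> M"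
    by (auto dest!: compact_imp_bounded simp: bounded_pos)
  have "\<bar>deriv smooth_step t\<bar> \<le> M" for t
    using M deriv_smooth_step_eq_0[of t] by (cases "t \<in> {0..1}") auto
  with M(1) show ?thesis using that by blast
qed

section \<open>Smooth plateaus on boxes\<close>

lemma supp_subset_closed: "closed S \<Longrightarrow> (\<And>x. f x \<noteq> 0 \<Longrightarrow> x \<in> S) \<Longrightarrow> supp f \<subseteq> S"
  unfolding supp_def by (rule closure_minimal) auto

text \<open>Each factor rises over [a_i, a_i + r] and falls over [b_i, b_i + r]. The ramps lie
  asymmetrically, both to the right of their corner, so that the ramp down at b_i cancels the ramp
  up of a neighbour starting at b_i: plateaus of adjacent boxes with the same r add up exactly to
  the plateau of the union.\<close>

definition plateau :: "real ^ 'n \<Rightarrow> real ^ 'n \<Rightarrow> real \<Rightarrow> real ^ 'n \<Rightarrow> real" where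
  "plateau a b r x =
     (\<Prod>i\<in>UNIV. smooth_step ((x $ i - a $ i) / r) - smooth_step ((x $ i - b $ i) / r))"

lemma plateau_smooth: "smooth (plateau a b r)"
  unfolding smooth_def
proof
  fix n
  have *: "Ck n (\<lambda>x::real ^ 'n. smooth_step ((x $ i - c) / r))" for i c
  proof -
    have "bounded_linear (\<lambda>x::real ^ 'n. x $ i / r)"
      by (intro bounded_linear_divide bounded_linear_compose[OF bounded_linear_divide] bounded_linear_vec_nth)
    from Ck_compose_affine[OF this, of n smooth_step "- (c / r)"] smooth_step_smooth
    show ?thesis by (simp add: smooth_def diff_divide_distrib)
  qed
  have "Ck n (\<lambda>x::real ^ 'n. smooth_step ((x $ i - c) / r) + (-1) * smooth_step ((x $ i - d) / r))" for i c d
    by (intro Ck_add Ck_mult Ck_const *)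
  then show "Ck n (plateau a b r)"
    unfolding plateau_def[abs_def] by (intro Ck_prod) simp
qed

context
  fixes a b :: "real ^ 'n" and r :: real
  assumes r: "0 < r" and ab: "\<And>i. a $ i \<le> b $ i"
begin

lemma plateau_factor_bounds:
  "0 \<le> smooth_step ((x - a $ i) / r) - smooth_step ((x - b $ i) / r)"
  "smooth_step ((x - a $ i) / r) - smooth_step ((x - b $ i) / r) \<le> 1"
proof -
  have "(x - b $ i) / r \<le> (x - a $ i) / r" using r ab[of i] by (simp add: divide_right_mono)
  from smooth_step_mono[OF this]
  show "0 \<le> smooth_step ((x - a $ i) / r) - smooth_step ((x - b $ i) / r)" by simp
  show "smooth_step ((x - a $ i) / r) - smooth_step ((x - b $ i) / r) \<le> 1"
    using smooth_step_bounds(2)[of "(x - a $ i) / r"] smooth_step_bounds(1)[of "(x - b $ i) / r"]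
    by linarith
qed

lemma plateau_nonneg: "0 \<le> plateau a b r x"
  and plateau_le_1: "plateau a b r x \<le> 1"
  unfolding plateau_def by (auto intro!: prod_nonneg prod_le_1 simp only: plateau_factor_bounds)

lemma plateau_eq_1:
  assumes "\<And>i. a $ i + r \<le> x $ i" "\<And>i. x $ i \<le> b $ i"
  shows "plateau a b r x = 1"
proof -
  have "smooth_step ((x $ i - a $ i) / r) - smooth_step ((x $ i - b $ i) / r) = 1" for i
    using assms[of i] r by (subst smooth_step_eq_1, simp add: field_simps, subst smooth_step_eq_0)
      (simp_all add: divide_le_0_iff)
  then show ?thesis by (simp add: plateau_def)
qed

lemma plateau_factor_eq_0:
  assumes "x \<le> a $ i \<or> b $ i + r \<le> x"
  shows "smooth_step ((x - a $ i) / r) - smooth_step ((x - b $ i) / r) = 0"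
  using assms
proof
  assume "x \<le> a $ i"
  then show ?thesis
    using r ab[of i] by (simp add: smooth_step_eq_0 divide_le_0_iff)
next
  assume "b $ i + r \<le> x"
  then show ?thesis
    using r ab[of i] by (simp add: smooth_step_eq_1 field_simps)
qed

lemma plateau_nonzero:
  assumes "plateau a b r x \<noteq> 0"
  shows "a $ i < x $ i" "x $ i < b $ i + r"
proof -
  have "smooth_step ((x $ i - a $ i) / r) - smooth_step ((x $ i - b $ i) / r) \<noteq> 0"
    using assms unfolding plateau_def by (simp add: prod_zero_iff)
  then show "a $ i < x $ i" "x $ i < b $ i + r"
    using plateau_factor_eq_0[of "x $ i" i] by fastforce+
qed

lemma plateau_eq_0_outside: "x \<notin> cbox a (b + vec r) \<Longrightarrow> plateau a b r x = 0"
  using plateau_nonzero[of x] by (fastforce simp: mem_box_cart less_imp_le)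

lemma plateau_mult_test_function:
  assumes "smooth l" shows "test_function (\<lambda>x. l x * plateau a b r x)"
proof -
  have "bounded {x. l x * plateau a b r x \<noteq> 0}"
    by (rule bounded_subset[OF bounded_cbox[of a "b + vec r"]]) (use plateau_eq_0_outside in auto)
  then have "compact (supp (\<lambda>x. l x * plateau a b r x))"
    by (simp add: supp_def)
  then show ?thesis
    using assms plateau_smooth by (auto simp: test_function_def intro!: smooth_mult)
qed

definition plateau_partial :: "'n \<Rightarrow> real ^ 'n \<Rightarrow> real" where
  "plateau_partial i x =
    (deriv smooth_step ((x $ i - a $ i) / r) - deriv smooth_step ((x $ i - b $ i) / r)) / r *
    (\<Prod>j\<in>UNIV - {i}. smooth_step ((x $ j - a $ j) / r) - smooth_step ((x $ j - b $ j) / r))"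

lemma plateau_has_derivative:
  "(plateau a b r has_derivative (\<lambda>v. \<Sum>i\<in>UNIV. plateau_partial i x * v $ i)) (at x)"
proof -
  have f: "((\<lambda>x. smooth_step ((x $ i - c) / r)) has_derivative
      (\<lambda>v. deriv smooth_step ((x $ i - c) / r) * (v $ i / r))) (at x)" for i c
  proof (rule has_derivative_compose[OF _ smooth_step_has_derivative[unfolded has_field_derivative_def]])
    have "bounded_linear (\<lambda>x::real ^ 'n. x $ i / r)"
      by (intro bounded_linear_compose[OF bounded_linear_divide] bounded_linear_vec_nth)
    from has_derivative_diff[OF bounded_linear_imp_has_derivative[OF this] has_derivative_const[of "c / r"]]
    show "((\<lambda>x. (x $ i - c) / r) has_derivative (\<lambda>v. v $ i / r)) (at x)"
      by (simp add: diff_divide_distrib)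
  qed
  have "((\<lambda>x. \<Prod>i\<in>UNIV. smooth_step ((x $ i - a $ i) / r) - smooth_step ((x $ i - b $ i) / r))
     has_derivative (\<lambda>v. \<Sum>i\<in>UNIV. (deriv smooth_step ((x $ i - a $ i) / r) * (v $ i / r)
       - deriv smooth_step ((x $ i - b $ i) / r) * (v $ i / r)) *
       (\<Prod>j\<in>UNIV - {i}. smooth_step ((x $ j - a $ j) / r) - smooth_step ((x $ j - b $ j) / r)))) (at x)"
    by (intro has_derivative_prod has_derivative_diff f)
  then show ?thesis
    unfolding plateau_def[abs_def] plateau_partial_def
    by (rule has_derivative_eq_rhs) (intro ext sum.cong refl,
        simp add: diff_divide_distrib left_diff_distrib right_diff_distrib mult.commute)
qed

text \<open>The i-th partial derivative lives in two slabs of thickness r, where the i-th factor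
  ramps up or down; there the ramp has slope at most 2M/r and the other factors are at most
  1.\<close>

lemma plateau_partial_bound:
  assumes M: "\<And>t. \<bar>deriv smooth_step t\<bar> \<le> M"
  shows "\<bar>plateau_partial i x\<bar> \<le> 2 * M / r *
    (indicat_real (cbox a (\<chi> j. if j = i then a $ j + r else b $ j + r)) x
     + indicat_real (cbox (\<chi> j. if j = i then b $ j else a $ j) (b + vec r)) x)"
    (is "_ \<le> 2 * M / r * (indicat_real ?A x + indicat_real ?B x)")
proof (cases "x \<in> ?A \<or> x \<in> ?B")
  case True
  have "0 \<le> M" using M[of 0] by linarith
  have "\<bar>deriv smooth_step ((x $ i - a $ i) / r) - deriv smooth_step ((x $ i - b $ i) / r)\<bar> \<le> 2 * M"
    using M[of "(x $ i - a $ i) / r"] M[of "(x $ i - b $ i) / r"] by linarith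
  moreover have "\<bar>\<Prod>j\<in>UNIV - {i}. smooth_step ((x $ j - a $ j) / r) - smooth_step ((x $ j - b $ j) / r)\<bar> \<le> 1"
    unfolding abs_prod by (intro prod_le_1) (auto simp only: plateau_factor_bounds abs_of_nonneg abs_ge_zero)
  ultimately have "\<bar>plateau_partial i x\<bar> \<le> (2 * M) / r * 1"
    unfolding plateau_partial_def abs_mult abs_divide using r \<open>0 \<le> M\<close>
    by (intro mult_mono) (auto intro: divide_right_mono)
  also have "\<dots> \<le> 2 * M / r * (indicat_real ?A x + indicat_real ?B x)"
    using True r \<open>0 \<le> M\<close> by (intro mult_left_mono) (auto simp: indicator_def)
  finally show ?thesis .
next
  case False
  have "plateau_partial i x = 0"
  proof (cases "\<exists>j. j \<noteq> i \<and> (x $ j \<le> a $ j \<or> b $ j + r \<le> x $ j)")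
    case True
    then obtain j where j: "j \<in> UNIV - {i}" "x $ j \<le> a $ j \<or> b $ j + r \<le> x $ j" by auto
    have "(\<Prod>j\<in>UNIV - {i}. smooth_step ((x $ j - a $ j) / r) - smooth_step ((x $ j - b $ j) / r)) = 0"
      using j plateau_factor_eq_0[of "x $ j" j] by (intro prod_zero) auto
    then show ?thesis by (simp add: plateau_partial_def)
  next
    case in_other: False
    have "x $ i \<notin> {a $ i..a $ i + r} \<and> x $ i \<notin> {b $ i..b $ i + r}"
    proof (rule ccontr)
      assume "\<not> ?thesis"
      then consider "x $ i \<in> {a $ i..a $ i + r}" | "x $ i \<in> {b $ i..b $ i + r}" by blast
      then show False
      proof cases
        case 1
        have "x \<in> ?A" unfolding mem_box_cart
        proof
          fix j show "a $ j \<le> x $ j \<and> x $ j \<le> (\<chi> j. if j = i then a $ j + r else b $ j + r) $ j"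
            using 1 in_other r by (cases "j = i") (auto simp: not_le less_imp_le)
        qed
        then show False using False by simp
      next
        case 2
        have "x \<in> ?B" unfolding mem_box_cart
        proof
          fix j show "(\<chi> j. if j = i then b $ j else a $ j) $ j \<le> x $ j \<and> x $ j \<le> (b + vec r) $ j"
            using 2 in_other r by (cases "j = i") (auto simp: not_le less_imp_le)
        qed
        then show False using False by simp
      qed
    qed
    then have "(x $ i - a $ i) / r \<notin> {0..1}" "(x $ i - b $ i) / r \<notin> {0..1}"
      using r by (auto simp: field_simps)
    then show ?thesis by (simp add: plateau_partial_def deriv_smooth_step_eq_0)
  qed
  then show ?thesis using False by simp
qed

end

lemma measure_cbox_lebesgue: "measure lebesgue (cbox a b) = measure lborel (cbox a b)"
  by (simp add: measure_completion)

text \<open>The height 1/r of the derivative cancels against the thickness r of the slabs, which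
  leaves the surface area of the cube. The bound is therefore independent of r;
  \<open>r \<le> s\<close> only serves to estimate the slab edges s + r by 2s. The majorant
  \<open>\<Gamma>\<close> does not depend on the direction \<open>v\<close>, so it can be used with
  a variable field.\<close>

lemma plateau_deriv_mass:
  obtains M where "0 < M"
    "\<And>(a :: real ^ 'n) s r. 0 < r \<Longrightarrow> r \<le> s \<Longrightarrow>
       \<exists>\<Gamma>. integrable lebesgue \<Gamma> \<and> (LINT x|lebesgue. \<Gamma> x) \<le> M * s ^ (CARD('n) - 1) \<and>
         (\<forall>x. 0 \<le> \<Gamma> x) \<and> (\<forall>x v. \<bar>frechet_derivative (plateau a (a + vec s) r) (at x) v\<bar> \<le> \<Gamma> x * norm v)"
proof -
  obtain M where M: "0 < M" "\<And>t. \<bar>deriv smooth_step t\<bar> \<le> M" using deriv_smooth_step_bound by metis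
  define N where "N = CARD('n)"
  show ?thesis
  proof
    show "0 < real N * (4 * M * 2 ^ (N - 1))" using M by (auto simp: N_def)
    fix a :: "real ^ 'n" and s r :: real
    assume r: "0 < r" "r \<le> s"
    define b where "b = a + vec s"
    have ab: "a $ i \<le> b $ i" for i using r by (auto simp: b_def)
    define A where "A i = cbox a (\<chi> j. if j = i then a $ j + r else b $ j + r)" for i
    define B where "B i = cbox (\<chi> j. if j = i then b $ j else a $ j) (b + vec r)" for i
    define \<Gamma> where "\<Gamma> x = (\<Sum>i\<in>UNIV. 2 * M / r * (indicat_real (A i) x + indicat_real (B i) x))" for x
    have "integrable lebesgue (indicat_real (cbox u v))" for u v :: "real ^ 'n"
      by (rule integrable_real_indicator) (simp_all add: emeasure_lborel_cbox_finite[unfolded infinity_ennreal_def])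
    then have intA: "integrable lebesgue (indicat_real (A i))" "integrable lebesgue (indicat_real (B i))" for i
      unfolding A_def B_def by auto
    have m: "measure lebesgue (A i) \<le> r * (2 * s) ^ (N - 1)" "measure lebesgue (B i) \<le> r * (2 * s) ^ (N - 1)" for i
    proof -
      have "measure lebesgue (A i) = (\<Prod>j\<in>UNIV. if j = i then r else s + r)"
        unfolding A_def measure_cbox_lebesgue
      proof (subst content_cbox_cart)
        show "cbox a (\<chi> j. if j = i then a $ j + r else b $ j + r) \<noteq> {}"
          using r by (auto simp: interval_eq_empty_cart b_def not_less intro: add_nonneg_nonneg)
      qed (use r in \<open>auto simp: b_def intro!: prod.cong\<close>)
      also have "\<dots> = r * (s + r) ^ (N - 1)"
        by (subst prod.remove[of _ i]) (auto simp: N_def card_Diff_singleton)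
      also have "\<dots> \<le> r * (2 * s) ^ (N - 1)"
        using r by (intro mult_left_mono power_mono) auto
      finally show "measure lebesgue (A i) \<le> r * (2 * s) ^ (N - 1)" .
      have "measure lebesgue (B i) = (\<Prod>j\<in>UNIV. if j = i then r else s + r)"
        unfolding B_def measure_cbox_lebesgue
      proof (subst content_cbox_cart)
        show "cbox (\<chi> j. if j = i then b $ j else a $ j) (b + vec r) \<noteq> {}"
          using r by (auto simp: interval_eq_empty_cart b_def not_less intro: add_nonneg_nonneg)
      qed (use r in \<open>auto simp: b_def intro!: prod.cong\<close>)
      also have "\<dots> = r * (s + r) ^ (N - 1)"
        by (subst prod.remove[of _ i]) (auto simp: N_def card_Diff_singleton)
      also have "\<dots> \<le> r * (2 * s) ^ (N - 1)"
        using r by (intro mult_left_mono power_mono) auto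
      finally show "measure lebesgue (B i) \<le> r * (2 * s) ^ (N - 1)" .
    qed
    have "integrable lebesgue \<Gamma>"
      unfolding \<Gamma>_def by (intro Bochner_Integration.integrable_sum integrable_mult_right Bochner_Integration.integrable_add intA)
    moreover have "(LINT x|lebesgue. \<Gamma> x) \<le> real N * (4 * M * 2 ^ (N - 1)) * s ^ (N - 1)"
    proof -
      have "(LINT x|lebesgue. \<Gamma> x) = (\<Sum>i\<in>UNIV. 2 * M / r * (measure lebesgue (A i) + measure lebesgue (B i)))"
        unfolding \<Gamma>_def using intA by (simp add: Bochner_Integration.integral_sum)
      also have "\<dots> \<le> (\<Sum>i\<in>(UNIV::'n set). 2 * M / r * (r * (2 * s) ^ (N - 1) + r * (2 * s) ^ (N - 1)))"
        using r M m by (intro sum_mono mult_left_mono add_mono) auto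
      also have "\<dots> = real N * (4 * M * 2 ^ (N - 1)) * s ^ (N - 1)"
        using r by (simp add: N_def power_mult_distrib)
      finally show ?thesis .
    qed
    moreover have "0 \<le> \<Gamma> x" for x
      unfolding \<Gamma>_def using r M by (intro sum_nonneg mult_nonneg_nonneg) auto
    moreover have "\<bar>frechet_derivative (plateau a (a + vec s) r) (at x) v\<bar> \<le> \<Gamma> x * norm v" for x v
    proof -
      have "frechet_derivative (plateau a b r) (at x) v = (\<Sum>i\<in>UNIV. plateau_partial a b r i x * v $ i)"
        by (subst frechet_derivative_at[OF plateau_has_derivative[OF r(1) ab], symmetric]) simp
      also have "\<bar>\<dots>\<bar> \<le> (\<Sum>i\<in>UNIV. \<bar>plateau_partial a b r i x * v $ i\<bar>)" by (rule sum_abs)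
      also have "\<dots> \<le> (\<Sum>i\<in>UNIV. 2 * M / r * (indicat_real (A i) x + indicat_real (B i) x) * norm v)"
        unfolding abs_mult A_def B_def using plateau_partial_bound[OF r(1) ab M(2)] component_le_norm_cart[of v] r M
        by (intro sum_mono mult_mono) auto
      finally show ?thesis by (simp add: \<Gamma>_def sum_distrib_right b_def)
    qed
    ultimately show "\<exists>\<Gamma>. integrable lebesgue \<Gamma> \<and> (LINT x|lebesgue. \<Gamma> x) \<le> real N * (4 * M * 2 ^ (N - 1)) * s ^ (CARD('n) - 1) \<and>
         (\<forall>x. 0 \<le> \<Gamma> x) \<and> (\<forall>x v. \<bar>frechet_derivative (plateau a (a + vec s) r) (at x) v\<bar> \<le> \<Gamma> x * norm v)"
      unfolding N_def by blast
  qed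
qed


section \<open>Splitting of plateaus and bisection of cubes\<close>

text \<open>In each coordinate the factor telescopes through the point \<open>m $ i\<close>;
  expanding the product gives one term for each set \<open>A\<close> of coordinates in which the
  lower half is chosen.\<close>

lemma plateau_split:
  fixes a b m x :: "real ^ 'n"
  shows "plateau a b r x = (\<Sum>A\<in>Pow UNIV. plateau (\<chi> i. if i \<in> A then a $ i else m $ i)
     (\<chi> i. if i \<in> A then m $ i else b $ i) r x)"
proof -
  define T where "T c i = smooth_step ((x $ i - c $ i) / r)" for c :: "real ^ 'n" and i
  have "plateau a b r x = (\<Prod>i\<in>UNIV. (T a i - T m i) + (T m i - T b i))"
    by (simp add: plateau_def T_def)
  also have "\<dots> = (\<Sum>A\<in>Pow UNIV. (\<Prod>i\<in>A. T a i - T m i) * (\<Prod>i\<in>UNIV - A. T m i - T b i))"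
    by (rule prod_add) simp
  also have "\<dots> = (\<Sum>A\<in>Pow UNIV. \<Prod>i\<in>UNIV. if i \<in> A then T a i - T m i else T m i - T b i)"
    by (simp add: prod.If_cases Compl_eq_Diff_UNIV)
  also have "\<dots> = (\<Sum>A\<in>Pow UNIV. plateau (\<chi> i. if i \<in> A then a $ i else m $ i)
     (\<chi> i. if i \<in> A then m $ i else b $ i) r x)"
    unfolding plateau_def T_def by (intro sum.cong prod.cong) auto
  finally show ?thesis .
qed

definition subcube :: "real ^ 'n \<Rightarrow> real \<Rightarrow> 'n set \<Rightarrow> real ^ 'n" where
  "subcube a s A = (\<chi> i. if i \<in> A then a $ i else a $ i + s / 2)"

lemma plateau_cube_split:
  "plateau a (a + vec s) r x
    = (\<Sum>A\<in>Pow UNIV. plateau (subcube a s A) (subcube a s A + vec (s / 2)) r x)"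
proof -
  have "(\<chi> i. if i \<in> A then a $ i else (a + vec (s / 2)) $ i) = subcube a s A" for A
    by (simp add: subcube_def vec_eq_iff)
  moreover have "(\<chi> i. if i \<in> A then (a + vec (s / 2)) $ i else (a + vec s) $ i)
      = subcube a s A + vec (s / 2)" for A
    by (simp add: subcube_def vec_eq_iff)
  ultimately show ?thesis
    using plateau_split[of a "a + vec s" r x "a + vec (s / 2)"] by simp
qed

lemma subcube_subset:
  assumes "0 \<le> s"
  shows "cbox (subcube a s A) (subcube a s A + vec (s / 2)) \<subseteq> cbox a (a + vec s)"
proof
  fix x assume x: "x \<in> cbox (subcube a s A) (subcube a s A + vec (s / 2))"
  show "x \<in> cbox a (a + vec s)"
    unfolding mem_box_cart
  proof
    fix i
    show "a $ i \<le> x $ i \<and> x $ i \<le> (a + vec s) $ i"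
      using x[unfolded mem_box_cart, rule_format, of i] assms
      by (cases "i \<in> A") (auto simp: subcube_def)
  qed
qed

text \<open>Dependent choice selects one child at each step, and compactness of the nested cubes
  gives the common point.\<close>

lemma cube_bisection:
  fixes P :: "real ^ 'n \<Rightarrow> real \<Rightarrow> bool"
  assumes start: "P a s" and s: "0 < s"
    and step: "\<And>a s. 0 < s \<Longrightarrow> P a s \<Longrightarrow> \<exists>A. P (subcube a s A) (s / 2)"
  obtains x c where "\<And>n. P (c n) (s / 2 ^ n)" "\<And>n. x \<in> cbox (c n) (c n + vec (s / 2 ^ n))"
proof -
  have "\<exists>c. \<forall>n. P (c n) (s / 2 ^ n) \<and> (\<exists>A. c (Suc n) = subcube (c n) (s / 2 ^ n) A)"
  proof (rule dependent_nat_choice)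
    show "\<exists>x. P x (s / 2 ^ 0)" using start by auto
  next
    fix y n assume "P y (s / 2 ^ n)"
    from step[OF _ this] s obtain A where "P (subcube y (s / 2 ^ n) A) (s / 2 ^ n / 2)" by auto
    then show "\<exists>z. P z (s / 2 ^ Suc n) \<and> (\<exists>A. z = subcube y (s / 2 ^ n) A)"
      by (auto simp: mult.commute)
  qed
  then obtain c where c: "\<And>n. P (c n) (s / 2 ^ n)" "\<And>n. \<exists>A. c (Suc n) = subcube (c n) (s / 2 ^ n) A"
    by blast
  define Q where "Q n = cbox (c n) (c n + vec (s / 2 ^ n))" for n
  have "Q (Suc n) \<subseteq> Q n" for n
  proof -
    obtain A where "c (Suc n) = subcube (c n) (s / 2 ^ n) A" using c(2) by blast
    then show ?thesis
      using subcube_subset[of "s / 2 ^ n" "c n" A] s by (simp add: Q_def mult.commute)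
  qed
  then have "Q n \<subseteq> Q m" if "m \<le> n" for m n
    using that by (rule lift_Suc_antimono_le)
  moreover have "compact (Q n)" "Q n \<noteq> {}" for n
    using s by (auto simp: Q_def interval_eq_empty_cart not_less)
  ultimately have "\<Inter>(range Q) \<noteq> {}" by (intro compact_nest) auto
  then obtain x where "\<And>n. x \<in> Q n" by blast
  then show ?thesis using that c(1) unfolding Q_def by blast
qed

section \<open>Locally bounded functions and lower semicontinuous majorants\<close>

lemma integrable_bounded_compact_support:
  fixes h :: "'a::euclidean_space \<Rightarrow> real"
  assumes "h \<in> borel_measurable lebesgue" "compact S" "\<And>x. x \<notin> S \<Longrightarrow> h x = 0"
    and "AE x in lebesgue. x \<in> S \<longrightarrow> \<bar>h x\<bar> \<le> B"
  shows "integrable lebesgue h"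
proof (rule Bochner_Integration.integrable_bound)
  have "S \<in> lmeasurable" using assms(2) by (rule lmeasurable_compact)
  then show "integrable lebesgue (\<lambda>x. B * indicat_real S x)"
    by (intro integrable_mult_right integrable_real_indicator) (auto simp: fmeasurable_def)
  show "AE x in lebesgue. norm (h x) \<le> norm (B * indicat_real S x)"
    using assms(4) by eventually_elim (use assms(3) in \<open>auto simp: indicator_def\<close>)
qed fact

lemma Linfty_loc_bound:
  assumes "Linfty_loc g" "compact S"
  obtains B where "0 \<le> B" "AE x in lebesgue. x \<in> S \<longrightarrow> \<bar>g x\<bar> \<le> B"
proof -
  obtain B where "AE x in lebesgue. x \<in> S \<longrightarrow> \<bar>g x\<bar> \<le> B"
    using assms by (auto simp: Linfty_loc_def)
  then have "AE x in lebesgue. x \<in> S \<longrightarrow> \<bar>g x\<bar> \<le> max B 0"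
    by eventually_elim auto
  then show ?thesis using that[of "max B 0"] by auto
qed

lemma continuous_imp_lebesgue_measurable:
  fixes f :: "'a::euclidean_space \<Rightarrow> 'b::topological_space"
  assumes "continuous_on UNIV f"
  shows "f \<in> borel_measurable lebesgue"
  using measurable_completion[of f lborel borel] borel_measurable_continuous_onI[OF assms] by simp

lemma continuous_bound_compact:
  fixes f :: "'a::euclidean_space \<Rightarrow> 'b::real_normed_vector"
  assumes "continuous_on UNIV f" "compact S"
  obtains B where "0 < B" "\<And>x. x \<in> S \<Longrightarrow> norm (f x) \<le> B"
proof -
  have "bounded (f ` S)"
    using assms by (intro compact_imp_bounded compact_continuous_image) (auto intro: continuous_on_subset)
  then show ?thesis using that by (auto simp: bounded_pos)
qed

text \<open>As in the Vitali--Caratheodory theorem, the superlevel sets of \<open>h\<close> on a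
  fine grid of heights are enlarged to open sets.\<close>

lemma lower_semicontinuous_majorant:
  fixes h :: "'a::euclidean_space \<Rightarrow> real"
  assumes h: "h \<in> borel_measurable lebesgue" and M: "\<And>x. \<bar>h x\<bar> \<le> M"
    and S: "S \<in> lmeasurable" and e: "0 < e"
  obtains H B where "H \<in> borel_measurable lebesgue" "\<And>x. \<bar>H x\<bar> \<le> B" "\<And>x. h x \<le> H x"
    "\<And>x. \<forall>\<^sub>F y in nhds x. H x \<le> H y"
    "(LINT x|lebesgue. indicat_real S x * (H x - h x)) \<le> e"
proof -
  \<comment> \<open>Half of the error \<open>e\<close> pays for rounding up to the grid of height
    \<open>\<delta>\<close> over \<open>S\<close>, the other half for the \<open>n\<close>
    enlargements, each costing \<open>\<delta> * \<eta>\<close>. The 1 avoids division by zero when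
    \<open>S\<close> is a null set.\<close>
  define \<delta> where "\<delta> = e / (2 * (measure lebesgue S + 1))"
  have \<delta>: "0 < \<delta>" using e by (auto simp: \<delta>_def intro!: divide_pos_pos add_nonneg_pos)
  have "0 \<le> M" using M[of undefined] by linarith
  obtain n :: nat where n: "2 * M / \<delta> < n" using reals_Archimedean2 by blast
  then have "0 < n" using \<delta> \<open>0 \<le> M\<close> by (metis divide_nonneg_pos gr0I mult_nonneg_nonneg not_less of_nat_0 zero_le_numeral)
  define T where "T k = {x. real k * \<delta> < h x + M}" for k
  have T: "T k \<in> sets lebesgue" for k
  proof -
    have "{x \<in> space lebesgue. real k * \<delta> < h x + M} \<in> sets lebesgue" using h by measurable
    then show ?thesis by (simp add: T_def)
  qed
  define \<eta> where "\<eta> = e / (2 * real n * \<delta>)"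
  have "0 < \<eta>" using e \<delta> \<open>0 < n\<close> by (simp add: \<eta>_def)
  then have "\<exists>U. open U \<and> T k \<subseteq> U \<and> U - T k \<in> lmeasurable \<and> emeasure lebesgue (U - T k) < ennreal \<eta>" for k
    using sets_lebesgue_outer_open[OF T] by metis
  then obtain U where U: "\<And>k. open (U k)" "\<And>k. T k \<subseteq> U k" "\<And>k. U k - T k \<in> lmeasurable"
    "\<And>k. emeasure lebesgue (U k - T k) < ennreal \<eta>" by metis
  define H where "H x = - M + \<delta> * (\<Sum>k<n. indicat_real (U k) x)" for x
  \<comment> \<open>The sum counts the grid heights strictly below h + M, so \<open>\<delta>\<close>
    times the sum is h + M rounded up to a multiple of \<open>\<delta>\<close>.\<close>
  have count: "h x + M \<le> \<delta> * (\<Sum>k<n. indicat_real (T k) x)"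
    "\<delta> * (\<Sum>k<n. indicat_real (T k) x) \<le> h x + M + \<delta>" for x
  proof -
    define t where "t = (h x + M) / \<delta>"
    have t: "0 \<le> t" "t < n"
      using M[of x] \<delta> n by (auto simp: t_def field_simps abs_le_iff)
    have "{..<n} \<inter> {k. x \<in> T k} = {..<nat \<lceil>t\<rceil>}"
    proof (intro set_eqI)
      fix k
      have "x \<in> T k \<longleftrightarrow> real k < t" using \<delta> by (simp add: T_def t_def pos_less_divide_eq)
      moreover have "k < nat \<lceil>t\<rceil> \<longleftrightarrow> real k < t"
        by (simp add: zless_nat_eq_int_zless less_ceiling_iff)
      ultimately show "k \<in> {..<n} \<inter> {k. x \<in> T k} \<longleftrightarrow> k \<in> {..<nat \<lceil>t\<rceil>}"
        using t by auto
    qed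
    then have "(\<Sum>k<n. indicat_real (T k) x) = real (nat \<lceil>t\<rceil>)"
      by (simp add: indicator_def sum.If_cases)
    moreover have "t \<le> real (nat \<lceil>t\<rceil>)" "real (nat \<lceil>t\<rceil>) \<le> t + 1" using t by linarith+
    ultimately show "h x + M \<le> \<delta> * (\<Sum>k<n. indicat_real (T k) x)"
      "\<delta> * (\<Sum>k<n. indicat_real (T k) x) \<le> h x + M + \<delta>"
      using \<delta> by (auto simp: t_def field_simps)
  qed
  show ?thesis
  proof (rule that[of H "M + \<delta> * n"])
    have "U k \<in> sets lebesgue" for k using U(1) by auto
    then show "H \<in> borel_measurable lebesgue" unfolding H_def by measurable
    fix x
    have "0 \<le> (\<Sum>k<n. indicat_real (U k) x)"
      by (intro sum_nonneg) simp
    moreover have "(\<Sum>k<n. indicat_real (U k) x) \<le> (\<Sum>k<n. 1)"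
      by (intro sum_mono) (simp add: indicator_def)
    ultimately have "0 \<le> \<delta> * (\<Sum>k<n. indicat_real (U k) x)" "\<delta> * (\<Sum>k<n. indicat_real (U k) x) \<le> \<delta> * n"
      using \<delta> by auto
    then show "\<bar>H x\<bar> \<le> M + \<delta> * n"
      unfolding H_def using \<open>0 \<le> M\<close> by linarith
    have TU: "(\<Sum>k<n. indicat_real (T k) x) \<le> (\<Sum>k<n. indicat_real (U k) x)"
      using U(2) by (intro sum_mono) (auto simp: indicator_def)
    then have "\<delta> * (\<Sum>k<n. indicat_real (T k) x) \<le> \<delta> * (\<Sum>k<n. indicat_real (U k) x)"
      using \<delta> by simp
    then show "h x \<le> H x" using count(1)[of x] unfolding H_def by linarith
    \<comment> \<open>Finitely many open sets: a point near x lies in every \<open>U k\<close> that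
      contains x. This gives lower semicontinuity without any loss.\<close>
    have "\<forall>\<^sub>F y in nhds x. \<forall>k\<in>{..<n}. x \<in> U k \<longrightarrow> y \<in> U k"
      using U(1) by (intro eventually_ball_finite) (auto intro: eventually_nhds_in_open)
    then show "\<forall>\<^sub>F y in nhds x. H x \<le> H y"
    proof eventually_elim
      case (elim y)
      then have "(\<Sum>k<n. indicat_real (U k) x) \<le> (\<Sum>k<n. indicat_real (U k) y)"
        by (intro sum_mono) (auto simp: indicator_def)
      then show ?case using \<delta> by (simp add: H_def)
    qed
  next
    have S': "S \<in> sets lebesgue" "emeasure lebesgue S < \<infinity>" using S by (auto simp: fmeasurable_def)
    have intU: "integrable lebesgue (indicat_real (U k - T k))" for k
      using U(3)[of k] by (intro integrable_real_indicator) (auto simp: fmeasurable_def)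
    have intS: "integrable lebesgue (indicat_real S)"
      using S' by (intro integrable_real_indicator) auto
    have m: "measure lebesgue (U k - T k) \<le> \<eta>" for k
      using U(4)[of k] \<open>0 < \<eta>\<close> by (simp add: measure_def enn2real_leI less_imp_le)
    have le: "indicat_real S x * (H x - h x) \<le> \<delta> * indicat_real S x + \<delta> * (\<Sum>k<n. indicat_real (U k - T k) x)" for x
    proof -
      have "(\<Sum>k<n. indicat_real (U k) x) = (\<Sum>k<n. indicat_real (T k) x) + (\<Sum>k<n. indicat_real (U k - T k) x)"
        unfolding sum.distrib[symmetric] using U(2) by (intro sum.cong) (auto simp: indicator_def)
      then have "H x - h x \<le> \<delta> + \<delta> * (\<Sum>k<n. indicat_real (U k - T k) x)"
        using count(2)[of x] by (simp add: H_def algebra_simps)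
      moreover have "0 \<le> \<delta> * (\<Sum>k<n. indicat_real (U k - T k) x)"
        using \<delta> by (auto intro!: mult_nonneg_nonneg sum_nonneg)
      ultimately show ?thesis by (auto simp: indicator_def)
    qed
    have "(LINT x|lebesgue. indicat_real S x * (H x - h x))
        \<le> (LINT x|lebesgue. \<delta> * indicat_real S x + \<delta> * (\<Sum>k<n. indicat_real (U k - T k) x))"
      using \<open>0 < e\<close> \<delta> le
      by (intro Bochner_Integration.integral_mono' Bochner_Integration.integrable_add integrable_mult_right
          Bochner_Integration.integrable_sum intU intS) (auto intro!: add_nonneg_nonneg mult_nonneg_nonneg sum_nonneg)
    also have "\<dots> = \<delta> * measure lebesgue S + \<delta> * (\<Sum>k<n. measure lebesgue (U k - T k))"
      using intU intS by (simp add: Bochner_Integration.integral_sum)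
    also have "\<dots> \<le> \<delta> * measure lebesgue S + \<delta> * (\<Sum>k<n. \<eta>)"
      using \<delta> m by (intro add_left_mono mult_left_mono sum_mono) auto
    also have "\<dots> \<le> e / 2 + e / 2"
    proof (rule add_mono)
      have "\<delta> * measure lebesgue S \<le> \<delta> * (measure lebesgue S + 1)" using \<delta> by simp
      also have "\<dots> = e / 2"
      proof -
        have "measure lebesgue S + 1 \<noteq> 0" using measure_nonneg[of lebesgue S] by linarith
        then show ?thesis unfolding \<delta>_def times_divide_eq_left
          by (rule nonzero_mult_divide_mult_cancel_right)
      qed
      finally show "\<delta> * measure lebesgue S \<le> e / 2" .
      show "\<delta> * (\<Sum>k<n. \<eta>) \<le> e / 2" using \<delta> \<open>0 < n\<close> by (simp add: \<eta>_def)
    qed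
    finally show "(LINT x|lebesgue. indicat_real S x * (H x - h x)) \<le> e" by simp
  qed
qed

section \<open>Derivatives along a vector field\<close>

lemma vf_deriv_eq:
  assumes "(w has_derivative w') (at x)"
  shows "vf_deriv Y w x = w' (Y x)"
  using frechet_derivative_at[OF assms] by (simp add: vf_deriv_def)

lemma vf_deriv_cong_open:
  assumes "open U" "x \<in> U" "\<And>y. y \<in> U \<Longrightarrow> f y = (g y :: real)"
  shows "vf_deriv Y f x = vf_deriv Y g x"
  unfolding vf_deriv_def frechet_derivative_def
  using has_derivative_cong_open[OF assms] by simp

lemma vf_deriv_eq_0_open:
  assumes "open U" "x \<in> U" "\<And>y. y \<in> U \<Longrightarrow> f y = (c :: real)"
  shows "vf_deriv Y f x = 0"
  using vf_deriv_cong_open[where f = f and g = "\<lambda>_. c", OF assms]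
    vf_deriv_eq[of "\<lambda>x. c" "\<lambda>v. 0" x Y] by simp

text \<open>A derivative that exists everywhere need not be continuous, but it is the pointwise
  limit of the continuous difference quotients along \<open>Y x\<close> with step 1/(n+1).\<close>

lemma vf_deriv_measurable:
  assumes "\<And>x. w differentiable (at x)" "continuous_on UNIV Y"
  shows "vf_deriv Y w \<in> borel_measurable lebesgue"
proof (rule borel_measurable_LIMSEQ_real)
  have w: "continuous_on UNIV w"
    using assms(1) by (intro differentiable_imp_continuous_on) (simp add: differentiable_on_def)
  have Y: "continuous_on UNIV Y" by fact
  fix n
  show "(\<lambda>x. (w (x + (1 / real (Suc n)) *\<^sub>R Y x) - w x) * real (Suc n)) \<in> borel_measurable lebesgue"
    by (intro continuous_imp_lebesgue_measurable continuous_intros Y w continuous_on_compose2[OF w]) auto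
next
  fix x
  have "((\<lambda>t. w (x + t *\<^sub>R Y x)) has_derivative (\<lambda>t. frechet_derivative w (at x) (t *\<^sub>R Y x))) (at 0)"
  proof (rule has_derivative_compose[where f = "\<lambda>t. x + t *\<^sub>R Y x"])
    show "((\<lambda>t. x + t *\<^sub>R Y x) has_derivative (\<lambda>t. t *\<^sub>R Y x)) (at 0)"
      by (auto intro!: derivative_eq_intros)
    show "(w has_derivative frechet_derivative w (at x)) (at (x + 0 *\<^sub>R Y x))"
      using assms(1) by (simp flip: frechet_derivative_works)
  qed
  moreover have "frechet_derivative w (at x) (t *\<^sub>R Y x) = vf_deriv Y w x * t" for t
    using linear_frechet_derivative[OF assms(1), of x] by (simp add: vf_deriv_def linear_cmul)
  ultimately have "((\<lambda>t. w (x + t *\<^sub>R Y x)) has_real_derivative vf_deriv Y w x) (at 0)"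
    by (simp add: has_field_derivative_def)
  then have "((\<lambda>h. (w (x + h *\<^sub>R Y x) - w x) / h) \<longlongrightarrow> vf_deriv Y w x) (at 0)"
    by (simp add: DERIV_def)
  moreover have "filterlim (\<lambda>n. 1 / real (Suc n)) (at 0) sequentially"
    using LIMSEQ_Suc[OF lim_1_over_n] by (auto simp: filterlim_at intro!: eventuallyI)
  ultimately have "(\<lambda>n. (w (x + (1 / real (Suc n)) *\<^sub>R Y x) - w x) / (1 / real (Suc n)))
      \<longlonglongrightarrow> vf_deriv Y w x"
    by (rule filterlim_compose)
  then show "(\<lambda>n. (w (x + (1 / real (Suc n)) *\<^sub>R Y x) - w x) * real (Suc n)) \<longlonglongrightarrow> vf_deriv Y w x"
    by simp
qed


text \<open>Smoothness gives continuity of the derivative in a fixed direction; the variable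
  direction \<open>Y x\<close> is therefore expanded in the basis.\<close>

lemma vf_deriv_continuous:
  assumes "smooth \<psi>" "continuous_on UNIV Y"
  shows "continuous_on UNIV (vf_deriv Y \<psi>)"
proof -
  have lin: "linear (frechet_derivative \<psi> (at x))" for x
    by (rule linear_frechet_derivative[OF smooth_differentiable[OF assms(1)]])
  have "vf_deriv Y \<psi> x = (\<Sum>b\<in>Basis. (Y x \<bullet> b) * frechet_derivative \<psi> (at x) b)" for x
  proof -
    have "frechet_derivative \<psi> (at x) (\<Sum>b\<in>Basis. (Y x \<bullet> b) *\<^sub>R b) =
      (\<Sum>b\<in>Basis. frechet_derivative \<psi> (at x) ((Y x \<bullet> b) *\<^sub>R b))"
      by (rule linear_sum[OF lin])
    then show ?thesis
      by (simp add: euclidean_representation vf_deriv_def linear_cmul[OF lin])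
  qed
  then show ?thesis
    by (simp add: continuous_intros smooth_continuous_derivative assms)
qed

lemma closed_supp: "closed (supp f)"
  by (simp add: supp_def)

lemma not_in_supp: "x \<notin> supp f \<Longrightarrow> f x = 0"
  using closure_subset[of "{x. f x \<noteq> 0}"] by (auto simp: supp_def)

lemma vf_deriv_not_in_supp: "x \<notin> supp f \<Longrightarrow> vf_deriv Y f x = 0"
  by (rule vf_deriv_eq_0_open[of "- supp f" x f 0]) (auto intro: not_in_supp open_Compl simp: closed_supp)

section \<open>Closure properties of locally essentially bounded functions\<close>

lemma Linfty_loc_continuous: "continuous_on UNIV f \<Longrightarrow> Linfty_loc f"
  unfolding Linfty_loc_def
proof (intro conjI allI impI continuous_imp_lebesgue_measurable)
  fix S :: "'a set"
  assume "continuous_on UNIV f" "compact S"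
  then obtain B where "\<And>x. x \<in> S \<Longrightarrow> norm (f x) \<le> B" using continuous_bound_compact by metis
  then show "\<exists>B. AE x in lebesgue. x \<in> S \<longrightarrow> \<bar>f x\<bar> \<le> B" by (intro exI[of _ B]) auto
qed

lemma Linfty_loc_add:
  assumes "Linfty_loc f" "Linfty_loc g" shows "Linfty_loc (\<lambda>x. f x + g x)"
  unfolding Linfty_loc_def
proof (intro conjI allI impI borel_measurable_add)
  fix S :: "'a set" assume S: "compact S"
  obtain A where A: "AE x in lebesgue. x \<in> S \<longrightarrow> \<bar>f x\<bar> \<le> A" using Linfty_loc_bound[OF assms(1) S] .
  obtain B where B: "AE x in lebesgue. x \<in> S \<longrightarrow> \<bar>g x\<bar> \<le> B" using Linfty_loc_bound[OF assms(2) S] .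
  have "AE x in lebesgue. x \<in> S \<longrightarrow> \<bar>f x + g x\<bar> \<le> A + B" using A B by eventually_elim auto
  then show "\<exists>B. AE x in lebesgue. x \<in> S \<longrightarrow> \<bar>f x + g x\<bar> \<le> B" ..
qed (use assms in \<open>auto simp: Linfty_loc_def\<close>)

lemma Linfty_loc_mult:
  assumes "Linfty_loc f" "Linfty_loc g" shows "Linfty_loc (\<lambda>x. f x * g x)"
  unfolding Linfty_loc_def
proof (intro conjI allI impI borel_measurable_times)
  fix S :: "'a set" assume S: "compact S"
  obtain A where A: "0 \<le> A" "AE x in lebesgue. x \<in> S \<longrightarrow> \<bar>f x\<bar> \<le> A" using Linfty_loc_bound[OF assms(1) S] .
  obtain B where B: "AE x in lebesgue. x \<in> S \<longrightarrow> \<bar>g x\<bar> \<le> B" using Linfty_loc_bound[OF assms(2) S] .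
  have "AE x in lebesgue. x \<in> S \<longrightarrow> \<bar>f x * g x\<bar> \<le> A * B"
    using A(2) B by eventually_elim (use A(1) in \<open>auto simp: abs_mult intro!: mult_mono\<close>)
  then show "\<exists>B. AE x in lebesgue. x \<in> S \<longrightarrow> \<bar>f x * g x\<bar> \<le> B" ..
qed (use assms in \<open>auto simp: Linfty_loc_def\<close>)

lemma Linfty_loc_locally_bounded:
  assumes "f \<in> borel_measurable lebesgue" "\<And>S. compact S \<Longrightarrow> \<exists>B. \<forall>x\<in>S. \<bar>f x\<bar> \<le> B"
  shows "Linfty_loc f"
  unfolding Linfty_loc_def
proof (intro conjI allI impI)
  fix S :: "'a set" assume "compact S"
  then obtain B where "\<forall>x\<in>S. \<bar>f x\<bar> \<le> B" using assms(2) by blast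
  then show "\<exists>B. AE x in lebesgue. x \<in> S \<longrightarrow> \<bar>f x\<bar> \<le> B" by (intro exI[of _ B]) auto
qed fact

lemma integrable_Linfty_loc_compact:
  assumes "Linfty_loc f" "compact S" "\<And>x. x \<notin> S \<Longrightarrow> f x = 0"
  shows "integrable lebesgue f"
proof -
  obtain B where "AE x in lebesgue. x \<in> S \<longrightarrow> \<bar>f x\<bar> \<le> B" using Linfty_loc_bound[OF assms(1,2)] .
  with assms show ?thesis
    by (intro integrable_bounded_compact_support[of f S B]) (auto simp: Linfty_loc_def)
qed

section \<open>Pairing a weak derivative with a differentiable function\<close>

lemma cbox_cube_norm_le:
  fixes a x y :: "real ^ 'n"
  assumes "x \<in> cbox a (a + vec t)" "y \<in> cbox a (a + vec t)"
  shows "norm (y - x) \<le> real CARD('n) * t"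
proof -
  have "norm (y - x) \<le> (\<Sum>i\<in>UNIV. \<bar>(y - x) $ i\<bar>)" by (rule norm_le_l1_cart)
  also have "\<dots> \<le> (\<Sum>i\<in>(UNIV :: 'n set). t)"
  proof (rule sum_mono)
    fix i
    show "\<bar>(y - x) $ i\<bar> \<le> t"
      using assms[unfolded mem_box_cart, THEN spec, of i] by (auto simp: abs_le_iff)
  qed
  finally show ?thesis by simp
qed

lemma cbox_cube_mono:
  fixes a :: "real ^ 'n"
  assumes "s \<le> t" shows "cbox a (a + vec s) \<subseteq> cbox a (a + vec t)"
proof
  fix x assume "x \<in> cbox a (a + vec s)"
  then show "x \<in> cbox a (a + vec t)"
    using assms unfolding mem_box_cart by (metis add_left_mono order_trans vec_component vector_add_component)
qed

lemma measure_cube: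
  assumes "0 \<le> t"
  shows "measure lebesgue (cbox a (a + vec t :: real ^ 'n)) = t ^ CARD('n)"
proof -
  have "cbox a (a + vec t) \<noteq> {}" using assms by (auto simp: interval_eq_empty_cart not_less)
  then show ?thesis by (simp add: measure_cbox_lebesgue content_cbox_cart)
qed

lemma test_function_plateau:
  assumes "0 < r" "0 \<le> s" shows "test_function (plateau a (a + vec s) r)"
  using plateau_mult_test_function[of r a "a + vec s" "\<lambda>_. 1"] assms
  by (simp add: smooth_def Ck_const)

locale distr_pairing =
  fixes Y :: "real ^ 'n \<Rightarrow> real ^ 'n" and f g :: "real ^ 'n \<Rightarrow> real"
  assumes Y: "continuous_on UNIV Y" and Y_div: "\<And>x. vf_div Y x = 0"
    and f: "continuous_on UNIV f" and g: "Linfty_loc g" and fg: "has_distr_deriv Y f g"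
begin

lemma Y_bounded: assumes "compact S" obtains B where "0 < B" "\<And>x. x \<in> S \<Longrightarrow> norm (Y x) \<le> B"
  using continuous_bound_compact[OF Y assms] by metis

text \<open>With \<open>H = f * vf_deriv Y w\<close> this is the integrand of \<open>\<integral> f Y (\<psi> w) + g \<psi> w\<close>; below \<open>H\<close> is a
  lower semicontinuous majorant of that product.\<close>

definition weak_defect :: "(real ^ 'n \<Rightarrow> real) \<Rightarrow> (real ^ 'n \<Rightarrow> real) \<Rightarrow> (real ^ 'n \<Rightarrow> real) \<Rightarrow> real ^ 'n \<Rightarrow> real" where
  "weak_defect w H \<psi> x = f x * w x * vf_deriv Y \<psi> x + \<psi> x * (H x + g x * w x)"

lemma weak_defect_integrable:
  assumes w: "continuous_on UNIV w" and H: "Linfty_loc H" and \<psi>: "test_function \<psi>"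
  shows "integrable lebesgue (weak_defect w H \<psi>)"
proof (rule integrable_Linfty_loc_compact)
  have sm: "smooth \<psi>" using \<psi> by (simp add: test_function_def)
  show "Linfty_loc (weak_defect w H \<psi>)"
    unfolding weak_defect_def[abs_def]
    by (intro Linfty_loc_add Linfty_loc_mult g Linfty_loc_continuous f w H
        smooth_continuous sm vf_deriv_continuous Y)
  show "compact (supp \<psi>)" using \<psi> by (simp add: test_function_def)
  show "weak_defect w H \<psi> x = 0" if "x \<notin> supp \<psi>" for x
    using that by (simp add: weak_defect_def not_in_supp vf_deriv_not_in_supp)
qed

text \<open>An affine function times a test function is again a test function, and since
  \<open>Y\<close> has divergence zero the integrand is exactly the difference of the two sides in
  the definition of the weak derivative.\<close>

lemma weak_defect_affine:
  assumes D: "bounded_linear D" and \<psi>: "test_function \<psi>"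
    and l\<psi>: "test_function (\<lambda>x. (D x + c) * \<psi> x)"
  shows "(LINT x|lebesgue. weak_defect (\<lambda>x. D x + c) (\<lambda>x. f x * D (Y x)) \<psi> x) = 0"
proof -
  have sm: "smooth \<psi>" and S: "compact (supp \<psi>)" using \<psi> by (auto simp: test_function_def)
  have d: "((\<lambda>x. (D x + c) * \<psi> x) has_derivative
      (\<lambda>v. (D x + c) * frechet_derivative \<psi> (at x) v + D v * \<psi> x)) (at x)" for x
  proof (rule has_derivative_mult)
    show "((\<lambda>x. D x + c) has_derivative D) (at x)"
      using has_derivative_add[OF bounded_linear_imp_has_derivative[OF D] has_derivative_const[of c]] by simp
  qed (rule smooth_has_derivative[OF sm])
  have "weak_defect (\<lambda>x. D x + c) (\<lambda>x. f x * D (Y x)) \<psi> x =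
    - (f x * vf_adjoint Y (\<lambda>x. (D x + c) * \<psi> x) x) + g x * ((D x + c) * \<psi> x)" for x
    unfolding weak_defect_def vf_adjoint_def Y_div vf_deriv_eq[OF d] vf_deriv_def
    by (simp add: algebra_simps)
  moreover have "integrable lebesgue (\<lambda>x. g x * ((D x + c) * \<psi> x))"
    "integrable lebesgue (\<lambda>x. f x * vf_adjoint Y (\<lambda>x. (D x + c) * \<psi> x) x)"
  proof -
    let ?l = "\<lambda>x. (D x + c) * \<psi> x"
    have sml: "smooth ?l" and Sl: "compact (supp ?l)" using l\<psi> by (auto simp: test_function_def)
    show "integrable lebesgue (\<lambda>x. g x * ?l x)"
    proof (rule integrable_Linfty_loc_compact[OF _ Sl])
      show "g x * ?l x = 0" if "x \<notin> supp ?l" for x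
        using not_in_supp[OF that] by simp
    qed (intro Linfty_loc_mult g Linfty_loc_continuous smooth_continuous sml)
    show "integrable lebesgue (\<lambda>x. f x * vf_adjoint Y ?l x)"
    proof (rule integrable_Linfty_loc_compact[OF _ Sl])
      show "f x * vf_adjoint Y ?l x = 0" if "x \<notin> supp ?l" for x
        using vf_deriv_not_in_supp[OF that] by (simp add: vf_adjoint_def Y_div)
      show "Linfty_loc (\<lambda>x. f x * vf_adjoint Y ?l x)"
        unfolding vf_adjoint_def Y_div mult_zero_left diff_zero
        by (intro Linfty_loc_mult Linfty_loc_continuous f continuous_intros vf_deriv_continuous sml Y)
    qed
  qed
  ultimately show ?thesis
    using fg l\<psi> by (simp add: has_distr_deriv_def)
qed

text \<open>The affine function \<open>l\<close> times a plateau is a test function, so subtracting the first order Taylor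
  polynomial of \<open>w\<close> does not change the integral; afterwards the integrand is small.\<close>

lemma weak_defect_local_lower_bound:
  assumes w: "\<And>x. w differentiable (at x)" and H: "Linfty_loc H"
    and fH: "f x * vf_deriv Y w x \<le> H x" and lsc: "\<forall>\<^sub>F y in nhds x. H x \<le> H y"
    and \<epsilon>: "0 < \<epsilon>"
  shows "\<exists>s1>0. \<forall>a s r. 0 < r \<and> r \<le> s \<and> s < s1 \<and> x \<in> cbox a (a + vec s) \<longrightarrow>
    - \<epsilon> * s ^ CARD('n) \<le> (LINT y|lebesgue. weak_defect w H (plateau a (a + vec s) r) y)"
proof -
  define N where "N = CARD('n)"
  have N: "1 \<le> N" by (simp add: N_def Suc_leI)
  obtain M where M: "0 < M" "\<And>(a :: real ^ 'n) s r. 0 < r \<Longrightarrow> r \<le> s \<Longrightarrow>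
       \<exists>\<Gamma>. integrable lebesgue \<Gamma> \<and> (LINT x|lebesgue. \<Gamma> x) \<le> M * s ^ (CARD('n) - 1) \<and>
         (\<forall>x. 0 \<le> \<Gamma> x) \<and> (\<forall>x v. \<bar>frechet_derivative (plateau a (a + vec s) r) (at x) v\<bar> \<le> \<Gamma> x * norm v)"
    using plateau_deriv_mass by metis
  have c: "compact (cball x 1)" by simp
  obtain Mf where Mf: "0 < Mf" "\<And>y. y \<in> cball x 1 \<Longrightarrow> norm (f y) \<le> Mf"
    using continuous_bound_compact[OF f c] by metis
  obtain MY where MY: "0 < MY" "\<And>y. y \<in> cball x 1 \<Longrightarrow> norm (Y y) \<le> MY"
    using Y_bounded[OF c] by metis
  obtain Mg where Mg: "0 \<le> Mg" "AE y in lebesgue. y \<in> cball x 1 \<longrightarrow> \<bar>g y\<bar> \<le> Mg"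
    using Linfty_loc_bound[OF g c] .
  \<comment> \<open>The three sources of error, each proportional to \<open>\<eta>\<close> times
    s^N: the Taylor error against the derivative of the plateau, the gap between \<open>H\<close>
    and its continuous comparison function, and the Taylor error against \<open>g\<close>. The
    factor 2^N is the volume of the doubled cube \<open>Q\<close> relative to the cube of side
    s.\<close>
  define K where "K = 2 * N * Mf * MY * M + (1 + 2 * N * Mg) * 2 ^ N"
  have K: "0 < K" unfolding K_def using N Mf MY Mg M by (intro add_pos_nonneg mult_pos_pos mult_nonneg_nonneg add_nonneg_nonneg) auto
  define \<eta> where "\<eta> = \<epsilon> / K"
  have \<eta>: "0 < \<eta>" using \<epsilon> K by (simp add: \<eta>_def)
  define D where "D = frechet_derivative w (at x)"
  have wD: "(w has_derivative D) (at x)" using w by (simp add: D_def flip: frechet_derivative_works)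
  then have D: "bounded_linear D" by (rule has_derivative_bounded_linear)
  define l where "l y = D y + (w x - D x)" for y
  have "\<forall>\<^sub>F y in nhds x. \<bar>w y - l y\<bar> \<le> \<eta> * norm (y - x)"
  proof -
    from wD \<eta> obtain d where d: "0 < d" "\<And>y. norm (y - x) < d \<Longrightarrow> norm (w y - w x - D (y - x)) \<le> \<eta> * norm (y - x)"
      unfolding has_derivative_at_alt by blast
    have eq: "w y - l y = w y - w x - D (y - x)" for y
      using linear_diff[OF bounded_linear.linear[OF D], of y x] by (simp add: l_def)
    then have "\<bar>w y - l y\<bar> \<le> \<eta> * norm (y - x)" if "norm (y - x) < d" for y
      using d(2)[OF that] by (simp only: eq real_norm_def)
    with d(1) show ?thesis
      unfolding eventually_nhds_metric by (auto simp: dist_norm)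
  qed
  \<comment> \<open>With \<open>D\<close> frozen at x the left side is continuous in y, unlike
    \<open>f y * vf_deriv Y w y\<close>. At y = x it is at most \<open>H x\<close>, and
    \<open>lsc\<close> then replaces \<open>H x\<close> by \<open>H y\<close>.\<close>
  moreover have "\<forall>\<^sub>F y in nhds x. f y * D (Y y) < H x + \<eta>"
  proof -
    have "continuous_on UNIV (\<lambda>y. f y * D (Y y))"
      by (intro continuous_intros f continuous_on_compose2[OF linear_continuous_on[OF D]] Y) auto
    then have "((\<lambda>y. f y * D (Y y)) \<longlongrightarrow> f x * D (Y x)) (at x)"
      by (simp add: continuous_on_eq_continuous_at isCont_def)
    moreover have "f x * D (Y x) < H x + \<eta>"
      using fH \<eta> by (simp add: vf_deriv_def D_def)
    ultimately show ?thesis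
      using order_tendstoD(2) by (auto simp: eventually_nhds_conv_at)
  qed
  ultimately have "\<forall>\<^sub>F y in nhds x. \<bar>w y - l y\<bar> \<le> \<eta> * norm (y - x) \<and> - \<eta> \<le> H y - f y * D (Y y)"
    using lsc by eventually_elim auto
  then obtain \<delta> where \<delta>: "0 < \<delta>" "\<And>y. dist y x < \<delta> \<Longrightarrow> \<bar>w y - l y\<bar> \<le> \<eta> * norm (y - x)"
    "\<And>y. dist y x < \<delta> \<Longrightarrow> - \<eta> \<le> H y - f y * D (Y y)"
    unfolding eventually_nhds_metric by blast
  \<comment> \<open>The doubled cube has diameter at most 2Ns, so it stays within
    \<open>\<delta>\<close> of x and inside \<open>cball x 1\<close>.\<close>
  define s1 where "s1 = min \<delta> 1 / (2 * N)"
  show ?thesis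
  proof (intro exI[of _ s1] conjI allI impI; (elim conjE)?)
    show "0 < s1" using \<delta>(1) N by (simp add: s1_def)
    fix a :: "real ^ 'n" and s r :: real
    assume r: "0 < r" "r \<le> s" and s: "s < s1" and x: "x \<in> cbox a (a + vec s)"
    have s0: "0 < s" using r by simp
    have Ns: "2 * N * s < min \<delta> 1" using s N by (simp add: s1_def field_simps)
    have "1 * s \<le> real N * s" using N s0 by (intro mult_right_mono) auto
    then have s_le: "s \<le> 1" using Ns s0 by linarith
    define \<psi> where "\<psi> = plateau a (a + vec s) r"
    have ab: "a $ i \<le> (a + vec s) $ i" for i using s0 by simp
    have \<psi>: "test_function \<psi>" unfolding \<psi>_def using r by (intro test_function_plateau) auto
    have "smooth l"
      unfolding l_def[abs_def] smooth_def by (intro allI Ck_add Ck_const Ck_bounded_linear D)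
    then have l\<psi>: "test_function (\<lambda>y. l y * \<psi> y)"
      unfolding \<psi>_def by (intro plateau_mult_test_function r(1) ab)
    define Q where "Q = cbox a (a + vec (2 * s))"
    have xQ: "x \<in> Q" using x s0 cbox_cube_mono[of s "2 * s" a] by (auto simp: Q_def)
    have Q: "norm (y - x) \<le> 2 * N * s" if "y \<in> Q" for y
      using cbox_cube_norm_le[of x a "2 * s" y] that xQ by (simp add: Q_def N_def ac_simps)
    have supp\<psi>: "supp \<psi> \<subseteq> Q"
    proof (rule supp_subset_closed)
      show "closed Q" unfolding Q_def by (rule closed_cbox)
      fix y assume "\<psi> y \<noteq> 0"
      then have "y \<in> cbox a (a + vec s + vec r)" using plateau_eq_0_outside[OF r(1) ab] unfolding \<psi>_def by blast
      then show "y \<in> Q"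
        using r cbox_cube_mono[of "s + r" "2 * s" a] by (auto simp: Q_def add.assoc vec_add)
    qed
    obtain \<Gamma> where \<Gamma>: "integrable lebesgue \<Gamma>" "(LINT x|lebesgue. \<Gamma> x) \<le> M * s ^ (N - 1)"
         "\<And>x. 0 \<le> \<Gamma> x" "\<And>x v. \<bar>frechet_derivative \<psi> (at x) v\<bar> \<le> \<Gamma> x * norm v"
      using M(2)[OF r, of a] unfolding \<psi>_def N_def by blast
    have cw: "continuous_on UNIV w"
      using w by (intro differentiable_imp_continuous_on) (simp add: differentiable_on_def)
    have cl: "continuous_on UNIV l"
      unfolding l_def by (intro continuous_intros linear_continuous_on[OF D])
    have i1: "integrable lebesgue (weak_defect w H \<psi>)"
      by (rule weak_defect_integrable[OF cw H \<psi>])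
    have i2: "integrable lebesgue (weak_defect l (\<lambda>y. f y * D (Y y)) \<psi>)"
      by (intro weak_defect_integrable[OF cl _ \<psi>] Linfty_loc_continuous continuous_intros f
          continuous_on_compose2[OF linear_continuous_on[OF D]] Y) auto
    have "(LINT y|lebesgue. weak_defect l (\<lambda>y. f y * D (Y y)) \<psi> y) = 0"
      using weak_defect_affine[OF D \<psi>, of "w x - D x"] l\<psi> unfolding l_def by simp
    then have eq: "(LINT y|lebesgue. weak_defect w H \<psi> y)
        = (LINT y|lebesgue. weak_defect w H \<psi> y - weak_defect l (\<lambda>y. f y * D (Y y)) \<psi> y)"
      using i1 i2 by simp
    define low where "low y = Mf * (\<eta> * (2 * N * s)) * MY * \<Gamma> y + \<eta> * (1 + 2 * N * Mg) * indicat_real Q y" for y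
    have iQ: "integrable lebesgue (indicat_real Q)"
      unfolding Q_def by (rule integrable_real_indicator) (simp_all add: emeasure_lborel_cbox_finite[unfolded infinity_ennreal_def])
    have "integrable lebesgue low"
      unfolding low_def by (intro Bochner_Integration.integrable_add integrable_mult_right \<Gamma> iQ)
    have low_le: "(LINT y|lebesgue. low y) \<le> \<epsilon> * s ^ N"
    proof -
      have "(LINT y|lebesgue. low y) = Mf * (\<eta> * (2 * N * s)) * MY * (LINT y|lebesgue. \<Gamma> y) + \<eta> * (1 + 2 * N * Mg) * measure lebesgue Q"
        unfolding low_def using \<Gamma>(1) iQ by simp
      also have "\<dots> \<le> Mf * (\<eta> * (2 * N * s)) * MY * (M * s ^ (N - 1)) + \<eta> * (1 + 2 * N * Mg) * (2 * s) ^ N"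
      proof (rule add_mono)
        show "Mf * (\<eta> * (2 * N * s)) * MY * (LINT y|lebesgue. \<Gamma> y) \<le> Mf * (\<eta> * (2 * N * s)) * MY * (M * s ^ (N - 1))"
          using \<Gamma>(2) Mf(1) \<eta> s0 MY(1) by (intro mult_left_mono) auto
        show "\<eta> * (1 + 2 * N * Mg) * measure lebesgue Q \<le> \<eta> * (1 + 2 * N * Mg) * (2 * s) ^ N"
          using measure_cube[of "2 * s" a] s0 by (simp add: Q_def N_def)
      qed
      also have "\<dots> = \<eta> * K * s ^ N"
      proof -
        have "s * s ^ (N - 1) = s ^ N" using N by (simp flip: power_Suc)
        then show ?thesis unfolding K_def by (simp add: power_mult_distrib algebra_simps)
      qed
      also have "\<dots> = \<epsilon> * s ^ N" using K by (simp add: \<eta>_def)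
      finally show ?thesis .
    qed
    have "AE y in lebesgue. - low y \<le> weak_defect w H \<psi> y - weak_defect l (\<lambda>y. f y * D (Y y)) \<psi> y"
      using Mg(2)
    proof eventually_elim
      case (elim y)
      \<comment> \<open>Every term now contains one of the small quantities \<open>w y - l y\<close>
        and \<open>H y - f y * D (Y y)\<close>, the latter small only from below, which suffices
        because \<open>\<psi>\<close> is nonnegative.\<close>
      have E: "weak_defect w H \<psi> y - weak_defect l (\<lambda>y. f y * D (Y y)) \<psi> y =
        f y * (w y - l y) * vf_deriv Y \<psi> y + \<psi> y * (H y - f y * D (Y y)) + \<psi> y * (g y * (w y - l y))"
        by (simp add: weak_defect_def algebra_simps)
      show ?case
      proof (cases "y \<in> Q")
        case False
        then have "y \<notin> supp \<psi>" using supp\<psi> by blast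
        then have "weak_defect w H \<psi> y - weak_defect l (\<lambda>y. f y * D (Y y)) \<psi> y = 0"
          unfolding E by (simp add: not_in_supp vf_deriv_not_in_supp)
        moreover have "0 \<le> low y"
          unfolding low_def using Mf(1) \<eta> s0 MY(1) Mg(1) \<Gamma>(3)[of y]
          by (intro add_nonneg_nonneg mult_nonneg_nonneg) auto
        ultimately show ?thesis by simp
      next
        case True
        have n: "norm (y - x) \<le> 2 * N * s" "dist y x < \<delta>" "y \<in> cball x 1"
          using Q[OF True] Ns by (auto simp: dist_norm norm_minus_commute)
        have wl: "\<bar>w y - l y\<bar> \<le> \<eta> * (2 * N * s)"
          using \<delta>(2)[OF n(2)] n(1) \<eta> by (meson less_imp_le mult_left_mono order_trans)
        have p: "0 \<le> \<psi> y" "\<psi> y \<le> 1"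
          unfolding \<psi>_def using plateau_nonneg[OF r(1) ab] plateau_le_1[OF r(1) ab] by auto
        have "\<bar>vf_deriv Y \<psi> y\<bar> \<le> \<Gamma> y * MY"
          unfolding vf_deriv_def using \<Gamma>(4)[of y "Y y"] MY(2)[OF n(3)] \<Gamma>(3)[of y]
          by (meson mult_left_mono order_trans)
        then have "\<bar>f y * (w y - l y) * vf_deriv Y \<psi> y\<bar> \<le> Mf * (\<eta> * (2 * N * s)) * (\<Gamma> y * MY)"
          unfolding abs_mult using Mf n(3) wl \<eta> s0 by (intro mult_mono) auto
        then have 1: "- (Mf * (\<eta> * (2 * N * s)) * MY * \<Gamma> y) \<le> f y * (w y - l y) * vf_deriv Y \<psi> y"
          by (simp add: abs_le_iff ac_simps)
        have "\<psi> y * (- \<eta>) \<le> \<psi> y * (H y - f y * D (Y y))"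
          using \<delta>(3)[OF n(2)] p by (intro mult_left_mono) auto
        moreover have "\<psi> y * \<eta> \<le> \<eta>" using p \<eta> by (simp add: mult_left_le_one_le)
        ultimately have 2: "- \<eta> \<le> \<psi> y * (H y - f y * D (Y y))" by simp
        have "\<bar>\<psi> y * (g y * (w y - l y))\<bar> \<le> 1 * (Mg * (\<eta> * (2 * N * s)))"
          unfolding abs_mult using p elim n(3) wl Mg(1) by (intro mult_mono) auto
        also have "\<dots> \<le> \<eta> * (2 * N * Mg)"
        proof -
          have "(\<eta> * (2 * N * Mg)) * s \<le> (\<eta> * (2 * N * Mg)) * 1"
            using s_le \<eta> Mg(1) by (intro mult_left_mono) auto
          then show ?thesis by (simp add: ac_simps)
        qed
        finally have 3: "- (\<eta> * (2 * N * Mg)) \<le> \<psi> y * (g y * (w y - l y))" by linarith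
        show ?thesis unfolding E low_def using 1 2 3 True by (simp add: distrib_left)
      qed
    qed
    then have "(LINT y|lebesgue. - low y) \<le> (LINT y|lebesgue. weak_defect w H \<psi> y - weak_defect l (\<lambda>y. f y * D (Y y)) \<psi> y)"
      using \<open>integrable lebesgue low\<close> i1 i2
      by (intro integral_mono_AE) auto
    then show "- \<epsilon> * s ^ CARD('n) \<le> (LINT y|lebesgue. weak_defect w H (plateau a (a + vec s) r) y)"
      using low_le eq by (simp add: N_def \<psi>_def)
  qed
qed

end

lemma integrable_mult_test_function:
  assumes "Linfty_loc k" "test_function \<phi>"
  shows "integrable lebesgue (\<lambda>x. k x * \<phi> x)"
proof (rule integrable_Linfty_loc_compact)
  show "Linfty_loc (\<lambda>x. k x * \<phi> x)"
    using assms
    by (intro Linfty_loc_mult) (auto intro: Linfty_loc_continuous smooth_continuous simp: test_function_def)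
  show "compact (supp \<phi>)" using assms by (simp add: test_function_def)
qed (simp add: not_in_supp)

context distr_pairing
begin

text \<open>The integrand is linear in the plateau and its first derivative, so it inherits the
  exact additivity of plateaus.\<close>

lemma weak_defect_cube_split:
  assumes "0 < r" "0 \<le> s"
  shows "weak_defect w H (plateau a (a + vec s) r) x
    = (\<Sum>A\<in>Pow UNIV. weak_defect w H (plateau (subcube a s A) (subcube a s A + vec (s / 2)) r) x)"
proof -
  let ?\<psi> = "\<lambda>A. plateau (subcube a s A) (subcube a s A + vec (s / 2)) r"
  have "(?\<psi> A has_derivative frechet_derivative (?\<psi> A) (at x)) (at x)" for A
    by (rule smooth_has_derivative[OF plateau_smooth])
  then have "((\<lambda>x. \<Sum>A\<in>Pow UNIV. ?\<psi> A x) has_derivative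
      (\<lambda>v. \<Sum>A\<in>Pow UNIV. frechet_derivative (?\<psi> A) (at x) v)) (at x)"
    by (rule has_derivative_sum)
  then have "(plateau a (a + vec s) r has_derivative
      (\<lambda>v. \<Sum>A\<in>Pow UNIV. frechet_derivative (?\<psi> A) (at x) v)) (at x)"
    unfolding plateau_cube_split[symmetric] .
  from vf_deriv_eq[OF this, of Y]
  have "vf_deriv Y (plateau a (a + vec s) r) x = (\<Sum>A\<in>Pow UNIV. vf_deriv Y (?\<psi> A) x)"
    by (simp add: vf_deriv_def)
  then show ?thesis
    unfolding weak_defect_def plateau_cube_split[of a s r x]
    by (simp add: sum_distrib_left sum_distrib_right sum.distrib)
qed

lemma pairing_nonneg:
  assumes w: "\<And>x. w differentiable (at x)" and w_supp: "bounded {x. w x \<noteq> 0}"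
    and wB: "\<And>x. \<bar>vf_deriv Y w x\<bar> \<le> B"
  shows "0 \<le> (LINT x|lebesgue. f x * vf_deriv Y w x + g x * w x)"
proof (rule ccontr)
  define I where "I = (LINT x|lebesgue. f x * vf_deriv Y w x + g x * w x)"
  define h where "h x = f x * vf_deriv Y w x" for x
  assume "\<not> 0 \<le> (LINT x|lebesgue. f x * vf_deriv Y w x + g x * w x)"
  then have I: "I < 0" by (simp add: I_def)
  obtain R' where R': "0 < R'" "\<And>x. w x \<noteq> 0 \<Longrightarrow> norm x \<le> R'"
    using w_supp by (auto simp: bounded_pos)
  have w0: "w x = 0" if "R' < norm x" for x using R'(2)[of x] that by auto
  have Yw0: "vf_deriv Y w x = 0" if "R' < norm x" for x
    by (rule vf_deriv_eq_0_open[of "{x. R' < norm x}" x w 0])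
       (use that w0 in \<open>auto intro!: open_Collect_less continuous_intros\<close>)
  \<comment> \<open>The margin 2 lets a plateau with edge width at most 1 equal 1 on the open ball
    of radius R' + 1; its derivative then vanishes wherever w does not.\<close>
  define R where "R = R' + 2"
  have cw: "continuous_on UNIV w"
    using w by (intro differentiable_imp_continuous_on) (simp add: differentiable_on_def)
  have h_meas: "h \<in> borel_measurable lebesgue"
    unfolding h_def[abs_def]
    by (intro borel_measurable_times continuous_imp_lebesgue_measurable f vf_deriv_measurable w Y)
  obtain Mf where Mf: "0 < Mf" "\<And>x. x \<in> cball 0 R' \<Longrightarrow> norm (f x) \<le> Mf"
    using continuous_bound_compact[OF f compact_cball] by metis
  have hB: "\<bar>h x\<bar> \<le> Mf * B" for x
  proof (cases "R' < norm x")
    case True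
    have "0 \<le> B" using wB[of x] by linarith
    then show ?thesis using Yw0[OF True] Mf(1) by (simp add: h_def)
  next
    case False
    then show ?thesis
      unfolding h_def abs_mult using Mf(1) Mf(2)[of x] wB[of x] by (intro mult_mono) auto
  qed
  \<comment> \<open>The extra 1 on the upper side covers the ramp of the plateau on [-R, R], of
    width r \<le> 1.\<close>
  define S :: "(real ^ 'n) set" where "S = cbox (vec (- R)) (vec (R + 1))"
  obtain H BH where H: "H \<in> borel_measurable lebesgue" "\<And>x. \<bar>H x\<bar> \<le> BH" "\<And>x. h x \<le> H x"
    "\<And>x. \<forall>\<^sub>F y in nhds x. H x \<le> H y"
    "(LINT x|lebesgue. indicat_real S x * (H x - h x)) \<le> - I / 2"
    using lower_semicontinuous_majorant[OF h_meas hB, of S "- I / 2"] I by (auto simp: S_def lmeasurable_cbox)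
  have LH: "Linfty_loc H" using H(1,2) by (intro Linfty_loc_locally_bounded) auto
  have Lh: "Linfty_loc h" using h_meas hB by (intro Linfty_loc_locally_bounded) auto
  \<comment> \<open>On the starting cube the integral is at most I - I/2 = I/2, which lies strictly
    below I/4 = - \<epsilon> (2R)^N because I is negative.\<close>
  define \<epsilon> where "\<epsilon> = - I / (4 * (2 * R) ^ CARD('n))"
  have R: "0 < R" using R' by (simp add: R_def)
  have \<epsilon>: "0 < \<epsilon>" unfolding \<epsilon>_def using I R by (intro divide_pos_pos) auto
  define \<mu> where "\<mu> a s r = (LINT x|lebesgue. weak_defect w H (plateau a (a + vec s) r) x)" for a s r
  \<comment> \<open>The width r cannot be fixed in advance: the local bound demands r \<le> s while
    s shrinks to 0. Asking for arbitrarily small r survives bisection: if every child failed for all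
    small r, then, there being finitely many children, so would the parent.\<close>
  define P where "P a s \<longleftrightarrow> (\<exists>\<^sub>F r in at_right 0. \<mu> a s r < - \<epsilon> * s ^ CARD('n))" for a s
  have int: "integrable lebesgue (weak_defect w H (plateau a (a + vec s) r))" if "0 < r" "0 \<le> s" for a s r
    by (intro weak_defect_integrable[OF cw LH] test_function_plateau that)
  have "P (vec (- R)) (2 * R)"
  proof -
    have "\<mu> (vec (- R)) (2 * R) r < - \<epsilon> * (2 * R) ^ CARD('n)" if r: "0 < r" "r \<le> 1" for r
    proof -
      define \<psi> :: "real ^ 'n \<Rightarrow> real" where "\<psi> = plateau (vec (- R)) (vec R) r"
      have ab: "vec (- R) $ i \<le> (vec R :: real ^ 'n) $ i" for i using R by simp
      have b: "vec (- R) + vec (2 * R) = (vec R :: real ^ 'n)" by (simp add: vec_eq_iff)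
      have one: "\<psi> x = 1" if "norm x < R' + 1" for x
        unfolding \<psi>_def
      proof (rule plateau_eq_1[OF r(1) ab])
        fix i
        have "\<bar>x $ i\<bar> < R' + 1" using component_le_norm_cart[of x i] that by linarith
        then show "vec (- R) $ i + r \<le> x $ i" "x $ i \<le> vec R $ i" using r by (auto simp: R_def)
      qed
      have Yone: "vf_deriv Y \<psi> x = 0" if "norm x < R' + 1" for x
        by (rule vf_deriv_eq_0_open[of "{x. norm x < R' + 1}" x \<psi> 1])
           (use that one in \<open>auto intro!: open_Collect_less continuous_intros\<close>)
      have le: "weak_defect w H \<psi> x \<le> (h x + g x * w x) + indicat_real S x * (H x - h x)" for x
      proof (cases "norm x \<le> R'")
        case True
        have "\<bar>x $ i\<bar> \<le> R'" for i using component_le_norm_cart[of x i] True by linarith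
        then have "- R' \<le> x $ i" "x $ i \<le> R'" for i by (auto simp: abs_le_iff minus_le_iff)
        then have "x \<in> S"
          unfolding S_def mem_box_cart by (auto simp: R_def intro: order_trans[of _ "- R'"] order_trans[of _ R'])
        then show ?thesis using one[of x] Yone[of x] True by (simp add: weak_defect_def)
      next
        case False
        then have z: "w x = 0" "h x = 0" using w0 Yw0 by (auto simp: h_def)
        have "0 \<le> \<psi> x" "\<psi> x \<le> 1"
          unfolding \<psi>_def using plateau_nonneg[OF r(1) ab] plateau_le_1[OF r(1) ab] by auto
        moreover have "\<psi> x = 0" if "x \<notin> S"
          unfolding \<psi>_def
        proof (rule plateau_eq_0_outside[OF r(1) ab])
          have "cbox (vec (- R)) (vec R + vec r) \<subseteq> S"
            using cbox_cube_mono[of "2 * R + r" "2 * R + 1" "vec (- R) :: real ^ 'n"] r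
            by (simp add: S_def vec_eq_iff flip: vec_add)
          then show "x \<notin> cbox (vec (- R)) (vec R + vec r)" using that by blast
        qed
        ultimately show ?thesis
          using H(3)[of x] z by (cases "x \<in> S") (auto simp: weak_defect_def mult_left_le_one_le)
      qed
      have i1: "integrable lebesgue (\<lambda>x. h x + g x * w x)"
      proof (rule integrable_Linfty_loc_compact[of _ "cball 0 R'"])
        show "Linfty_loc (\<lambda>x. h x + g x * w x)"
          by (intro Linfty_loc_add Linfty_loc_mult Lh g Linfty_loc_continuous cw)
      qed (use w0 Yw0 in \<open>auto simp: h_def\<close>)
      have i2: "integrable lebesgue (\<lambda>x. indicat_real S x * (H x - h x))"
      proof (rule integrable_bounded_compact_support[of _ S "BH + Mf * B"])
        show "(\<lambda>x. indicat_real S x * (H x - h x)) \<in> borel_measurable lebesgue"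
          using H(1) h_meas
          by (intro borel_measurable_times borel_measurable_diff borel_measurable_indicator)
            (simp_all add: S_def)
        have "\<bar>H x - h x\<bar> \<le> BH + Mf * B" for x using H(2)[of x] hB[of x] by linarith
        then show "AE x in lebesgue. x \<in> S \<longrightarrow> \<bar>indicat_real S x * (H x - h x)\<bar> \<le> BH + Mf * B" by simp
      qed (auto simp: S_def)
      have i0: "integrable lebesgue (weak_defect w H \<psi>)"
        using int[OF r(1), of "2 * R" "vec (- R)"] R unfolding \<psi>_def b by simp
      have "\<mu> (vec (- R)) (2 * R) r = (LINT x|lebesgue. weak_defect w H \<psi> x)"
        unfolding \<mu>_def \<psi>_def b ..
      also have "\<dots> \<le> (LINT x|lebesgue. (h x + g x * w x) + indicat_real S x * (H x - h x))"
        by (intro integral_mono i0 Bochner_Integration.integrable_add i1 i2 le)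
      also have "\<dots> = I + (LINT x|lebesgue. indicat_real S x * (H x - h x))"
        using i1 i2 by (simp add: I_def h_def)
      also have "\<dots> \<le> I / 2" using H(5) by simp
      also have "\<dots> < - \<epsilon> * (2 * R) ^ CARD('n)" using I R by (simp add: \<epsilon>_def)
      finally show ?thesis .
    qed
    then have "\<forall>\<^sub>F r in at_right 0. \<mu> (vec (- R)) (2 * R) r < - \<epsilon> * (2 * R) ^ CARD('n)"
      by (intro eventually_at_rightI[of 0 1]) auto
    then show ?thesis
      unfolding P_def by (rule eventually_frequently[rotated]) simp
  qed
  moreover have "\<exists>A. P (subcube a s A) (s / 2)" if s: "0 < s" and P: "P a s" for a s
  proof (rule ccontr)
    assume "\<not> ?thesis"
    then have "\<forall>\<^sub>F r in at_right 0. - \<epsilon> * (s / 2) ^ CARD('n) \<le> \<mu> (subcube a s A) (s / 2) r" for A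
      by (simp add: P_def not_frequently not_less)
    then have "\<forall>\<^sub>F r in at_right 0. \<forall>A\<in>Pow UNIV. - \<epsilon> * (s / 2) ^ CARD('n) \<le> \<mu> (subcube a s A) (s / 2) r"
      by (intro eventually_ball_finite) auto
    moreover have "\<forall>\<^sub>F r in at_right (0::real). 0 < r" by (simp add: eventually_at_right_less)
    ultimately have "\<forall>\<^sub>F r in at_right 0. - \<epsilon> * s ^ CARD('n) \<le> \<mu> a s r"
    proof eventually_elim
      case (elim r)
      \<comment> \<open>The 2^N children have volume (s/2)^N each, so the threshold is additive like
        the functional.\<close>
      have "- \<epsilon> * s ^ CARD('n) = (\<Sum>A\<in>(Pow UNIV :: 'n set set). - \<epsilon> * (s / 2) ^ CARD('n))"
        by (simp add: card_Pow power_divide)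
      also have "\<dots> \<le> (\<Sum>A\<in>Pow UNIV. \<mu> (subcube a s A) (s / 2) r)"
        using elim by (intro sum_mono) auto
      also have "\<dots> = \<mu> a s r"
        unfolding \<mu>_def weak_defect_cube_split[OF elim(2) less_imp_le[OF s]]
        using elim s int by (subst Bochner_Integration.integral_sum) auto
      finally show ?case .
    qed
    then show False using P by (auto simp: P_def frequently_def not_less)
  qed
  ultimately obtain x c where xc: "\<And>n. P (c n) (2 * R / 2 ^ n)" "\<And>n. x \<in> cbox (c n) (c n + vec (2 * R / 2 ^ n))"
  proof (elim cube_bisection[of P "vec (- R)" "2 * R"])
    show "0 < 2 * R" using R by simp
  qed blast+
  have "f x * vf_deriv Y w x \<le> H x" using H(3)[of x] by (simp add: h_def)
  from weak_defect_local_lower_bound[OF w LH this H(4) \<epsilon>]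
  obtain s1 where s1: "0 < s1" "\<And>a s r. 0 < r \<Longrightarrow> r \<le> s \<Longrightarrow> s < s1 \<Longrightarrow> x \<in> cbox a (a + vec s) \<Longrightarrow>
    - \<epsilon> * s ^ CARD('n) \<le> \<mu> a s r"
    unfolding \<mu>_def by blast
  have "(\<lambda>n. 2 * R * (1 / 2) ^ n) \<longlonglongrightarrow> 2 * R * 0"
    by (intro tendsto_intros LIMSEQ_power_zero) simp
  then have "\<forall>\<^sub>F n in sequentially. 2 * R * (1 / 2) ^ n < s1"
    using s1(1) by (intro order_tendstoD(2)[of _ 0]) auto
  then obtain n where "2 * R * (1 / 2) ^ n < s1"
    unfolding eventually_sequentially by blast
  then have n: "2 * R / 2 ^ n < s1" by (simp add: power_one_over)
  \<comment> \<open>For a cube this small the lower bound holds for every small r, which contradicts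
    its failure for arbitrarily small r.\<close>
  have "\<forall>\<^sub>F r in at_right 0. - \<epsilon> * (2 * R / 2 ^ n) ^ CARD('n) \<le> \<mu> (c n) (2 * R / 2 ^ n) r"
    using R by (intro eventually_at_rightI[of 0 "2 * R / 2 ^ n"] s1(2) n xc(2)) auto
  then show False using xc(1)[of n] by (auto simp: P_def frequently_def not_less)
qed

text \<open>The hypotheses are invariant under w \<mapsto> -w, so the inequality gives its own
  reverse.\<close>

lemma pairing_eq_0:
  assumes w: "\<And>x. w differentiable (at x)" and w_supp: "bounded {x. w x \<noteq> 0}"
    and wB: "\<And>x. \<bar>vf_deriv Y w x\<bar> \<le> B"
  shows "(LINT x|lebesgue. f x * vf_deriv Y w x + g x * w x) = 0"
proof (rule antisym)
  have neg: "vf_deriv Y (\<lambda>x. - w x) x = - vf_deriv Y w x" for x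
    using vf_deriv_eq[OF has_derivative_minus[OF w[unfolded frechet_derivative_works]], of Y]
    by (simp add: vf_deriv_def)
  have "0 \<le> (LINT x|lebesgue. f x * vf_deriv Y (\<lambda>x. - w x) x + g x * - w x)"
    by (rule pairing_nonneg[of _ B]) (use w w_supp wB in \<open>auto simp: neg\<close>)
  also have "\<dots> = - (LINT x|lebesgue. f x * vf_deriv Y w x + g x * w x)"
    by (subst Bochner_Integration.integral_minus[symmetric]) (simp add: neg)
  finally show "(LINT x|lebesgue. f x * vf_deriv Y w x + g x * w x) \<le> 0" by simp
qed (rule pairing_nonneg[OF assms])

text \<open>Pair with w = m \<phi>, which is differentiable with compact support. Its derivative
  along Y is bounded because that of m is bounded on the support of \<phi>; expanding it by the
  classical product rule gives the weak one.\<close>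

lemma has_distr_deriv_mult:
  assumes m: "\<And>x. m differentiable (at x)"
    and mB: "\<And>S. compact S \<Longrightarrow> \<exists>B. \<forall>x\<in>S. \<bar>vf_deriv Y m x\<bar> \<le> B"
  shows "has_distr_deriv Y (\<lambda>x. f x * m x) (\<lambda>x. g x * m x + f x * vf_deriv Y m x)"
    and "Linfty_loc (\<lambda>x. g x * m x + f x * vf_deriv Y m x)"
proof -
  have cm: "continuous_on UNIV m"
    using m by (intro differentiable_imp_continuous_on) (simp add: differentiable_on_def)
  have Lm: "Linfty_loc (vf_deriv Y m)"
    by (intro Linfty_loc_locally_bounded vf_deriv_measurable m Y mB)
  show L: "Linfty_loc (\<lambda>x. g x * m x + f x * vf_deriv Y m x)"
    by (intro Linfty_loc_add Linfty_loc_mult g f Linfty_loc_continuous cm Lm)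
  show "has_distr_deriv Y (\<lambda>x. f x * m x) (\<lambda>x. g x * m x + f x * vf_deriv Y m x)"
    unfolding has_distr_deriv_def
  proof (intro allI impI)
    fix \<phi> :: "real ^ 'n \<Rightarrow> real" assume \<phi>: "test_function \<phi>"
    then have sm: "smooth \<phi>" and S: "compact (supp \<phi>)" by (auto simp: test_function_def)
    have c\<phi>: "continuous_on UNIV \<phi>" using sm by (rule smooth_continuous)
    have d: "((\<lambda>x. m x * \<phi> x) has_derivative
      (\<lambda>v. m x * frechet_derivative \<phi> (at x) v + frechet_derivative m (at x) v * \<phi> x)) (at x)" for x
      by (rule has_derivative_mult[OF m[unfolded frechet_derivative_works] smooth_has_derivative[OF sm]])
    have Yw: "vf_deriv Y (\<lambda>x. m x * \<phi> x) x = m x * vf_deriv Y \<phi> x + vf_deriv Y m x * \<phi> x" for x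
      unfolding vf_deriv_eq[OF d] by (simp add: vf_deriv_def)
    obtain B1 where B1: "0 < B1" "\<And>x. x \<in> supp \<phi> \<Longrightarrow> norm (m x * vf_deriv Y \<phi> x) \<le> B1"
      using continuous_bound_compact[OF continuous_on_mult[OF cm vf_deriv_continuous[OF sm Y]] S] by metis
    obtain B2 where B2: "0 < B2" "\<And>x. x \<in> supp \<phi> \<Longrightarrow> norm (\<phi> x) \<le> B2"
      using continuous_bound_compact[OF c\<phi> S] by metis
    obtain B3 where B3: "\<And>x. x \<in> supp \<phi> \<Longrightarrow> \<bar>vf_deriv Y m x\<bar> \<le> B3" using mB[OF S] by blast
    have "\<bar>vf_deriv Y (\<lambda>x. m x * \<phi> x) x\<bar> \<le> B1 + \<bar>B3\<bar> * B2" for x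
    proof (cases "x \<in> supp \<phi>")
      case True
      have "\<bar>vf_deriv Y m x * \<phi> x\<bar> \<le> \<bar>B3\<bar> * B2"
        unfolding abs_mult using B3[OF True] B2(2)[OF True] by (intro mult_mono) auto
      then show ?thesis using B1(2)[OF True] unfolding Yw by simp
    next
      case False
      then show ?thesis
        unfolding Yw using B1(1) B2(1) by (simp add: not_in_supp vf_deriv_not_in_supp)
    qed
    moreover have "bounded {x. m x * \<phi> x \<noteq> 0}"
      by (rule bounded_subset[OF compact_imp_bounded[OF S]]) (use not_in_supp in fastforce)
    moreover have "(\<lambda>x. m x * \<phi> x) differentiable (at x)" for x
      using d differentiable_def by blast
    ultimately have "(LINT x|lebesgue. f x * vf_deriv Y (\<lambda>x. m x * \<phi> x) x + g x * (m x * \<phi> x)) = 0"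
      by (intro pairing_eq_0)
    also have "(\<lambda>x. f x * vf_deriv Y (\<lambda>x. m x * \<phi> x) x + g x * (m x * \<phi> x))
      = (\<lambda>x. (g x * m x + f x * vf_deriv Y m x) * \<phi> x - f x * m x * vf_adjoint Y \<phi> x)"
      unfolding fun_eq_iff Yw vf_adjoint_def Y_div by (simp add: algebra_simps)
    finally have "(LINT x|lebesgue. (g x * m x + f x * vf_deriv Y m x) * \<phi> x - f x * m x * vf_adjoint Y \<phi> x) = 0" .
    moreover have "integrable lebesgue (\<lambda>x. (g x * m x + f x * vf_deriv Y m x) * \<phi> x)"
      by (rule integrable_mult_test_function[OF L \<phi>])
    moreover have "integrable lebesgue (\<lambda>x. f x * m x * vf_adjoint Y \<phi> x)"
    proof (rule integrable_Linfty_loc_compact[OF _ S])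
      show "Linfty_loc (\<lambda>x. f x * m x * vf_adjoint Y \<phi> x)"
        unfolding vf_adjoint_def Y_div mult_zero_left diff_zero
        by (intro Linfty_loc_mult Linfty_loc_continuous f cm continuous_intros vf_deriv_continuous sm Y)
    qed (simp add: vf_adjoint_def Y_div vf_deriv_not_in_supp)
    ultimately show "(LINT x|lebesgue. f x * m x * vf_adjoint Y \<phi> x)
        = (LINT x|lebesgue. (g x * m x + f x * vf_deriv Y m x) * \<phi> x)"
      by simp
  qed
qed

end

section \<open>Uniqueness of weak derivatives\<close>

lemma integral_shift_continuous:
  fixes F :: "'a::euclidean_space \<Rightarrow> real"
  assumes "continuous_on UNIV F"
  shows "(LINT x|lebesgue. F (c + x)) = (LINT x|lebesgue. F x)"
proof -
  have m: "F \<in> borel_measurable borel" using assms by (rule borel_measurable_continuous_onI)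
  have "continuous_on UNIV (\<lambda>x. F (c + x))"
    by (intro continuous_on_compose2[OF assms] continuous_intros) auto
  then have m': "(\<lambda>x. F (c + x)) \<in> borel_measurable borel" by (rule borel_measurable_continuous_onI)
  have "(LINT x|lborel. F x) = (LINT x|distr lborel borel ((+) c). F x)"
    by (simp add: lborel_distr_plus)
  also have "\<dots> = (LINT x|lborel. F (c + x))"
    using m by (intro integral_distr) auto
  finally show ?thesis using m m' by (simp add: integral_completion)
qed

text \<open>By translation invariance every difference quotient in direction \<open>e\<close> has
  integral zero; the mean value theorem bounds the quotients by a constant on a fixed ball, and
  dominated convergence passes to the derivative.\<close>

lemma integral_directional_derivative_eq_0:
  fixes F :: "'a::euclidean_space \<Rightarrow> real"
  assumes D: "\<And>x. (F has_derivative F' x) (at x)" and cont: "continuous_on UNIV (\<lambda>x. F' x e)"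
    and S: "compact S" "\<And>x. x \<notin> S \<Longrightarrow> F x = 0"
  shows "(LINT x|lebesgue. F' x e) = 0"
proof -
  have cF: "continuous_on UNIV F"
    using D by (intro differentiable_imp_continuous_on) (auto simp: differentiable_on_def differentiable_def)
  define q where "q n x = (F (x + (1 / real (Suc n)) *\<^sub>R e) - F x) * real (Suc n)" for n x
  have cs: "continuous_on UNIV (\<lambda>x. F (x + c))" for c
    by (intro continuous_on_compose2[OF cF] continuous_intros) auto
  have along: "((\<lambda>t. F (x + t *\<^sub>R e)) has_real_derivative F' (x + t *\<^sub>R e) e) (at t)" for x t
  proof -
    have "((\<lambda>t. F (x + t *\<^sub>R e)) has_derivative (\<lambda>s. F' (x + t *\<^sub>R e) (s *\<^sub>R e))) (at t)"
      by (rule has_derivative_compose[OF _ D, where f = "\<lambda>t. x + t *\<^sub>R e"]) (auto intro!: derivative_eq_intros)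
    then show ?thesis
      using linear_cmul[OF bounded_linear.linear[OF has_derivative_bounded_linear[OF D]]]
      by (simp add: has_field_derivative_def mult.commute[of _ "F' (x + t *\<^sub>R e) e"])
  qed
  obtain R where R: "0 < R" "\<And>x. x \<in> S \<Longrightarrow> norm x \<le> R"
    using compact_imp_bounded[OF S(1)] by (auto simp: bounded_pos)
  obtain B where B: "0 < B" "\<And>x. x \<in> cball 0 (R + 2 * norm e) \<Longrightarrow> norm (F' x e) \<le> B"
    using continuous_bound_compact[OF cont compact_cball] by metis
  have small: "norm (t *\<^sub>R e) \<le> norm e" if "0 \<le> t" "t \<le> 1" for t
    using that by (simp add: mult_left_le_one_le)
  have step: "0 < 1 / real (Suc n)" "1 / real (Suc n) \<le> 1" for n by auto
  have q_out: "q n x = 0" if "x \<notin> cball 0 (R + norm e)" for n x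
  proof -
    have "norm x > R + norm e" using that by simp
    moreover have "norm x \<le> norm (x + (1 / real (Suc n)) *\<^sub>R e) + norm ((1 / real (Suc n)) *\<^sub>R e)"
      by (metis add_diff_cancel norm_triangle_ineq4)
    ultimately have "norm (x + (1 / real (Suc n)) *\<^sub>R e) > R" "norm x > R"
      using small[of "1 / real (Suc n)"] step[of n] norm_ge_zero[of e] by linarith+
    then have "F (x + (1 / real (Suc n)) *\<^sub>R e) = 0" "F x = 0"
      using R(2) S(2) by (meson not_less)+
    then show ?thesis by (simp add: q_def)
  qed
  have q_bound: "norm (q n x) \<le> B * indicat_real (cball 0 (R + norm e)) x" for n x
  proof (cases "x \<in> cball 0 (R + norm e)")
    case True
    obtain z where z: "0 < z" "z < 1 / real (Suc n)"
      "F (x + (1 / real (Suc n)) *\<^sub>R e) - F (x + 0 *\<^sub>R e) = (1 / real (Suc n) - 0) * F' (x + z *\<^sub>R e) e"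
      using MVT2[OF step(1) along, of n x] by blast
    then have "q n x = F' (x + z *\<^sub>R e) e" by (simp add: q_def)
    moreover have "x + z *\<^sub>R e \<in> cball 0 (R + 2 * norm e)"
    proof -
      have "z \<le> 1" using z(2) step(2)[of n] by linarith
      then have "norm (x + z *\<^sub>R e) \<le> norm x + norm e"
        using small[of z] z(1) norm_triangle_ineq[of x "z *\<^sub>R e"] by linarith
      then show ?thesis using True by simp
    qed
    ultimately show ?thesis using B(2) True by simp
  qed (simp add: q_out)
  have "(\<lambda>n. LINT x|lebesgue. q n x) \<longlonglongrightarrow> (LINT x|lebesgue. F' x e)"
  proof (rule integral_dominated_convergence)
    show "(\<lambda>x. F' x e) \<in> borel_measurable lebesgue"
      by (rule continuous_imp_lebesgue_measurable[OF cont])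
    show "q n \<in> borel_measurable lebesgue" for n
      unfolding q_def[abs_def] by (intro continuous_imp_lebesgue_measurable continuous_intros cs cF)
    show "integrable lebesgue (\<lambda>x. B * indicat_real (cball 0 (R + norm e)) x)"
      by (intro integrable_mult_right integrable_real_indicator)
        (simp_all add: emeasure_lborel_cball_finite[unfolded infinity_ennreal_def])
    show "AE x in lebesgue. (\<lambda>n. q n x) \<longlonglongrightarrow> F' x e"
    proof (rule AE_I2)
      fix x
      have "((\<lambda>h. (F (x + h *\<^sub>R e) - F x) / h) \<longlongrightarrow> F' x e) (at 0)"
        using along[of x 0] by (simp add: DERIV_def)
      moreover have "filterlim (\<lambda>n. 1 / real (Suc n)) (at 0) sequentially"
        using LIMSEQ_Suc[OF lim_1_over_n] by (auto simp: filterlim_at intro!: eventuallyI)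
      ultimately have "(\<lambda>n. (F (x + (1 / real (Suc n)) *\<^sub>R e) - F x) / (1 / real (Suc n))) \<longlonglongrightarrow> F' x e"
        by (rule filterlim_compose)
      then show "(\<lambda>n. q n x) \<longlonglongrightarrow> F' x e" by (simp add: q_def)
    qed
    show "AE x in lebesgue. norm (q n x) \<le> B * indicat_real (cball 0 (R + norm e)) x" for n
      using q_bound by simp
  qed
  moreover have "(LINT x|lebesgue. q n x) = 0" for n
  proof -
    let ?c = "(1 / real (Suc n)) *\<^sub>R e"
    have i1: "integrable lebesgue (\<lambda>x. F (x + ?c))"
    proof (rule integrable_Linfty_loc_compact)
      show "compact ((\<lambda>x. - ?c + x) ` S)" using S(1) by (rule compact_translation)
      fix x assume "x \<notin> (\<lambda>x. - ?c + x) ` S"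
      then have "x + ?c \<notin> S" by (metis (no_types, lifting) add.commute image_eqI minus_add_cancel add.left_commute)
      then show "F (x + ?c) = 0" by (rule S(2))
    qed (rule Linfty_loc_continuous[OF cs])
    have i2: "integrable lebesgue F"
      by (rule integrable_Linfty_loc_compact[OF Linfty_loc_continuous[OF cF] S])
    have "(LINT x|lebesgue. q n x) = ((LINT x|lebesgue. F (x + ?c)) - (LINT x|lebesgue. F x)) * real (Suc n)"
      unfolding q_def using i1 i2 by (simp add: Bochner_Integration.integral_diff del: of_nat_Suc)
    then show ?thesis using integral_shift_continuous[OF cF, of ?c] by (simp add: add.commute)
  qed
  ultimately show ?thesis by (simp add: LIMSEQ_const_iff)
qed

text \<open>For a divergence free field, Y \<phi> is the divergence of \<phi> Y, a sum of partial
  derivatives of compactly supported functions.\<close>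

lemma integral_vf_deriv_test_function:
  fixes Y :: "'a::euclidean_space \<Rightarrow> 'a"
  assumes Y: "smooth Y" and div0: "\<And>x. vf_div Y x = 0" and \<phi>: "test_function \<phi>"
  shows "(LINT x|lebesgue. vf_deriv Y \<phi> x) = 0"
proof -
  have sm: "smooth \<phi>" and S: "compact (supp \<phi>)" using \<phi> by (auto simp: test_function_def)
  have Y': "(Y has_derivative frechet_derivative Y (at x)) (at x)"
    and \<phi>': "(\<phi> has_derivative frechet_derivative \<phi> (at x)) (at x)" for x
    using Y sm by (auto intro: smooth_has_derivative)
  define F' where "F' b x v = \<phi> x * (frechet_derivative Y (at x) v \<bullet> b) + frechet_derivative \<phi> (at x) v * (Y x \<bullet> b)"
    for b x v
  have F': "((\<lambda>x. \<phi> x * (Y x \<bullet> b)) has_derivative F' b x) (at x)" for b x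
    unfolding F'_def
    by (intro has_derivative_mult \<phi>' bounded_linear.has_derivative[OF bounded_linear_inner_left] Y')
  have cont: "continuous_on UNIV (\<lambda>x. F' b x b)" for b
    unfolding F'_def by (intro continuous_intros smooth_continuous_derivative smooth_continuous sm Y)
  have int: "integrable lebesgue (\<lambda>x. F' b x b)" for b
  proof (rule integrable_Linfty_loc_compact[OF Linfty_loc_continuous[OF cont] S])
    fix x assume x: "x \<notin> supp \<phi>"
    have "frechet_derivative \<phi> (at x) v = 0" for v
      using vf_deriv_not_in_supp[OF x, of "\<lambda>_. v"] by (simp add: vf_deriv_def)
    then show "F' b x b = 0" using not_in_supp[OF x] by (simp add: F'_def)
  qed
  have "vf_deriv Y \<phi> x = (\<Sum>b\<in>Basis. F' b x b)" for x
  proof -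
    have lin: "linear (frechet_derivative \<phi> (at x))"
      by (rule linear_frechet_derivative[OF smooth_differentiable[OF sm]])
    have "frechet_derivative \<phi> (at x) (\<Sum>b\<in>Basis. (Y x \<bullet> b) *\<^sub>R b) =
      (\<Sum>b\<in>Basis. frechet_derivative \<phi> (at x) ((Y x \<bullet> b) *\<^sub>R b))"
      by (rule linear_sum[OF lin])
    then have "vf_deriv Y \<phi> x = (\<Sum>b\<in>Basis. frechet_derivative \<phi> (at x) b * (Y x \<bullet> b))"
      by (simp add: euclidean_representation vf_deriv_def linear_cmul[OF lin] mult.commute)
    moreover have "(\<Sum>b\<in>Basis. \<phi> x * (frechet_derivative Y (at x) b \<bullet> b)) = 0"
      using div0[of x] by (simp add: vf_div_def flip: sum_distrib_left)
    ultimately show ?thesis by (simp add: F'_def sum.distrib)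
  qed
  then have "(LINT x|lebesgue. vf_deriv Y \<phi> x) = (\<Sum>b\<in>Basis. LINT x|lebesgue. F' b x b)"
    using int by simp
  also have "\<dots> = 0"
    by (intro sum.neutral ballI integral_directional_derivative_eq_0[OF F' cont S]) (simp add: not_in_supp)
  finally show ?thesis .
qed

lemma smooth_step_tendsto_sequentially:
  assumes "0 < \<rho>"
  shows "(\<lambda>n. smooth_step (t / (\<rho> / real (Suc n)))) \<longlonglongrightarrow> of_bool (0 < t)"
proof (cases "0 < t")
  case True
  obtain k :: nat where k: "\<rho> / t < k" using reals_Archimedean2 by blast
  have "smooth_step (t / (\<rho> / real (Suc n))) = 1" if "k \<le> n" for n
  proof (rule smooth_step_eq_1)
    have "\<rho> / t \<le> Suc n" using k that by linarith
    then show "1 \<le> t / (\<rho> / real (Suc n))" using True assms by (simp add: field_simps)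
  qed
  then show ?thesis
    using True by (intro tendsto_eventually) (auto simp: eventually_sequentially)
next
  case False
  then have "smooth_step (t / (\<rho> / real (Suc n))) = 0" for n
    using assms by (intro smooth_step_eq_0) (auto simp: divide_le_0_iff mult_le_0_iff)
  then show ?thesis using False by simp
qed

text \<open>The shift by 1 lets the ramp end at t = 0 instead of starting there, so the limit takes
  the value 1 at 0. Together with the unshifted limit this excludes both end points and produces the
  indicator of an open interval.\<close>

lemma smooth_step_shifted_tendsto_sequentially:
  assumes "0 < \<rho>"
  shows "(\<lambda>n. smooth_step (t / (\<rho> / real (Suc n)) + 1)) \<longlonglongrightarrow> of_bool (0 \<le> t)"
proof (cases "0 \<le> t")
  case True
  then have "smooth_step (t / (\<rho> / real (Suc n)) + 1) = 1" for n
    using assms by (intro smooth_step_eq_1) (simp add: zero_le_divide_iff)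
  then show ?thesis using True by simp
next
  case False
  obtain k :: nat where k: "\<rho> / (- t) < k" using reals_Archimedean2 by blast
  have "smooth_step (t / (\<rho> / real (Suc n)) + 1) = 0" if "k \<le> n" for n
  proof (rule smooth_step_eq_0)
    have "\<rho> / (- t) \<le> Suc n" using k that by linarith
    then show "t / (\<rho> / real (Suc n)) + 1 \<le> 0"
      using False assms by (simp add: field_simps)
  qed
  then show ?thesis
    using False by (intro tendsto_eventually) (auto simp: eventually_sequentially)
qed

text \<open>Plateaus with shrinking edges converge pointwise to the indicator of the open box and
  are dominated by the indicator of the closed one.\<close>

lemma Linfty_loc_integral_box_eq_0:
  fixes g :: "real ^ 'n \<Rightarrow> real"
  assumes g: "Linfty_loc g" and g0: "\<And>\<phi>. test_function \<phi> \<Longrightarrow> (LINT x|lebesgue. g x * \<phi> x) = 0"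
  shows "(LINT x|lebesgue. g x * indicat_real (box a b) x) = 0"
proof (cases "\<forall>i. a $ i < b $ i")
  case False
  then have "box a b = {}" by (auto simp: interval_eq_empty_cart not_less)
  then show ?thesis by simp
next
  case True
  define \<rho> where "\<rho> = Min (range (\<lambda>i. b $ i - a $ i))"
  have \<rho>: "0 < \<rho>" "\<And>i. \<rho> \<le> b $ i - a $ i"
    using True by (auto simp: \<rho>_def)
  define r where "r n = \<rho> / real (Suc n)" for n
  have r: "0 < r n" "r n \<le> \<rho>" for n
    using \<rho>(1) divide_left_mono[of 1 "real (Suc n)" \<rho>] by (auto simp: r_def)
  \<comment> \<open>The upper corner is moved back by the edge width so that the supports stay
    inside \<open>cbox a b\<close>; \<open>\<rho>\<close> is the shortest edge, which keeps the
    corners ordered.\<close>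
  define \<psi> where "\<psi> n = plateau a (b - vec (r n)) (r n)" for n
  have ab: "a $ i \<le> (b - vec (r n)) $ i" for i n using r(2)[of n] \<rho>(2)[of i] by simp
  have test: "test_function (\<psi> n)" for n
    using plateau_mult_test_function[OF r(1) ab, of "\<lambda>_. 1" n] by (simp add: \<psi>_def smooth_def Ck_const)
  have out: "\<psi> n x = 0" if "x \<notin> cbox a b" for n x
    using plateau_eq_0_outside[OF r(1) ab, of x n] that by (simp add: \<psi>_def)
  have lim: "(\<lambda>n. \<psi> n x) \<longlonglongrightarrow> indicat_real (box a b) x" for x
  proof -
    have "(\<lambda>n. \<psi> n x) \<longlonglongrightarrow> (\<Prod>i\<in>UNIV. of_bool (0 < x $ i - a $ i) - of_bool (0 \<le> x $ i - b $ i))"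
    proof -
      have *: "(x $ i - (b - vec (r n)) $ i) / r n = (x $ i - b $ i) / r n + 1" for i n
        using r(1)[of n] by (simp add: field_simps)
      show ?thesis
        unfolding \<psi>_def plateau_def * unfolding r_def
        by (intro tendsto_prod tendsto_diff smooth_step_tendsto_sequentially
            smooth_step_shifted_tendsto_sequentially \<rho>(1))
    qed
    also have "(\<Prod>i\<in>UNIV. of_bool (0 < x $ i - a $ i) - of_bool (0 \<le> x $ i - b $ i)) = indicat_real (box a b) x"
    proof (cases "x \<in> box a b")
      case T: True
      have "of_bool (0 < x $ i - a $ i) - of_bool (0 \<le> x $ i - b $ i) = (1::real)" for i
        using T[unfolded mem_box_cart, rule_format, of i] by auto
      then show ?thesis using T by simp
    next
      case F: False
      then obtain i where "\<not> (a $ i < x $ i \<and> x $ i < b $ i)" by (auto simp: mem_box_cart)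
      then have "of_bool (0 < x $ i - a $ i) - of_bool (0 \<le> x $ i - b $ i) = (0::real)"
        using True[rule_format, of i] by auto
      then have "(\<Prod>i\<in>UNIV. of_bool (0 < x $ i - a $ i) - of_bool (0 \<le> x $ i - b $ i)) = (0::real)"
        by (intro prod_zero[OF finite] bexI[of _ i]) simp_all
      then show ?thesis using F by simp
    qed
    finally show ?thesis .
  qed
  have g_meas: "g \<in> borel_measurable lebesgue" using g by (simp add: Linfty_loc_def)
  have Lind: "Linfty_loc (indicat_real (cbox a b))"
    by (rule Linfty_loc_locally_bounded) (auto intro!: borel_measurable_indicator exI[of _ 1])
  have "(\<lambda>n. LINT x|lebesgue. g x * \<psi> n x) \<longlonglongrightarrow> (LINT x|lebesgue. g x * indicat_real (box a b) x)"
  proof (rule integral_dominated_convergence)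
    show "(\<lambda>x. g x * indicat_real (box a b) x) \<in> borel_measurable lebesgue"
      by (intro borel_measurable_times g_meas borel_measurable_indicator) simp
    show "(\<lambda>x. g x * \<psi> n x) \<in> borel_measurable lebesgue" for n
      using test[of n] by (intro borel_measurable_times g_meas continuous_imp_lebesgue_measurable)
        (auto intro: smooth_continuous simp: test_function_def)
    show "integrable lebesgue (\<lambda>x. norm (g x * indicat_real (cbox a b) x))"
      by (intro integrable_norm integrable_Linfty_loc_compact[of _ "cbox a b"] Linfty_loc_mult g Lind) auto
    show "AE x in lebesgue. (\<lambda>n. g x * \<psi> n x) \<longlonglongrightarrow> g x * indicat_real (box a b) x"
      by (intro AE_I2 tendsto_intros lim)
    show "AE x in lebesgue. norm (g x * \<psi> n x) \<le> norm (g x * indicat_real (cbox a b) x)" for n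
    proof (rule AE_I2)
      fix x
      show "norm (g x * \<psi> n x) \<le> norm (g x * indicat_real (cbox a b) x)"
        using out[of x n] plateau_nonneg[OF r(1)[of n] ab, where x = x] plateau_le_1[OF r(1)[of n] ab, where x = x]
        by (cases "x \<in> cbox a b") (auto simp: \<psi>_def abs_mult mult_left_le)
    qed
  qed
  then show ?thesis using g0[OF test] by (simp add: LIMSEQ_const_iff)
qed

text \<open>The positive and the negative part of \<open>g\<close> define measures that agree on
  open boxes. These form a generator closed under intersection, so the measures coincide, and so do
  the densities almost everywhere.\<close>

lemma Linfty_loc_AE_eq_0:
  fixes g :: "real ^ 'n \<Rightarrow> real"
  assumes g: "Linfty_loc g" and g0: "\<And>\<phi>. test_function \<phi> \<Longrightarrow> (LINT x|lebesgue. g x * \<phi> x) = 0"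
  shows "AE x in lebesgue. g x = 0"
proof -
  have g_meas: "g \<in> borel_measurable lebesgue" using g by (simp add: Linfty_loc_def)
  \<comment> \<open>Boxes generate the Borel sets, not the Lebesgue sets, so a Borel representative
    is taken before the measures are compared.\<close>
  obtain k where k[measurable]: "k \<in> borel_measurable lborel" and gk: "AE x in lborel. g x = k x"
    using completion_ex_borel_measurable_real[OF g_meas] by auto
  have gk': "AE x in lebesgue. g x = k x" using gk by (rule AE_completion)
  have Lind: "Linfty_loc (indicat_real (box a b))" for a b :: "real ^ 'n"
    by (rule Linfty_loc_locally_bounded) (auto intro!: borel_measurable_indicator exI[of _ 1])
  have int: "integrable lborel (\<lambda>x. k x * indicat_real (box a b) x)"
    and zero: "(LINT x|lborel. k x * indicat_real (box a b) x) = 0" for a b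
  proof -
    have 1: "integrable lebesgue (\<lambda>x. g x * indicat_real (box a b) x)"
    proof (rule integrable_Linfty_loc_compact[of _ "cbox a b"])
      show "Linfty_loc (\<lambda>x. g x * indicat_real (box a b) x)" by (intro Linfty_loc_mult g Lind)
    qed (use box_subset_cbox[of a b] in \<open>auto simp: indicator_def\<close>)
    have m1: "(\<lambda>x. g x * indicat_real (box a b) x) \<in> borel_measurable lebesgue"
      using 1 by (rule borel_measurable_integrable)
    have m2: "(\<lambda>x. k x * indicat_real (box a b) x) \<in> borel_measurable lborel" by measurable
    then have m3: "(\<lambda>x. k x * indicat_real (box a b) x) \<in> borel_measurable lebesgue"
      by (rule measurable_completion)
    have ae: "AE x in lebesgue. g x * indicat_real (box a b) x = k x * indicat_real (box a b) x"
      using gk' by eventually_elim simp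
    have "integrable lebesgue (\<lambda>x. k x * indicat_real (box a b) x)"
      using 1 integrable_cong_AE[OF m1 m3 ae] by simp
    then show "integrable lborel (\<lambda>x. k x * indicat_real (box a b) x)"
      using m2 by (simp add: integrable_completion)
    have "(LINT x|lebesgue. k x * indicat_real (box a b) x) = 0"
      using integral_cong_AE[OF m1 m3 ae] Linfty_loc_integral_box_eq_0[OF g g0, of a b] by simp
    then show "(LINT x|lborel. k x * indicat_real (box a b) x) = 0"
      using m2 by (simp add: integral_completion)
  qed
  \<comment> \<open>Since \<open>ennreal\<close> sends negative numbers to 0, these are the measures
    with densities the positive and the negative part of \<open>k\<close>.\<close>
  define P where "P = density lborel (\<lambda>x. ennreal (k x))"
  define Q where "Q = density lborel (\<lambda>x. ennreal (- k x))"
  have fin: "(\<integral>\<^sup>+ x. ennreal (s * k x) * indicator (box a b) x \<partial>lborel)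
      = ennreal (LINT x|lborel. max 0 (s * k x) * indicat_real (box a b) x)" for a b and s :: real
  proof -
    have "(\<integral>\<^sup>+ x. ennreal (s * k x) * indicator (box a b) x \<partial>lborel)
        = (\<integral>\<^sup>+ x. ennreal (max 0 (s * k x) * indicat_real (box a b) x) \<partial>lborel)"
      by (intro nn_integral_cong) (auto simp: indicator_def max_def ennreal_neg)
    also have "\<dots> = ennreal (LINT x|lborel. max 0 (s * k x) * indicat_real (box a b) x)"
    proof (rule nn_integral_eq_integral)
      have "integrable lborel (\<lambda>x. max 0 (s * (k x * indicat_real (box a b) x)))"
        by (intro integrable_max integrable_mult_right int) auto
      also have "(\<lambda>x. max 0 (s * (k x * indicat_real (box a b) x)))
          = (\<lambda>x. max 0 (s * k x) * indicat_real (box a b) x)"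
        by (auto simp: fun_eq_iff indicator_def)
      finally show "integrable lborel (\<lambda>x. max 0 (s * k x) * indicat_real (box a b) x)" .
    qed (auto intro!: AE_I2)
    finally show ?thesis .
  qed
  have emP: "emeasure P (box a b) = ennreal (LINT x|lborel. max 0 (k x) * indicat_real (box a b) x)" for a b
    unfolding P_def using fin[of 1 a b] by (subst emeasure_density) auto
  have emQ: "emeasure Q (box a b) = ennreal (LINT x|lborel. max 0 (- k x) * indicat_real (box a b) x)" for a b
    unfolding Q_def using fin[of "-1" a b] by (subst emeasure_density) auto
  have "P = Q"
  proof (rule measure_eqI_generator_eq)
    let ?E = "range (\<lambda>(a, b). box a b :: (real ^ 'n) set)"
    show "Int_stable ?E" by (auto simp: Int_stable_def box_Int_box)
    show "?E \<subseteq> Pow UNIV" "sets P = sigma_sets UNIV ?E" "sets Q = sigma_sets UNIV ?E"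
      by (simp_all add: borel_eq_box P_def Q_def)
    let ?A = "\<lambda>n::nat. box (- (real n *\<^sub>R One)) (real n *\<^sub>R One) :: (real ^ 'n) set"
    show "range ?A \<subseteq> ?E" "(\<Union>i. ?A i) = UNIV" unfolding UN_box_eq_UNIV by auto
    show "emeasure P (?A i) \<noteq> \<infinity>" for i by (simp add: emP)
    show "emeasure P X = emeasure Q X" if "X \<in> ?E" for X
    proof -
      from that obtain a b where X: "X = box a b" by (elim rangeE) (auto split: prod.splits)
      have i: "integrable lborel (\<lambda>x. max 0 (s * (k x * indicat_real (box a b) x)))" for s
        by (intro integrable_max integrable_mult_right int) auto
      have e: "max 0 (s * (k x * indicat_real (box a b) x)) = max 0 (s * k x) * indicat_real (box a b) x" for s x
        by (auto simp: indicator_def)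
      have "(LINT x|lborel. max 0 (k x) * indicat_real (box a b) x) - (LINT x|lborel. max 0 (- k x) * indicat_real (box a b) x)
        = (LINT x|lborel. max 0 (k x) * indicat_real (box a b) x - max 0 (- k x) * indicat_real (box a b) x)"
        using i[of 1, unfolded e] i[of "-1", unfolded e] by simp
      also have "\<dots> = (LINT x|lborel. k x * indicat_real (box a b) x)"
        by (intro Bochner_Integration.integral_cong) (auto simp: max_def)
      finally show ?thesis using zero[of a b] by (simp add: X emP emQ)
    qed
  qed
  then have "AE x in lborel. ennreal (k x) = ennreal (- k x)"
    unfolding P_def Q_def by (subst (asm) sigma_finite_measure.density_unique_iff[OF sigma_finite_lborel]) auto
  then have "AE x in lborel. k x = 0"
  proof eventually_elim
    case (elim x)
    then show ?case by (cases "0 \<le> k x") (auto simp: ennreal_neg ennreal_eq_0_iff)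
  qed
  then have "AE x in lebesgue. k x = 0" by (rule AE_completion)
  with gk' show ?thesis by eventually_elim simp
qed

lemma has_distr_deriv_unique:
  fixes f :: "real ^ 'n \<Rightarrow> real"
  assumes "Linfty_loc g" "has_distr_deriv Y f g" "Linfty_loc h" "has_distr_deriv Y f h"
  shows "AE x in lebesgue. g x = h x"
proof -
  have "Linfty_loc (\<lambda>x. g x + (-1) * h x)"
    by (intro Linfty_loc_add Linfty_loc_mult assms Linfty_loc_continuous continuous_intros)
  then have "Linfty_loc (\<lambda>x. g x - h x)" by simp
  moreover have "(LINT x|lebesgue. (g x - h x) * \<phi> x) = 0" if "test_function \<phi>" for \<phi>
    using that assms integrable_mult_test_function[OF assms(1) that] integrable_mult_test_function[OF assms(3) that]
    by (simp add: has_distr_deriv_def left_diff_distrib)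
  ultimately have "AE x in lebesgue. g x - h x = 0" by (rule Linfty_loc_AE_eq_0)
  then show ?thesis by eventually_elim simp
qed

section \<open>Mollification\<close>

lemma integral_lebesgue_eq_integral_cbox:
  fixes k :: "'a::euclidean_space \<Rightarrow> real"
  assumes "continuous_on UNIV k" "\<And>x. x \<notin> cbox a b \<Longrightarrow> k x = 0"
  shows "(LINT x|lebesgue. k x) = integral (cbox a b) k"
proof -
  have "integrable lebesgue k"
    using assms by (intro integrable_Linfty_loc_compact[of _ "cbox a b"] Linfty_loc_continuous) auto
  then have "(LINT x|lebesgue. k x) = integral UNIV k" by (rule integral_lebesgue[symmetric])
  also have "\<dots> = integral UNIV (\<lambda>x. if x \<in> cbox a b then k x else 0)"
    using assms(2) by (intro integral_cong) auto
  finally show ?thesis by (simp only: integral_restrict_UNIV)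
qed

text \<open>The kernel carries the derivative since \<open>d\<close> is merely continuous. Leibniz's
  rule for integrals over boxes applies because, for base points in a unit ball around
  \<open>x\<close>, all shifted kernels are supported in one common box.\<close>

lemma convolution_has_derivative:
  fixes \<eta> d :: "'a::euclidean_space \<Rightarrow> real"
  assumes \<eta>: "test_function \<eta>" and d: "continuous_on UNIV d"
  shows "((\<lambda>x. LINT y|lebesgue. d y * \<eta> (y - x)) has_derivative
    (\<lambda>v. LINT y|lebesgue. - (d y * frechet_derivative \<eta> (at (y - x)) v))) (at x)"
proof -
  have sm: "smooth \<eta>" and "compact (supp \<eta>)" using \<eta> by (auto simp: test_function_def)
  then obtain R where R: "0 < R" "\<And>z. z \<in> supp \<eta> \<Longrightarrow> norm z \<le> R"
    by (auto dest!: compact_imp_bounded simp: bounded_pos)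
  have out: "\<eta> z = 0" "frechet_derivative \<eta> (at z) v = 0" if "R < norm z" for z v
  proof -
    have z: "z \<notin> supp \<eta>" using R(2)[of z] that by linarith
    show "\<eta> z = 0" using z by (rule not_in_supp)
    show "frechet_derivative \<eta> (at z) v = 0"
      using vf_deriv_not_in_supp[OF z, of "\<lambda>_. v"] by (simp add: vf_deriv_def)
  qed
  obtain a where a: "cball x (R + 1) \<subseteq> cbox (- a) a"
    using bounded_subset_cbox_symmetric[OF bounded_cball] by metis
  have far: "R < norm (y - x')" if "y \<notin> cbox (- a) a" "x' \<in> ball x 1" for y x'
  proof -
    have "y \<notin> cball x (R + 1)" using a that(1) by blast
    then have "R + 1 < norm (y - x)" by (simp add: dist_norm norm_minus_commute)
    also have "norm (y - x) \<le> norm (y - x') + norm (x' - x)" by (metis diff_add_cancel norm_triangle_ineq add_diff_eq)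
    finally show ?thesis using that(2) by (simp add: dist_norm norm_minus_commute)
  qed
  have cs: "continuous_on UNIV (\<lambda>y. \<eta> (y - x'))" for x'
    by (intro continuous_on_compose2[OF smooth_continuous[OF sm, of UNIV]] continuous_intros) auto
  have cd: "continuous_on UNIV (\<lambda>y. frechet_derivative \<eta> (at (y - x')) v)" for x' v
    by (intro continuous_on_compose2[OF smooth_continuous_derivative[OF sm]] continuous_intros) auto
  define f where "f x' y = d y * \<eta> (y - x')" for x' y
  have bl: "bounded_linear (\<lambda>v. - (d y * frechet_derivative \<eta> (at z) v))" for y z
    using has_derivative_bounded_linear[OF smooth_has_derivative[OF sm]]
    by (intro bounded_linear_minus bounded_linear_mult_right[THEN bounded_linear_compose])
  \<comment> \<open>Leibniz's rule takes the derivative as a map into the bounded linear functions,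
    continuous jointly in the base point and the integration variable.\<close>
  define fx where "fx x' y = Blinfun (\<lambda>v. - (d y * frechet_derivative \<eta> (at (y - x')) v))" for x' y
  have fx: "blinfun_apply (fx x' y) = (\<lambda>v. - (d y * frechet_derivative \<eta> (at (y - x')) v))" for x' y
    unfolding fx_def by (rule bounded_linear_Blinfun_apply[OF bl])
  have cont_fx: "continuous_on (ball x 1 \<times> cbox (- a) a) (\<lambda>(x, t). fx x t)"
  proof (rule continuous_on_blinfun_componentwise)
    fix b :: 'a assume "b \<in> Basis"
    have "continuous_on (ball x 1 \<times> cbox (- a) a)
        (\<lambda>p. - (d (snd p) * frechet_derivative \<eta> (at (snd p - fst p)) b))"
      by (intro continuous_intros continuous_on_compose2[OF d]
          continuous_on_compose2[OF smooth_continuous_derivative[OF sm, of b]]) auto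
    then show "continuous_on (ball x 1 \<times> cbox (- a) a) (\<lambda>p. blinfun_apply (case p of (x, t) \<Rightarrow> fx x t) b)"
      by (simp add: case_prod_beta fx)
  qed
  have "((\<lambda>x'. integral (cbox (- a) a) (f x')) has_derivative integral (cbox (- a) a) (fx x)) (at x within ball x 1)"
  proof (rule leibniz_rule[OF _ _ cont_fx])
    fix x' y assume "x' \<in> ball x 1" "y \<in> cbox (- a) a"
    have "((\<lambda>x'. \<eta> (y - x')) has_derivative (\<lambda>v. frechet_derivative \<eta> (at (y - x')) (- v))) (at x')"
      by (rule has_derivative_compose[OF _ smooth_has_derivative[OF sm], where f = "\<lambda>x'. y - x'"])
        (auto intro!: derivative_eq_intros)
    moreover have "frechet_derivative \<eta> (at (y - x')) (- v) = - frechet_derivative \<eta> (at (y - x')) v" for v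
      by (rule linear_neg[OF linear_frechet_derivative[OF smooth_differentiable[OF sm]]])
    ultimately have "((\<lambda>x'. \<eta> (y - x')) has_derivative (\<lambda>v. - frechet_derivative \<eta> (at (y - x')) v)) (at x')"
      by simp
    from has_derivative_mult_right[OF this, of "d y"]
    have "((\<lambda>x'. f x' y) has_derivative fx x' y) (at x')"
      unfolding f_def fx by simp
    then show "((\<lambda>x'. f x' y) has_derivative fx x' y) (at x' within ball x 1)"
      by (rule has_derivative_at_withinI)
  next
    fix x' show "f x' integrable_on cbox (- a) a"
      unfolding f_def by (intro integrable_continuous continuous_intros continuous_on_subset[OF d]
          continuous_on_subset[OF cs]) auto
  qed auto
  then have "((\<lambda>x'. integral (cbox (- a) a) (f x')) has_derivative integral (cbox (- a) a) (fx x)) (at x)"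
    by (simp add: at_within_open[of x "ball x 1"])
  moreover have "integral (cbox (- a) a) (f x') = (LINT y|lebesgue. d y * \<eta> (y - x'))" if "x' \<in> ball x 1" for x'
    unfolding f_def
  proof (rule integral_lebesgue_eq_integral_cbox[symmetric])
    show "continuous_on UNIV (\<lambda>y. d y * \<eta> (y - x'))" by (intro continuous_intros d cs)
    fix y assume "y \<notin> cbox (- a) a"
    then show "d y * \<eta> (y - x') = 0" using out(1)[OF far[OF _ that]] by simp
  qed
  ultimately have der: "((\<lambda>x. LINT y|lebesgue. d y * \<eta> (y - x)) has_derivative integral (cbox (- a) a) (fx x)) (at x)"
    by (elim has_derivative_transform_within_open[of _ _ _ _ "ball x 1"]) auto
  have val: "blinfun_apply (integral (cbox (- a) a) (fx x)) v
      = (LINT y|lebesgue. - (d y * frechet_derivative \<eta> (at (y - x)) v))" for v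
  proof -
    have "continuous_on (cbox (- a) a) (\<lambda>y. fx x y)"
    proof -
      have "continuous_on (cbox (- a) a) (\<lambda>y. (x, y))" by (intro continuous_intros)
      from continuous_on_compose2[OF cont_fx this] show ?thesis by force
    qed
    then have "blinfun_apply (integral (cbox (- a) a) (fx x)) v = integral (cbox (- a) a) (\<lambda>y. fx x y v)"
      by (intro blinfun_apply_integral integrable_continuous)
    also have "\<dots> = (LINT y|lebesgue. - (d y * frechet_derivative \<eta> (at (y - x)) v))"
      unfolding fx
    proof (rule integral_lebesgue_eq_integral_cbox[symmetric])
      show "continuous_on UNIV (\<lambda>y. - (d y * frechet_derivative \<eta> (at (y - x)) v))"
        by (intro continuous_intros d cd)
      fix y assume "y \<notin> cbox (- a) a"
      then show "- (d y * frechet_derivative \<eta> (at (y - x)) v) = 0"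
        using out(2)[OF far] by simp
    qed
    finally show ?thesis .
  qed
  show ?thesis by (rule has_derivative_eq_rhs[OF der]) (rule ext, rule val)
qed

lemma smooth_lipschitz_cball:
  fixes Y :: "'a::euclidean_space \<Rightarrow> 'b::real_normed_vector"
  assumes Y: "smooth Y"
  obtains L where "0 < L" "\<And>x y. x \<in> cball z R \<Longrightarrow> y \<in> cball z R \<Longrightarrow> norm (Y x - Y y) \<le> L * norm (x - y)"
proof -
  have "continuous_on UNIV (\<lambda>x. \<Sum>b\<in>Basis. norm (frechet_derivative Y (at x) b))"
    by (intro continuous_intros smooth_continuous_derivative Y)
  from continuous_bound_compact[OF this compact_cball]
  obtain L where L: "0 < L" "\<And>x. x \<in> cball z R \<Longrightarrow> norm (\<Sum>b\<in>Basis. norm (frechet_derivative Y (at x) b)) \<le> L"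
    by metis
  have onorm: "onorm (frechet_derivative Y (at x)) \<le> L" if "x \<in> cball z R" for x
  proof (rule onorm_le)
    fix v
    have lin: "linear (frechet_derivative Y (at x))"
      by (rule linear_frechet_derivative[OF smooth_differentiable[OF Y]])
    have "frechet_derivative Y (at x) v = frechet_derivative Y (at x) (\<Sum>b\<in>Basis. (v \<bullet> b) *\<^sub>R b)"
      by (simp add: euclidean_representation)
    also have "\<dots> = (\<Sum>b\<in>Basis. (v \<bullet> b) *\<^sub>R frechet_derivative Y (at x) b)"
      by (simp add: linear_sum[OF lin] linear_cmul[OF lin])
    also have "norm \<dots> \<le> (\<Sum>b\<in>Basis. norm ((v \<bullet> b) *\<^sub>R frechet_derivative Y (at x) b))"
      by (rule norm_sum)
    also have "\<dots> \<le> (\<Sum>b\<in>Basis. norm v * norm (frechet_derivative Y (at x) b))"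
      by (intro sum_mono) (auto intro!: mult_right_mono Basis_le_norm)
    also have "\<dots> = norm v * (\<Sum>b\<in>Basis. norm (frechet_derivative Y (at x) b))"
      by (simp add: sum_distrib_left)
    also have "\<dots> \<le> norm v * L"
      using L(2)[OF that] by (intro mult_left_mono) auto
    finally show "norm (frechet_derivative Y (at x) v) \<le> L * norm v" by (simp add: mult.commute)
  qed
  have "norm (Y x - Y y) \<le> L * norm (x - y)" if "x \<in> cball z R" "y \<in> cball z R" for x y
    by (rule differentiable_bound[OF convex_cball has_derivative_at_withinI[OF smooth_has_derivative[OF Y]]
          onorm that])
  with L(1) show ?thesis using that by blast
qed

text \<open>With edge width h the asymmetric corners -2h and h give a function that is 1 on
  [-h, h]^N and vanishes outside [-2h, 2h]^N.\<close>

definition bump :: "real \<Rightarrow> real ^ 'n \<Rightarrow> real" where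
  "bump h = plateau (vec (- (2 * h))) (vec h) h"

text \<open>The type argument supplies the dimension, which \<open>h\<close> alone does not
  determine.\<close>

definition bump_mass :: "'n::finite itself \<Rightarrow> real \<Rightarrow> real" where
  "bump_mass T h = (LINT y|lebesgue. (bump h :: real ^ 'n::finite \<Rightarrow> real) y)"

definition mollify :: "real \<Rightarrow> (real ^ 'n \<Rightarrow> real) \<Rightarrow> real ^ 'n \<Rightarrow> real" where
  "mollify h d x = (LINT y|lebesgue. d y * bump h (y - x)) / bump_mass TYPE('n::finite) h"

context
  fixes h :: real assumes h: "0 < h"
begin

text \<open>Writing the translated bump as a plateau on a cube of side 3h makes
  \<open>plateau_deriv_mass\<close> applicable to it.\<close>

lemma bump_shift: "bump h (y - x) = plateau (x + vec (- (2 * h))) (x + vec (- (2 * h)) + vec (3 * h)) h y"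
proof -
  have "x + vec (- (2 * h)) + vec (3 * h) = x + vec h" by (simp add: vec_eq_iff)
  then show ?thesis by (simp add: bump_def plateau_def algebra_simps)
qed

lemma bump_corner: "vec (- (2 * h)) $ i \<le> (vec h :: real ^ 'n) $ i"
  using h by simp

lemma bump_bounds: "0 \<le> bump h z" "bump h z \<le> 1"
  unfolding bump_def using plateau_nonneg[OF h bump_corner] plateau_le_1[OF h bump_corner] by auto

lemma test_function_bump: "test_function (bump h)"
  using plateau_mult_test_function[OF h bump_corner, of "\<lambda>_. 1"] by (simp add: bump_def smooth_def Ck_const)

lemma test_function_bump_shift: "test_function (\<lambda>y. bump h (y - x))"
  unfolding bump_shift using h by (intro test_function_plateau) auto

lemma supp_bump_shift:
  fixes x :: "real ^ 'n"
  assumes "y \<in> supp (\<lambda>y. bump h (y - x))"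
  shows "norm (y - x) \<le> 2 * real CARD('n) * h"
proof -
  have "supp (\<lambda>y. bump h (y - x)) \<subseteq> cbox (x + vec (- (2 * h))) (x + vec (2 * h))"
  proof (rule supp_subset_closed)
    fix y assume y: "bump h (y - x) \<noteq> 0"
    have b: "- (2 * h) < (y - x) $ i" "(y - x) $ i < h + h" for i
      using plateau_nonzero[OF h bump_corner, of "y - x" i] y by (auto simp: bump_def)
    show "y \<in> cbox (x + vec (- (2 * h))) (x + vec (2 * h))"
      unfolding mem_box_cart
    proof
      fix i
      show "(x + vec (- (2 * h))) $ i \<le> y $ i \<and> y $ i \<le> (x + vec (2 * h)) $ i"
        using b[of i] by simp
    qed
  qed (rule closed_cbox)
  then have y: "y \<in> cbox (x + vec (- (2 * h))) (x + vec (2 * h))" using assms by blast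
  have "norm (y - x) \<le> (\<Sum>i\<in>UNIV. \<bar>(y - x) $ i\<bar>)" by (rule norm_le_l1_cart)
  also have "\<dots> \<le> (\<Sum>i\<in>(UNIV :: 'n set). 2 * h)"
  proof (rule sum_mono)
    fix i show "\<bar>(y - x) $ i\<bar> \<le> 2 * h"
      using y[unfolded mem_box_cart, THEN spec, of i] by (auto simp: abs_le_iff)
  qed
  finally show ?thesis by simp
qed

lemma continuous_bump: "continuous_on UNIV (bump h)"
  using test_function_bump by (auto simp: test_function_def intro: smooth_continuous)

lemma bump_mass_shift:
  fixes x :: "real ^ 'n"
  shows "(LINT y|lebesgue. bump h (y - x)) = bump_mass TYPE('n) h"
  using integral_shift_continuous[OF continuous_bump, of "- x"] by (simp add: bump_mass_def)

lemma bump_mass_lower: "(2 * h) ^ CARD('n) \<le> bump_mass TYPE('n::finite) h"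
proof -
  let ?Q = "cbox (vec (- h)) (vec (- h) + vec (2 * h)) :: (real ^ 'n) set"
  have "(2 * h) ^ CARD('n) = (LINT y|lebesgue. indicat_real ?Q y)"
    using measure_cube[of "2 * h" "vec (- h) :: real ^ 'n"] h by simp
  also have "\<dots> \<le> (LINT y|lebesgue. bump h (y :: real ^ 'n))"
  proof (rule integral_mono)
    show "integrable lebesgue (indicat_real ?Q)"
      by (rule integrable_real_indicator) (simp_all add: emeasure_lborel_cbox_finite[unfolded infinity_ennreal_def])
    show "integrable lebesgue (bump h :: real ^ 'n \<Rightarrow> real)"
      using integrable_mult_test_function[OF _ test_function_bump, of "\<lambda>_. 1"]
      by (simp add: Linfty_loc_continuous)
    fix y :: "real ^ 'n"
    have "bump h y = 1" if "y \<in> ?Q"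
      unfolding bump_def
    proof (rule plateau_eq_1[OF h bump_corner])
      fix i show "vec (- (2 * h)) $ i + h \<le> y $ i" "y $ i \<le> vec h $ i"
        using that[unfolded mem_box_cart, THEN spec, of i] by auto
    qed
    then show "indicat_real ?Q y \<le> bump h y" using bump_bounds(1) by (auto simp: indicator_def)
  qed
  finally show ?thesis by (simp add: bump_mass_def)
qed

lemma bump_mass_pos: "0 < bump_mass TYPE('n::finite) h"
  using bump_mass_lower h by (meson less_le_trans mult_pos_pos zero_less_numeral zero_less_power)

lemma mollify_has_derivative:
  fixes x :: "real ^ 'n"
  assumes "continuous_on UNIV d"
  shows "(mollify h d has_derivative
    (\<lambda>v. (LINT y|lebesgue. - (d y * frechet_derivative (bump h) (at (y - x)) v)) / bump_mass TYPE('n::finite) h)) (at x)"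
  unfolding mollify_def[abs_def]
  using bounded_linear.has_derivative[OF bounded_linear_divide convolution_has_derivative[OF test_function_bump assms]] by simp

end

text \<open>Uniform continuity is used on a ball larger than \<open>K\<close>, since
  \<open>y\<close> may lie outside \<open>K\<close>.\<close>

lemma uniform_modulus_compact:
  fixes d :: "'a::euclidean_space \<Rightarrow> real"
  assumes d: "continuous_on UNIV d" and K: "compact K" and \<omega>: "0 < \<omega>"
  obtains \<delta> where "0 < \<delta>" "\<And>x y. x \<in> K \<Longrightarrow> norm (y - x) \<le> \<delta> \<Longrightarrow> \<bar>d y - d x\<bar> \<le> \<omega>"
proof -
  obtain R where R: "\<And>x. x \<in> K \<Longrightarrow> norm x \<le> R"
    using compact_imp_bounded[OF K] by (auto simp: bounded_pos)
  have "uniformly_continuous_on (cball 0 (R + 1)) d"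
    by (intro compact_uniformly_continuous continuous_on_subset[OF d]) auto
  then obtain e where e: "0 < e" "\<And>x y. x \<in> cball 0 (R + 1) \<Longrightarrow> y \<in> cball 0 (R + 1) \<Longrightarrow> dist y x < e \<Longrightarrow> dist (d y) (d x) < \<omega>"
    unfolding uniformly_continuous_on_def using \<omega> by meson
  show ?thesis
  proof (rule that[of "min 1 (e / 2)"])
    show "0 < min 1 (e / 2)" using e(1) by simp
    fix x y assume x: "x \<in> K" and n: "norm (y - x) \<le> min 1 (e / 2)"
    have "norm y \<le> norm x + norm (y - x)" by (rule norm_triangle_sub)
    then have "y \<in> cball 0 (R + 1)" "x \<in> cball 0 (R + 1)" using R[OF x] n by auto
    then show "\<bar>d y - d x\<bar> \<le> \<omega>" using e(2)[of x y] n e(1) by (simp add: dist_norm)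
  qed
qed

lemma mollify_close:
  fixes d :: "real ^ 'n \<Rightarrow> real"
  assumes d: "continuous_on UNIV d" and K: "compact K"
  shows "\<forall>\<^sub>F h in at_right 0. \<forall>x\<in>K. \<bar>mollify h d x - d x\<bar> \<le> 1"
proof -
  obtain \<delta> where \<delta>: "0 < \<delta>" "\<And>x y. x \<in> K \<Longrightarrow> norm (y - x) \<le> \<delta> \<Longrightarrow> \<bar>d y - d x\<bar> \<le> 1"
    using uniform_modulus_compact[OF d K, of 1] by auto
  have N: "0 < real CARD('n)" by simp
  have "\<bar>mollify h d x - d x\<bar> \<le> 1" if h: "0 < h" "h < \<delta> / (2 * real CARD('n))" and x: "x \<in> K" for h x
  proof -
    define \<phi> where "\<phi> = (\<lambda>y. bump h (y - x))"
    have \<phi>: "test_function \<phi>" unfolding \<phi>_def by (rule test_function_bump_shift[OF h(1)])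
    have m: "0 < bump_mass TYPE('n) h" by (rule bump_mass_pos[OF h(1)])
    have mass: "(LINT y|lebesgue. \<phi> y) = bump_mass TYPE('n) h"
      unfolding \<phi>_def by (rule bump_mass_shift[OF h(1)])
    have i1: "integrable lebesgue (\<lambda>y. d y * \<phi> y)" "integrable lebesgue (\<lambda>y. d x * \<phi> y)" "integrable lebesgue \<phi>"
      using integrable_mult_test_function[OF _ \<phi>] integrable_mult_test_function[OF _ \<phi>, of "\<lambda>_. 1"]
      by (auto simp: Linfty_loc_continuous d)
    have "mollify h d x * bump_mass TYPE('n) h = (LINT y|lebesgue. d y * \<phi> y)"
      using m by (simp add: mollify_def \<phi>_def)
    then have "(LINT y|lebesgue. d y * \<phi> y - d x * \<phi> y) = (mollify h d x - d x) * bump_mass TYPE('n) h"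
      using i1 mass by (simp add: left_diff_distrib)
    then have "\<bar>mollify h d x - d x\<bar> * bump_mass TYPE('n) h = \<bar>LINT y|lebesgue. d y * \<phi> y - d x * \<phi> y\<bar>"
      using m by (simp add: abs_mult)
    also have "\<dots> \<le> (LINT y|lebesgue. \<phi> y)"
    proof (rule order_trans[OF integral_abs_bound], rule integral_mono)
      show "integrable lebesgue (\<lambda>y. \<bar>d y * \<phi> y - d x * \<phi> y\<bar>)" using i1 by auto
      fix y
      show "\<bar>d y * \<phi> y - d x * \<phi> y\<bar> \<le> \<phi> y"
      proof (cases "y \<in> supp \<phi>")
        case True
        have "norm (y - x) \<le> 2 * real CARD('n) * h"
          using supp_bump_shift[OF h(1)] True by (simp add: \<phi>_def)
        also have "\<dots> \<le> \<delta>" using h N by (simp add: field_simps)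
        finally have "\<bar>d y - d x\<bar> \<le> 1" by (rule \<delta>(2)[OF x])
        moreover have "0 \<le> \<phi> y" unfolding \<phi>_def by (rule bump_bounds(1)[OF h(1)])
        ultimately show ?thesis
          by (simp add: abs_mult mult_left_le_one_le flip: left_diff_distrib)
      qed (simp add: not_in_supp)
    qed (rule i1)
    finally show ?thesis using mass m by simp
  qed
  then show ?thesis
    using \<delta>(1) N by (intro eventually_at_rightI[of 0 "\<delta> / (2 * real CARD('n))"]) auto
qed

text \<open>Friedrichs' commutator estimate. Both \<open>Y\<close> and the constant field \<open>Y x\<close> are divergence free, so \<open>f\<close>
  may be replaced by \<open>f - f x\<close> in the commutator; the variation of \<open>Y\<close> on the support of the bump
  compensates the size of the derivative of the bump.\<close>

lemma (in distr_pairing) mollify_vf_deriv_bound: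
  assumes Ys: "smooth Y" and K: "compact K" and g1: "AE x in lebesgue. \<bar>g x\<bar> \<le> 1"
  shows "\<forall>\<^sub>F h in at_right 0. \<forall>x\<in>K. \<bar>vf_deriv Y (mollify h f) x\<bar> \<le> 2"
proof -
  define N where "N = CARD('n)"
  have N: "1 \<le> N" by (simp add: N_def Suc_leI)
  obtain M where M: "0 < M" "\<And>(a :: real ^ 'n) s r. 0 < r \<Longrightarrow> r \<le> s \<Longrightarrow>
       \<exists>\<Gamma>. integrable lebesgue \<Gamma> \<and> (LINT x|lebesgue. \<Gamma> x) \<le> M * s ^ (CARD('n) - 1) \<and>
         (\<forall>x. 0 \<le> \<Gamma> x) \<and> (\<forall>x v. \<bar>frechet_derivative (plateau a (a + vec s) r) (at x) v\<bar> \<le> \<Gamma> x * norm v)"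
    using plateau_deriv_mass by metis
  obtain R where R: "\<And>x. x \<in> K \<Longrightarrow> norm x \<le> R"
    using compact_imp_bounded[OF K] by (auto simp: bounded_pos)
  obtain L where L: "0 < L" "\<And>x y. x \<in> cball 0 (R + 2 * N) \<Longrightarrow> y \<in> cball 0 (R + 2 * N) \<Longrightarrow>
      norm (Y x - Y y) \<le> L * norm (x - y)"
    using smooth_lipschitz_cball[OF Ys, of 0 "R + 2 * N"] by metis
  \<comment> \<open>Chosen so that the commutator bound \<open>\<omega>\<close> (L 2N h) M
    (3h)^(N-1) equals h^N, which is at most the mass of the bump.\<close>
  define \<omega> where "\<omega> = 1 / (L * (2 * N) * M * 3 ^ (N - 1))"
  have \<omega>: "0 < \<omega>" using L(1) M(1) N by (simp add: \<omega>_def)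
  obtain \<delta> where \<delta>: "0 < \<delta>" "\<And>x y. x \<in> K \<Longrightarrow> norm (y - x) \<le> \<delta> \<Longrightarrow> \<bar>f y - f x\<bar> \<le> \<omega>"
    using uniform_modulus_compact[OF f K \<omega>] by metis
  define h0 where "h0 = min 1 (\<delta> / (2 * N))"
  have "\<bar>vf_deriv Y (mollify h f) x\<bar> \<le> 2" if h: "0 < h" "h < h0" and x: "x \<in> K" for h x
  proof -
    have h1: "h \<le> 1" "2 * N * h \<le> \<delta>" using h N by (auto simp: h0_def field_simps)
    define m where "m = bump_mass TYPE('n) h"
    have m: "0 < m" "(2 * h) ^ N \<le> m"
      using bump_mass_pos[OF h(1)] bump_mass_lower[OF h(1)] by (auto simp: m_def N_def)
    define \<phi> where "\<phi> = (\<lambda>y. bump h (y - x))"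
    have \<phi>: "test_function \<phi>" unfolding \<phi>_def by (rule test_function_bump_shift[OF h(1)])
    then have sm: "smooth \<phi>" and S: "compact (supp \<phi>)" by (auto simp: test_function_def)
    have mass: "(LINT y|lebesgue. \<phi> y) = m"
      unfolding \<phi>_def m_def by (rule bump_mass_shift[OF h(1)])
    have \<phi>0: "0 \<le> \<phi> y" for y unfolding \<phi>_def by (rule bump_bounds(1)[OF h(1)])
    have D\<phi>: "frechet_derivative \<phi> (at y) v = frechet_derivative (bump h) (at (y - x)) v" for y v
    proof -
      have "(bump h has_derivative frechet_derivative (bump h) (at (y - x))) (at (y - x))"
        by (rule smooth_has_derivative[OF test_function_bump[OF h(1), unfolded test_function_def, THEN conjunct1]])
      moreover have "((\<lambda>y. y - x) has_derivative (\<lambda>v. v)) (at y)"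
        using has_derivative_diff[OF has_derivative_ident has_derivative_const[of x]] by simp
      ultimately have "(\<phi> has_derivative frechet_derivative (bump h) (at (y - x))) (at y)"
        unfolding \<phi>_def by (rule has_derivative_compose[rotated])
      from frechet_derivative_at[OF this] show ?thesis by simp
    qed
    define c where "c = Y x"
    have Yx: "smooth (\<lambda>_::real ^ 'n. c)" "vf_div (\<lambda>_. c) z = 0" for z :: "real ^ 'n"
      by (simp_all add: smooth_def Ck_const vf_div_def)
    have near: "norm (y - x) \<le> 2 * N * h" if "y \<in> supp \<phi>" for y
      using supp_bump_shift[OF h(1)] that by (simp add: \<phi>_def N_def)
    \<comment> \<open>T1 is the weak derivative tested with the bump and contributes at most
      \<open>m\<close> because \<open>\<bar>g\<bar> \<le> 1\<close>; T2 is the commutator with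
      \<open>f x\<close> subtracted, again at most \<open>m\<close>; T3 integrates to zero. The sum
      explains the bound 2.\<close>
    define T1 where "T1 y = f y * vf_adjoint Y \<phi> y" for y
    define T2 where "T2 y = (f y - f x) * (vf_deriv Y \<phi> y - vf_deriv (\<lambda>_. c) \<phi> y)" for y
    define T3 where "T3 y = f x * (vf_deriv Y \<phi> y - vf_deriv (\<lambda>_. c) \<phi> y)" for y
    have cY: "continuous_on UNIV (vf_deriv Y \<phi>)" "continuous_on UNIV (vf_deriv (\<lambda>_. c) \<phi>)"
      by (intro vf_deriv_continuous sm Y continuous_intros)+
    have compactly: "integrable lebesgue k"
      if "continuous_on UNIV k" "\<And>y. y \<notin> supp \<phi> \<Longrightarrow> k y = 0" for k :: "real ^ 'n \<Rightarrow> real"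
      by (rule integrable_Linfty_loc_compact[OF Linfty_loc_continuous[OF that(1)] S that(2)])
    have "integrable lebesgue T1"
      by (rule compactly)
        (auto simp: T1_def[abs_def] vf_adjoint_def Y_div vf_deriv_not_in_supp intro!: continuous_intros f cY)
    moreover have "integrable lebesgue T2"
      by (rule compactly)
        (auto simp: T2_def[abs_def] vf_deriv_not_in_supp intro!: continuous_intros f cY)
    moreover have "integrable lebesgue (vf_deriv Y \<phi>)" "integrable lebesgue (vf_deriv (\<lambda>_. c) \<phi>)"
      by (intro compactly cY vf_deriv_not_in_supp; assumption)+
    ultimately have int: "integrable lebesgue T1" "integrable lebesgue T2"
      "integrable lebesgue (vf_deriv Y \<phi>)" "integrable lebesgue (vf_deriv (\<lambda>_. c) \<phi>)"
      by auto
    have int3: "integrable lebesgue T3" unfolding T3_def[abs_def] using int(3,4) by auto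
    have "vf_deriv Y (mollify h f) x
        = (LINT y|lebesgue. - (f y * frechet_derivative (bump h) (at (y - x)) c)) / m"
      using vf_deriv_eq[OF mollify_has_derivative[OF h(1) f, of x], of Y] by (simp add: m_def c_def)
    also have "(\<lambda>y. - (f y * frechet_derivative (bump h) (at (y - x)) c)) = (\<lambda>y. T1 y + T2 y + T3 y)"
      by (simp add: fun_eq_iff T1_def T2_def T3_def vf_adjoint_def Y_div vf_deriv_def algebra_simps flip: D\<phi>)
    also have "(LINT y|lebesgue. T1 y + T2 y + T3 y) = (LINT y|lebesgue. T1 y) + (LINT y|lebesgue. T2 y) + (LINT y|lebesgue. T3 y)"
      using int int3 by simp
    also have "(LINT y|lebesgue. T3 y) = 0"
      unfolding T3_def using int(3,4) integral_vf_deriv_test_function[OF Ys Y_div \<phi>]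
        integral_vf_deriv_test_function[OF Yx \<phi>] by simp
    finally have eq: "vf_deriv Y (mollify h f) x * m = (LINT y|lebesgue. T1 y) + (LINT y|lebesgue. T2 y)"
      using m(1) by simp
    have "\<bar>LINT y|lebesgue. T1 y\<bar> \<le> m"
    proof -
      have "(LINT y|lebesgue. T1 y) = (LINT y|lebesgue. g y * \<phi> y)"
        unfolding T1_def using fg \<phi> by (simp add: has_distr_deriv_def)
      also have "\<bar>\<dots>\<bar> \<le> (LINT y|lebesgue. \<bar>g y * \<phi> y\<bar>)" by (rule integral_abs_bound)
      also have "\<dots> \<le> (LINT y|lebesgue. \<phi> y)"
      proof (rule integral_mono_AE)
        show "integrable lebesgue (\<lambda>y. \<bar>g y * \<phi> y\<bar>)"
          using integrable_mult_test_function[OF g \<phi>] by auto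
        show "integrable lebesgue \<phi>"
          using integrable_mult_test_function[OF _ \<phi>, of "\<lambda>_. 1"] by (simp add: Linfty_loc_continuous)
        show "AE y in lebesgue. \<bar>g y * \<phi> y\<bar> \<le> \<phi> y"
          using g1 by eventually_elim (use \<phi>0 in \<open>auto simp: abs_mult intro!: mult_left_le_one_le\<close>)
      qed
      finally show ?thesis by (simp add: mass)
    qed
    moreover have "\<bar>LINT y|lebesgue. T2 y\<bar> \<le> m"
    proof -
      obtain \<Gamma> where \<Gamma>: "integrable lebesgue \<Gamma>" "(LINT y|lebesgue. \<Gamma> y) \<le> M * (3 * h) ^ (N - 1)"
        "\<And>y. 0 \<le> \<Gamma> y" "\<And>y v. \<bar>frechet_derivative \<phi> (at y) v\<bar> \<le> \<Gamma> y * norm v"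
        using M(2)[of h "3 * h" "x + vec (- (2 * h))"] h(1)
        unfolding \<phi>_def bump_shift[OF h(1)] N_def by auto
      have "\<bar>T2 y\<bar> \<le> \<omega> * (L * (2 * N * h)) * \<Gamma> y" for y
      proof (cases "y \<in> supp \<phi>")
        case False
        then show ?thesis
          using \<omega> L(1) h(1) \<Gamma>(3)[of y] by (simp add: T2_def vf_deriv_not_in_supp)
      next
        case True
        have lin: "linear (frechet_derivative \<phi> (at y))"
          by (rule linear_frechet_derivative[OF smooth_differentiable[OF sm]])
        have "norm y \<le> norm x + norm (y - x)" by (rule norm_triangle_sub)
        moreover have "norm (y - x) \<le> 2 * N"
          using near[OF True] h1(1) mult_left_mono[of h 1 "2 * real N"] by linarith
        ultimately have "y \<in> cball 0 (R + 2 * N)" "x \<in> cball 0 (R + 2 * N)" using R[OF x] by auto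
        then have "norm (Y y - Y x) \<le> L * norm (y - x)" by (rule L(2))
        also have "\<dots> \<le> L * (2 * N * h)" using near[OF True] L(1) by (intro mult_left_mono) auto
        finally have 1: "norm (Y y - c) \<le> L * (2 * N * h)" by (simp add: c_def)
        have "\<bar>vf_deriv Y \<phi> y - vf_deriv (\<lambda>_. c) \<phi> y\<bar> = \<bar>frechet_derivative \<phi> (at y) (Y y - c)\<bar>"
          by (simp add: vf_deriv_def linear_diff[OF lin])
        also have "\<dots> \<le> \<Gamma> y * (L * (2 * N * h))"
          using \<Gamma>(4)[of y "Y y - c"] 1 \<Gamma>(3)[of y] by (meson mult_left_mono order_trans)
        finally have 2: "\<bar>vf_deriv Y \<phi> y - vf_deriv (\<lambda>_. c) \<phi> y\<bar> \<le> \<Gamma> y * (L * (2 * N * h))" .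
        have "norm (y - x) \<le> \<delta>" using near[OF True] h1(2) by linarith
        then have "\<bar>f y - f x\<bar> \<le> \<omega>" by (rule \<delta>(2)[OF x])
        then have "\<bar>T2 y\<bar> \<le> \<omega> * (\<Gamma> y * (L * (2 * N * h)))"
          unfolding T2_def abs_mult using 2 \<omega> by (intro mult_mono) auto
        then show ?thesis by (simp add: ac_simps)
      qed
      then have "\<bar>LINT y|lebesgue. T2 y\<bar> \<le> (LINT y|lebesgue. \<omega> * (L * (2 * N * h)) * \<Gamma> y)"
        using int(2) \<Gamma>(1) by (intro order_trans[OF integral_abs_bound] integral_mono) auto
      also have "\<dots> = \<omega> * (L * (2 * N * h)) * (LINT y|lebesgue. \<Gamma> y)" by simp
      also have "\<dots> \<le> \<omega> * (L * (2 * N * h)) * (M * (3 * h) ^ (N - 1))"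
        using \<Gamma>(2) \<omega> L(1) h(1) by (intro mult_left_mono) auto
      also have "\<dots> = (\<omega> * (L * (2 * N) * M * 3 ^ (N - 1))) * (h * h ^ (N - 1))"
        by (simp add: power_mult_distrib)
      also have "\<dots> = h ^ N"
      proof -
        have "L * (2 * N) * M * 3 ^ (N - 1) \<noteq> 0" using L(1) M(1) N by simp
        then have "\<omega> * (L * (2 * N) * M * 3 ^ (N - 1)) = 1" 
          unfolding \<omega>_def times_divide_eq_left mult_1_left by (rule divide_self)
        moreover have "h * h ^ (N - 1) = h ^ N" using N by (simp flip: power_Suc)
        ultimately show ?thesis by simp
      qed
      also have "\<dots> \<le> (2 * h) ^ N" using h(1) by (intro power_mono) auto
      also have "\<dots> \<le> m" by (rule m(2))
      finally show ?thesis .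
    qed
    ultimately have "\<bar>vf_deriv Y (mollify h f) x * m\<bar> \<le> 2 * m" unfolding eq by linarith
    then show ?thesis using m(1) by (simp add: abs_mult)
  qed
  moreover have "0 < h0" using \<delta>(1) N by (simp add: h0_def)
  ultimately show ?thesis by (intro eventually_at_rightI[of 0 h0]) auto
qed

section \<open>Product rule and cutoffs\<close>

lemma grad_component:
  assumes "f \<in> class_L X"
  shows "Linfty_loc (\<lambda>x. grad X f x $ i)" "has_distr_deriv (X i) f (\<lambda>x. grad X f x $ i)"
proof -
  have "\<exists>g. Linfty_loc g \<and> has_distr_deriv (X i) f g" using assms by (simp add: class_L_def)
  then have "Linfty_loc (SOME g. Linfty_loc g \<and> has_distr_deriv (X i) f g) \<and>
      has_distr_deriv (X i) f (SOME g. Linfty_loc g \<and> has_distr_deriv (X i) f g)"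
    by (rule someI_ex)
  then show "Linfty_loc (\<lambda>x. grad X f x $ i)" "has_distr_deriv (X i) f (\<lambda>x. grad X f x $ i)"
    by (simp_all add: grad_def)
qed

lemma norm_grad_measurable:
  assumes "f \<in> class_L X"
  shows "(\<lambda>x. norm (grad X f x)) \<in> borel_measurable lebesgue"
proof -
  have "(\<lambda>x. grad X f x $ i) \<in> borel_measurable lebesgue" for i
    using grad_component(1)[OF assms] by (simp add: Linfty_loc_def)
  then show ?thesis
    unfolding norm_vec_def L2_set_def by measurable
qed

locale divergence_free_frame =
  fixes X :: "'k::finite \<Rightarrow> real ^ 'n \<Rightarrow> real ^ 'n"
  assumes X_smooth: "\<And>i. smooth (X i)" and X_div: "\<And>i x. vf_div (X i) x = 0"
begin

lemma distr_pairing_grad: "f \<in> class_L X \<Longrightarrow> distr_pairing (X i) f (\<lambda>x. grad X f x $ i)"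
  using grad_component[of f X i] X_smooth X_div
  by unfold_locales (auto intro: smooth_continuous simp: class_L_def)

text \<open>The product rule of the pairing is applied to each field. As \<open>grad\<close> is a
  chosen representative, uniqueness of weak derivatives turns the result into an almost everywhere
  identity.\<close>

lemma class_L_mult:
  assumes f: "f \<in> class_L X" and m: "\<And>x. m differentiable (at x)"
    and mB: "\<And>i S. compact S \<Longrightarrow> \<exists>B. \<forall>x\<in>S. \<bar>vf_deriv (X i) m x\<bar> \<le> B"
  shows "(\<lambda>x. f x * m x) \<in> class_L X"
    and "AE x in lebesgue. grad X (\<lambda>x. f x * m x) x = m x *\<^sub>R grad X f x + f x *\<^sub>R classical_grad X m x"
proof -
  have D: "has_distr_deriv (X i) (\<lambda>x. f x * m x) (\<lambda>x. grad X f x $ i * m x + f x * vf_deriv (X i) m x)"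
    and L: "Linfty_loc (\<lambda>x. grad X f x $ i * m x + f x * vf_deriv (X i) m x)" for i
    using distr_pairing.has_distr_deriv_mult[OF distr_pairing_grad[OF f] m mB] by auto
  have "continuous_on UNIV m"
    using m by (intro differentiable_imp_continuous_on) (simp add: differentiable_on_def)
  then show fm: "(\<lambda>x. f x * m x) \<in> class_L X"
    using f D L by (auto simp: class_L_def intro!: continuous_intros)
  have "AE x in lebesgue. grad X (\<lambda>x. f x * m x) x $ i = grad X f x $ i * m x + f x * vf_deriv (X i) m x" for i
    by (rule has_distr_deriv_unique[OF grad_component[OF fm] L D])
  then have "AE x in lebesgue. \<forall>i. grad X (\<lambda>x. f x * m x) x $ i = grad X f x $ i * m x + f x * vf_deriv (X i) m x"
    by (simp add: AE_all_countable)
  then show "AE x in lebesgue. grad X (\<lambda>x. f x * m x) x = m x *\<^sub>R grad X f x + f x *\<^sub>R classical_grad X m x"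
    by eventually_elim (simp add: vec_eq_iff classical_grad_def mult.commute)
qed

text \<open>The mollification scale depends on T, but the bound 2 on the mollified derivatives does
  not; hence one \<open>c\<close> serves all T and survives the limit T \<rightarrow>
  \<infinity>.\<close>

lemma cutoff_exists:
  assumes d: "d \<in> class_L X" and balls: "\<And>R. compact {x. d x \<le> R}"
    and grad_d: "AE x in lebesgue. norm (grad X d x) \<le> 1"
  obtains c where "0 < c" "\<And>T. \<exists>\<kappa>. (\<forall>x. \<kappa> differentiable (at x)) \<and> (\<forall>x. 0 \<le> \<kappa> x \<and> \<kappa> x \<le> 1) \<and>
    (\<forall>x. d x \<le> T \<longrightarrow> \<kappa> x = 1) \<and> (\<forall>x. \<kappa> x \<noteq> 0 \<longrightarrow> d x \<le> T + 3) \<and>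
    (\<forall>x. norm (classical_grad X \<kappa> x) \<le> c)"
proof -
  obtain M where M: "0 < M" "\<And>t. \<bar>deriv smooth_step t\<bar> \<le> M" using deriv_smooth_step_bound by metis
  define c where "c = real CARD('k) * (2 * M)"
  have cd: "continuous_on UNIV d" using d by (simp add: class_L_def)
  show ?thesis
  proof (rule that[of c])
    show "0 < c" using M(1) by (simp add: c_def)
    fix T :: real
    have "AE x in lebesgue. \<bar>grad X d x $ i\<bar> \<le> 1" for i
      using grad_d by eventually_elim (use component_le_norm_cart order_trans in blast)
    then have "\<forall>\<^sub>F h in at_right 0. \<forall>x\<in>{x. d x \<le> T + 4}. \<bar>vf_deriv (X i) (mollify h d) x\<bar> \<le> 2" for i
      by (intro distr_pairing.mollify_vf_deriv_bound[OF distr_pairing_grad[OF d]] X_smooth balls)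
    then have "\<forall>\<^sub>F h in at_right 0. \<forall>i. \<forall>x\<in>{x. d x \<le> T + 4}. \<bar>vf_deriv (X i) (mollify h d) x\<bar> \<le> 2"
      by (simp add: eventually_all_finite)
    moreover have "\<forall>\<^sub>F h in at_right 0. \<forall>x\<in>{x. d x \<le> T + 4}. \<bar>mollify h d x - d x\<bar> \<le> 1"
      by (rule mollify_close[OF cd balls])
    moreover have "\<forall>\<^sub>F h in at_right (0::real). 0 < h" by (simp add: eventually_at_right_less)
    ultimately have "\<forall>\<^sub>F h in at_right 0. 0 < h \<and> (\<forall>x. d x \<le> T + 4 \<longrightarrow>
        \<bar>mollify h d x - d x\<bar> \<le> 1 \<and> (\<forall>i. \<bar>vf_deriv (X i) (mollify h d) x\<bar> \<le> 2))"
      by eventually_elim auto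
    then obtain h where h: "0 < h" "\<And>x. d x \<le> T + 4 \<Longrightarrow> \<bar>mollify h d x - d x\<bar> \<le> 1"
      "\<And>x i. d x \<le> T + 4 \<Longrightarrow> \<bar>vf_deriv (X i) (mollify h d) x\<bar> \<le> 2"
      using eventually_happens'[OF trivial_limit_at_right_real] by blast
    define u where "u = mollify h d"
    define \<tau> where "\<tau> x = 1 - smooth_step (u x - (T + 1))" for x
    \<comment> \<open>The mollification is controlled only where \<open>d x \<le> T + 4\<close>;
      beyond that it might become small again, so \<open>\<kappa>\<close> is set to 0 by hand. As u
      differs from d by at most 1, \<tau> is 1 for d \<le> T and already 0 for T + 3 < d < T + 4, so
      the two definitions agree on an open overlap and \<open>\<kappa>\<close> is differentiable
      everywhere.\<close>
    define \<kappa> where "\<kappa> x = (if d x < T + 4 then \<tau> x else 0)" for x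
    have oU: "open {x. d x < T + 4}" "open {x. T + 3 < d x}"
      using cd by (auto intro!: open_Collect_less continuous_intros)
    have u': "(u has_derivative frechet_derivative u (at x)) (at x)" for x
      using mollify_has_derivative[OF h(1) cd, of x] frechet_derivative_works differentiable_def
      unfolding u_def by blast
    have \<tau>': "(\<tau> has_derivative (\<lambda>v. - (deriv smooth_step (u x - (T + 1)) * frechet_derivative u (at x) v))) (at x)" for x
    proof -
      have "((\<lambda>x. u x - (T + 1)) has_derivative frechet_derivative u (at x)) (at x)"
        using has_derivative_diff[OF u' has_derivative_const[of "T + 1"]] by simp
      from has_derivative_compose[OF this smooth_step_has_derivative[unfolded has_field_derivative_def]]
      have "((\<lambda>x. smooth_step (u x - (T + 1))) has_derivative
          (\<lambda>v. deriv smooth_step (u x - (T + 1)) * frechet_derivative u (at x) v)) (at x)" .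
      from has_derivative_diff[OF has_derivative_const this, of 1]
      show ?thesis unfolding \<tau>_def[abs_def] by simp
    qed
    have far: "\<kappa> x = 0" if "T + 3 < d x" for x
    proof (cases "d x < T + 4")
      case True
      then have "1 \<le> u x - (T + 1)" using h(2)[of x] that by (auto simp: u_def)
      then show ?thesis by (simp add: \<kappa>_def \<tau>_def smooth_step_eq_1)
    qed (simp add: \<kappa>_def)
    have \<kappa>_near: "(\<kappa> has_derivative (\<lambda>v. - (deriv smooth_step (u x - (T + 1)) * frechet_derivative u (at x) v))) (at x)"
      if "d x < T + 4" for x
      using has_derivative_cong_open[OF oU(1), of x \<kappa> \<tau>] that \<tau>' by (simp add: \<kappa>_def)
    have \<kappa>_far: "(\<kappa> has_derivative (\<lambda>v. 0)) (at x)" if "T + 3 < d x" for x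
      using has_derivative_cong_open[OF oU(2), of x \<kappa> "\<lambda>_. 0"] that far by simp
    have "\<kappa> differentiable (at x)" for x
      using \<kappa>_near[of x] \<kappa>_far[of x] unfolding differentiable_def by (cases "d x < T + 4") auto
    moreover have "0 \<le> \<kappa> x \<and> \<kappa> x \<le> 1" for x
      using smooth_step_bounds[of "u x - (T + 1)"] by (simp add: \<kappa>_def \<tau>_def)
    moreover have "\<kappa> x = 1" if "d x \<le> T" for x
    proof -
      have "u x - (T + 1) \<le> 0" using h(2)[of x] that by (auto simp: u_def)
      then show ?thesis using that by (simp add: \<kappa>_def \<tau>_def smooth_step_eq_0)
    qed
    moreover have "\<kappa> x \<noteq> 0 \<Longrightarrow> d x \<le> T + 3" for x using far[of x] by linarith
    moreover have "norm (classical_grad X \<kappa> x) \<le> c" for x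
    proof -
      have "\<bar>vf_deriv (X i) \<kappa> x\<bar> \<le> 2 * M" for i
      proof (cases "d x < T + 4")
        case True
        have "vf_deriv (X i) \<kappa> x = - (deriv smooth_step (u x - (T + 1)) * vf_deriv (X i) u x)"
          using vf_deriv_eq[OF \<kappa>_near[OF True], of "X i"] by (simp add: vf_deriv_def)
        then have "\<bar>vf_deriv (X i) \<kappa> x\<bar> \<le> M * 2"
          using M h(3)[of x i] True by (auto simp: abs_mult u_def intro!: mult_mono)
        then show ?thesis by simp
      next
        case False
        then show ?thesis using vf_deriv_eq[OF \<kappa>_far, of x "X i"] M(1) by simp
      qed
      then have "(\<Sum>i\<in>UNIV. \<bar>classical_grad X \<kappa> x $ i\<bar>) \<le> (\<Sum>i\<in>(UNIV :: 'k set). 2 * M)"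
        by (intro sum_mono) (simp add: classical_grad_def)
      then show ?thesis using norm_le_l1_cart[of "classical_grad X \<kappa> x"] by (simp add: c_def)
    qed
    ultimately show "\<exists>\<kappa>. (\<forall>x. \<kappa> differentiable (at x)) \<and> (\<forall>x. 0 \<le> \<kappa> x \<and> \<kappa> x \<le> 1) \<and>
      (\<forall>x. d x \<le> T \<longrightarrow> \<kappa> x = 1) \<and> (\<forall>x. \<kappa> x \<noteq> 0 \<longrightarrow> d x \<le> T + 3) \<and>
      (\<forall>x. norm (classical_grad X \<kappa> x) \<le> c)"
      by blast
  qed
qed

end

section \<open>Finite oscillation, and absorption in the extended nonnegative reals\<close>

text \<open>If \<open>V\<close> were unbounded above or below, the difference of supremum and
  infimum would be \<infinity>, even in the case of \<infinity> - (-\<infinity>).\<close>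

lemma osc_finite_bounded:
  assumes "osc V < \<infinity>" obtains B where "\<And>x. \<bar>V x\<bar> \<le> B"
proof -
  define s i where "s = (SUP x. ereal (V x))" and "i = (INF x. ereal (V x))"
  have le: "i \<le> ereal (V x)" "ereal (V x) \<le> s" for x
    by (auto simp: s_def i_def intro: SUP_upper INF_lower)
  have "s - i < \<infinity>" using assms by (simp add: osc_def s_def i_def)
  then have "\<bar>s\<bar> \<noteq> \<infinity>" "\<bar>i\<bar> \<noteq> \<infinity>"
    using le[of undefined] by (cases s; cases i; auto)+
  then obtain s' i' where "s = ereal s'" "i = ereal i'" by (metis ereal_real)
  then have "i' \<le> V x" "V x \<le> s'" for x using le[of x] by auto
  then have "\<bar>V x\<bar> \<le> max \<bar>s'\<bar> \<bar>i'\<bar>" for x by (smt (verit))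
  then show ?thesis using that by blast
qed

text \<open>Finiteness of \<open>a\<close> is essential: for q > 0 the value \<open>top\<close>
  satisfies the inequality with any \<open>b\<close>. The right-hand side \<open>b\<close> may be
  infinite.\<close>

lemma ennreal_absorb:
  assumes a: "a < top" and le: "a \<le> b + ennreal q * a" and q: "0 \<le> q" "q < 1"
  shows "a \<le> ennreal (1 / (1 - q)) * b"
proof (cases b)
  case (real b')
  obtain a' where a': "a = ennreal a'" "0 \<le> a'" using a by (cases a) auto
  have "ennreal a' \<le> ennreal (b' + q * a')"
    using le real a' q by (simp add: ennreal_mult ennreal_plus)
  then have "a' \<le> b' + q * a'"
    using real a' q by (subst (asm) ennreal_le_iff) auto
  then have "a' * (1 - q) \<le> b'" by (simp add: algebra_simps)
  then have "a' \<le> 1 / (1 - q) * b'" using q by (simp add: field_simps)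
  then show ?thesis
    using real q by (simp add: a' ennreal_leI flip: ennreal_mult)
next
  case top
  then show ?thesis using q by (simp add: ennreal_mult_top)
qed

section \<open>Perturbation of the measure\<close>

text \<open>The weight exp(-W) is kept under the integrals over \<nu> instead of passing to a new
  measure, so that \<open>W\<close> is settled before \<open>V\<close> and the normalisation
  enter.\<close>

lemma (in divergence_free_frame) exp_weighted_inequality:
  fixes d q W :: "real ^ 'n \<Rightarrow> real" and \<nu> :: "(real ^ 'n) measure"
  assumes d: "d \<in> class_L X" and balls: "\<And>R. compact {x. d x \<le> R}"
    and grad_d: "AE x in lebesgue. norm (grad X d x) \<le> 1"
    and q: "continuous_on UNIV q" "\<And>x. 0 \<le> q x"
    and \<nu>: "\<nu> = density lebesgue e" and e: "e \<in> borel_measurable lebesgue" and prob: "prob_space \<nu>"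
    and CD: "0 < C" "0 < D"
    and ineq: "\<And>f. f \<in> class_L X \<Longrightarrow>
      (\<integral>\<^sup>+ x. ennreal (\<bar>f x\<bar> * q x) \<partial>\<nu>)
        \<le> ennreal C * (\<integral>\<^sup>+ x. ennreal (norm (grad X f x)) \<partial>\<nu>)
          + ennreal D * (\<integral>\<^sup>+ x. ennreal \<bar>f x\<bar> \<partial>\<nu>)"
    and W: "\<And>x. W differentiable (at x)"
    and \<delta>: "0 \<le> \<delta>" "C * \<delta> < 1" and \<gamma>: "0 < \<gamma>"
    and grad_W: "\<And>x. norm (classical_grad X W x) \<le> \<delta> * q x + \<gamma>"
  obtains C' D' :: real where "0 < C'" "0 < D'"
    "\<And>f. f \<in> class_L X \<Longrightarrow>
      (\<integral>\<^sup>+ x. ennreal (\<bar>f x\<bar> * q x * exp (- W x)) \<partial>\<nu>)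
        \<le> ennreal C' * (\<integral>\<^sup>+ x. ennreal (norm (grad X f x) * exp (- W x)) \<partial>\<nu>)
          + ennreal D' * (\<integral>\<^sup>+ x. ennreal (\<bar>f x\<bar> * exp (- W x)) \<partial>\<nu>)"
proof -
  obtain c where c: "0 < c" "\<And>T. \<exists>\<kappa>. (\<forall>x. \<kappa> differentiable (at x)) \<and> (\<forall>x. 0 \<le> \<kappa> x \<and> \<kappa> x \<le> 1) \<and>
    (\<forall>x. d x \<le> T \<longrightarrow> \<kappa> x = 1) \<and> (\<forall>x. \<kappa> x \<noteq> 0 \<longrightarrow> d x \<le> T + 3) \<and>
    (\<forall>x. norm (classical_grad X \<kappa> x) \<le> c)"
    using cutoff_exists[OF d balls grad_d] by metis
  have cd: "continuous_on UNIV d" using d by (simp add: class_L_def)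
  have cW: "continuous_on UNIV W"
    using W by (intro differentiable_imp_continuous_on) (simp add: differentiable_on_def)
  have meas: "k \<in> borel_measurable \<nu>" if "k \<in> borel_measurable lebesgue" for k :: "real ^ 'n \<Rightarrow> ennreal"
    using that by (simp add: \<nu>)
  have AE\<nu>: "AE x in \<nu>. P x" if "AE x in lebesgue. P x" for P
    unfolding \<nu> using that e by (subst AE_density) auto
  \<comment> \<open>With A, G, F the integrals of \<open>\<bar>u\<bar> * q\<close>, of the weighted
    gradient and of the weighted function, the estimate below reads A \<le> C G + (C (c + \<gamma>)
    + D) F + C \<delta> A; solving for A gives these constants.\<close>
  define C1 where "C1 = C / (1 - C * \<delta>)"
  define D1 where "D1 = (C * (c + \<gamma>) + D) / (1 - C * \<delta>)"
  have pos: "0 < C1" "0 < D1"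
    using CD c(1) \<gamma> \<delta> by (auto simp: C1_def D1_def intro!: divide_pos_pos add_pos_pos mult_pos_pos)
  show ?thesis
  proof (rule that[OF pos])
    fix f assume f: "f \<in> class_L X"
    then have cf: "continuous_on UNIV f" by (simp add: class_L_def)
    define G where "G = (\<integral>\<^sup>+ x. ennreal (norm (grad X f x) * exp (- W x)) \<partial>\<nu>)"
    define F where "F = (\<integral>\<^sup>+ x. ennreal (\<bar>f x\<bar> * exp (- W x)) \<partial>\<nu>)"
    have bound: "(\<integral>\<^sup>+ x. ennreal (\<bar>f x\<bar> * q x * exp (- W x)) * indicator {x. d x \<le> T} x \<partial>\<nu>)
        \<le> ennreal C1 * G + ennreal D1 * F" for T :: real
    proof -
      obtain \<kappa> where \<kappa>: "\<And>x. \<kappa> differentiable (at x)" "\<And>x. 0 \<le> \<kappa> x" "\<And>x. \<kappa> x \<le> 1"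
        "\<And>x. d x \<le> T \<Longrightarrow> \<kappa> x = 1" "\<And>x. \<kappa> x \<noteq> 0 \<Longrightarrow> d x \<le> T + 3"
        "\<And>x. norm (classical_grad X \<kappa> x) \<le> c"
        using c(2)[of T] by blast
      have c\<kappa>: "continuous_on UNIV \<kappa>"
        using \<kappa>(1) by (intro differentiable_imp_continuous_on) (simp add: differentiable_on_def)
      define m where "m x = \<kappa> x * exp (- W x)" for x
      have m': "(m has_derivative (\<lambda>v. \<kappa> x * (- (exp (- W x) * frechet_derivative W (at x) v))
          + frechet_derivative \<kappa> (at x) v * exp (- W x))) (at x)" for x
        unfolding m_def
      proof (rule has_derivative_mult)
        show "(\<kappa> has_derivative frechet_derivative \<kappa> (at x)) (at x)"
          using \<kappa>(1) by (simp flip: frechet_derivative_works)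
        have "(W has_derivative frechet_derivative W (at x)) (at x)"
          using W by (simp flip: frechet_derivative_works)
        from has_derivative_compose[OF has_derivative_minus[OF this] DERIV_exp[unfolded has_field_derivative_def]]
        show "((\<lambda>x. exp (- W x)) has_derivative (\<lambda>v. - (exp (- W x) * frechet_derivative W (at x) v))) (at x)"
          by simp
      qed
      have m_diff: "m differentiable (at x)" for x
        using m' differentiable_def by blast
      have grad_m: "classical_grad X m x = exp (- W x) *\<^sub>R (classical_grad X \<kappa> x - \<kappa> x *\<^sub>R classical_grad X W x)" for x
        using vf_deriv_eq[OF m'[of x]]
        by (simp add: vec_eq_iff classical_grad_def vf_deriv_def algebra_simps)
      have grad_m_le: "norm (classical_grad X m x) \<le> exp (- W x) * (c + \<gamma> + \<delta> * q x * \<kappa> x)" for x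
      proof -
        have "norm (classical_grad X \<kappa> x - \<kappa> x *\<^sub>R classical_grad X W x)
            \<le> norm (classical_grad X \<kappa> x) + \<kappa> x * norm (classical_grad X W x)"
          using norm_triangle_ineq4[of "classical_grad X \<kappa> x" "\<kappa> x *\<^sub>R classical_grad X W x"] \<kappa>(2)[of x] by simp
        also have "\<dots> \<le> c + \<kappa> x * (\<delta> * q x + \<gamma>)"
          using \<kappa>(2,6) grad_W by (intro add_mono mult_left_mono)
        \<comment> \<open>The factor \<open>\<kappa> x\<close> is dropped from the
          \<open>\<gamma>\<close> term but kept beside \<open>\<delta> * q x\<close>: there it
          recombines with \<open>\<bar>f\<bar>\<close> and the exponential to
          \<open>\<bar>u\<bar> * q\<close>, so that exactly A reappears and can be absorbed.\<close>
        also have "\<dots> \<le> c + \<gamma> + \<delta> * q x * \<kappa> x"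
          using mult_right_mono[OF \<kappa>(3)[of x], of \<gamma>] \<gamma> by (simp add: algebra_simps)
        finally show ?thesis unfolding grad_m by (simp add: mult_left_mono)
      qed
      have mB: "\<exists>B. \<forall>x\<in>S. \<bar>vf_deriv (X i) m x\<bar> \<le> B" if "compact S" for i S
      proof -
        have "continuous_on UNIV (\<lambda>x. exp (- W x) * (c + \<gamma> + \<delta> * q x * \<kappa> x))"
          by (intro continuous_intros cW q(1) c\<kappa>)
        from continuous_bound_compact[OF this that]
        obtain B where B: "\<And>x. x \<in> S \<Longrightarrow> norm (exp (- W x) * (c + \<gamma> + \<delta> * q x * \<kappa> x)) \<le> B" by metis
        have "\<bar>vf_deriv (X i) m x\<bar> \<le> B" if "x \<in> S" for x
          using component_le_norm_cart[of "classical_grad X m x" i] grad_m_le[of x] B[OF that]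
          by (simp add: classical_grad_def)
        then show ?thesis by blast
      qed
      define u where "u x = f x * m x" for x
      have u: "u \<in> class_L X"
        and grad_u: "AE x in lebesgue. grad X u x = m x *\<^sub>R grad X f x + f x *\<^sub>R classical_grad X m x"
        using class_L_mult[OF f m_diff mB] unfolding u_def by auto
      have cu: "continuous_on UNIV u" using u by (simp add: class_L_def)
      define A where "A = (\<integral>\<^sup>+ x. ennreal (\<bar>u x\<bar> * q x) \<partial>\<nu>)"
      have u_abs: "\<bar>u x\<bar> = \<bar>f x\<bar> * \<kappa> x * exp (- W x)" for x
        using \<kappa>(2)[of x] by (simp add: u_def m_def abs_mult)
      have u_le: "\<bar>u x\<bar> \<le> \<bar>f x\<bar> * exp (- W x)" for x
        using mult_left_mono[OF \<kappa>(3)[of x], of "\<bar>f x\<bar>"] by (simp add: u_abs mult_right_mono)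
      \<comment> \<open>The function \<open>u\<close> vanishes outside a compact ball, so
        \<open>\<bar>u\<bar> * q\<close> is bounded, and \<nu> is a probability measure.\<close>
      have "A < top"
      proof -
        have "continuous_on UNIV (\<lambda>x. \<bar>u x\<bar> * q x)" by (intro continuous_intros cu q(1))
        from continuous_bound_compact[OF this balls[of "T + 3"]]
        obtain B where B: "0 < B" "\<And>x. d x \<le> T + 3 \<Longrightarrow> norm (\<bar>u x\<bar> * q x) \<le> B" by auto
        have "\<bar>u x\<bar> * q x \<le> B" for x
        proof (cases "d x \<le> T + 3")
          case True
          then show ?thesis using B(2)[OF True] by simp
        next
          case False
          then have "u x = 0" using \<kappa>(5)[of x] by (auto simp: u_def m_def)
          then show ?thesis using B(1) by simp
        qed
        then have "A \<le> (\<integral>\<^sup>+ x. ennreal B \<partial>\<nu>)"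
          unfolding A_def by (intro nn_integral_mono ennreal_leI)
        also have "\<dots> = ennreal B"
          using prob_space.emeasure_space_1[OF prob] by simp
        finally show ?thesis by (simp add: order_le_less_trans)
      qed
      moreover have "A \<le> (ennreal C * G + ennreal (C * (c + \<gamma>) + D) * F) + ennreal (C * \<delta>) * A"
      proof -
        have "(\<integral>\<^sup>+ x. ennreal (norm (grad X u x)) \<partial>\<nu>) \<le>
          (\<integral>\<^sup>+ x. ennreal (norm (grad X f x) * exp (- W x)) + (ennreal (c + \<gamma>) * ennreal (\<bar>f x\<bar> * exp (- W x))
            + ennreal \<delta> * ennreal (\<bar>u x\<bar> * q x)) \<partial>\<nu>)"
        proof (rule nn_integral_mono_AE, use AE\<nu>[OF grad_u] in eventually_elim)
          case (elim x)
          have "norm (grad X u x) \<le> \<bar>m x\<bar> * norm (grad X f x) + \<bar>f x\<bar> * norm (classical_grad X m x)"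
            using norm_triangle_ineq[of "m x *\<^sub>R grad X f x" "f x *\<^sub>R classical_grad X m x"] elim by simp
          also have "\<dots> \<le> exp (- W x) * norm (grad X f x) + \<bar>f x\<bar> * (exp (- W x) * (c + \<gamma> + \<delta> * q x * \<kappa> x))"
            using \<kappa>(2,3)[of x] grad_m_le[of x]
            by (intro add_mono mult_right_mono mult_left_mono) (auto simp: m_def abs_mult mult_left_le_one_le)
          also have "\<dots> = norm (grad X f x) * exp (- W x) + ((c + \<gamma>) * (\<bar>f x\<bar> * exp (- W x)) + \<delta> * (\<bar>u x\<bar> * q x))"
            unfolding u_abs by (simp add: algebra_simps)
          finally have "ennreal (norm (grad X u x)) \<le> ennreal (norm (grad X f x) * exp (- W x)
              + ((c + \<gamma>) * (\<bar>f x\<bar> * exp (- W x)) + \<delta> * (\<bar>u x\<bar> * q x)))"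
            by (rule ennreal_leI)
          then show ?case
            using c(1) \<gamma> \<delta>(1) q(2)[of x] by (simp add: ennreal_mult ennreal_plus)
        qed
        also have "\<dots> = G + (ennreal (c + \<gamma>) * F + ennreal \<delta> * A)"
        proof -
          have m1: "(\<lambda>x. ennreal (norm (grad X f x) * exp (- W x))) \<in> borel_measurable \<nu>"
            by (intro meas measurable_compose[OF _ measurable_ennreal] borel_measurable_times
                norm_grad_measurable f continuous_imp_lebesgue_measurable continuous_intros cW)
          have m2: "(\<lambda>x. ennreal (\<bar>f x\<bar> * exp (- W x))) \<in> borel_measurable \<nu>"
            by (intro meas measurable_compose[OF _ measurable_ennreal]
                continuous_imp_lebesgue_measurable continuous_intros cW cf)
          have m3: "(\<lambda>x. ennreal (\<bar>u x\<bar> * q x)) \<in> borel_measurable \<nu>"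
            by (intro meas measurable_compose[OF _ measurable_ennreal]
                continuous_imp_lebesgue_measurable continuous_intros cu q(1))
          show ?thesis
            unfolding G_def F_def A_def using m1 m2 m3
            by (simp add: nn_integral_add nn_integral_cmult)
        qed
        finally have gu: "(\<integral>\<^sup>+ x. ennreal (norm (grad X u x)) \<partial>\<nu>) \<le> G + (ennreal (c + \<gamma>) * F + ennreal \<delta> * A)" .
        have uF: "(\<integral>\<^sup>+ x. ennreal \<bar>u x\<bar> \<partial>\<nu>) \<le> F"
          unfolding F_def by (intro nn_integral_mono ennreal_leI u_le)
        have "A \<le> ennreal C * (G + (ennreal (c + \<gamma>) * F + ennreal \<delta> * A)) + ennreal D * F"
          unfolding A_def
          by (rule order_trans[OF ineq[OF u]], fold A_def) (intro add_mono mult_left_mono gu uF; simp)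
        also have "\<dots> = (ennreal C * G + ennreal (C * (c + \<gamma>) + D) * F) + ennreal (C * \<delta>) * A"
          using CD c(1) \<gamma> \<delta>(1) by (simp add: ennreal_mult ennreal_plus algebra_simps)
        finally show ?thesis .
      qed
      ultimately have "A \<le> ennreal (1 / (1 - C * \<delta>)) * (ennreal C * G + ennreal (C * (c + \<gamma>) + D) * F)"
        using CD \<delta> by (intro ennreal_absorb) auto
      also have "\<dots> = ennreal C1 * G + ennreal D1 * F"
      proof -
        have "ennreal (1 / (1 - C * \<delta>)) * ennreal r = ennreal (r / (1 - C * \<delta>))" if "0 \<le> r" for r
          using that \<delta> by (simp flip: ennreal_mult)
        moreover have "0 \<le> C * (c + \<gamma>) + D" using CD c(1) \<gamma> by simp
        ultimately have "ennreal (1 / (1 - C * \<delta>)) * ennreal C = ennreal C1"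
          "ennreal (1 / (1 - C * \<delta>)) * ennreal (C * (c + \<gamma>) + D) = ennreal D1"
          using CD(1) unfolding C1_def D1_def by auto
        then show ?thesis by (simp add: distrib_left mult.assoc[symmetric])
      qed
      finally have "A \<le> ennreal C1 * G + ennreal D1 * F" .
      moreover have "(\<integral>\<^sup>+ x. ennreal (\<bar>f x\<bar> * q x * exp (- W x)) * indicator {x. d x \<le> T} x \<partial>\<nu>) \<le> A"
        unfolding A_def by (intro nn_integral_mono) (auto simp: u_abs \<kappa>(4) indicator_def ac_simps)
      ultimately show ?thesis by (rule order_trans[rotated])
    qed
    \<comment> \<open>The bound does not depend on T, and the balls of integer radius exhaust the
      space, so monotone convergence removes the restriction.\<close>
    have "(\<integral>\<^sup>+ x. ennreal (\<bar>f x\<bar> * q x * exp (- W x)) \<partial>\<nu>)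
        = (\<integral>\<^sup>+ x. (SUP n. ennreal (\<bar>f x\<bar> * q x * exp (- W x)) * indicator {x. d x \<le> real n} x) \<partial>\<nu>)"
    proof (intro nn_integral_cong antisym)
      fix x
      obtain n :: nat where "d x \<le> real n" using real_arch_simple by blast
      then show "ennreal (\<bar>f x\<bar> * q x * exp (- W x))
          \<le> (SUP n. ennreal (\<bar>f x\<bar> * q x * exp (- W x)) * indicator {x. d x \<le> real n} x)"
        by (intro SUP_upper2[of n]) auto
    qed (auto intro!: SUP_least simp: indicator_def)
    also have "\<dots> = (SUP n. \<integral>\<^sup>+ x. ennreal (\<bar>f x\<bar> * q x * exp (- W x)) * indicator {x. d x \<le> real n} x \<partial>\<nu>)"
    proof (rule nn_integral_monotone_convergence_SUP)
      show "incseq (\<lambda>n x. ennreal (\<bar>f x\<bar> * q x * exp (- W x)) * indicator {x. d x \<le> real n} x)"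
        by (auto simp: incseq_def le_fun_def indicator_def)
      have "{x. d x \<le> real n} \<in> sets lebesgue" for n
        using balls[of n] by (intro lmeasurable_compact fmeasurableD)
      then show "(\<lambda>x. ennreal (\<bar>f x\<bar> * q x * exp (- W x)) * indicator {x. d x \<le> real n} x) \<in> borel_measurable \<nu>" for n
        by (intro meas borel_measurable_times_ennreal borel_measurable_indicator
            measurable_compose[OF _ measurable_ennreal] continuous_imp_lebesgue_measurable
            continuous_intros cW cf q(1))
    qed
    also have "\<dots> \<le> ennreal C1 * G + ennreal D1 * F"
      by (intro SUP_least bound)
    finally show "(\<integral>\<^sup>+ x. ennreal (\<bar>f x\<bar> * q x * exp (- W x)) \<partial>\<nu>)
        \<le> ennreal C1 * (\<integral>\<^sup>+ x. ennreal (norm (grad X f x) * exp (- W x)) \<partial>\<nu>)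
          + ennreal D1 * (\<integral>\<^sup>+ x. ennreal (\<bar>f x\<bar> * exp (- W x)) \<partial>\<nu>)"
      by (simp add: G_def F_def)
  qed
qed

text \<open>Pointwise exp(-V) lies between exp(-B) and exp B, and \<open>Z\<close> is a constant
  factor. One direction serves the left side of the final inequality, the other its right
  side.\<close>

lemma bounded_perturbation_nn_integral:
  fixes h W V :: "'a \<Rightarrow> real"
  assumes \<mu>: "\<mu> = density \<nu> (\<lambda>x. ennreal (exp (- W x - V x) / Z))" and Z: "0 < Z"
    and meas: "W \<in> borel_measurable \<nu>" "V \<in> borel_measurable \<nu>" "h \<in> borel_measurable \<nu>"
    and V: "\<And>x. \<bar>V x\<bar> \<le> B" and h: "\<And>x. 0 \<le> h x"
  shows "(\<integral>\<^sup>+ x. ennreal (h x) \<partial>\<mu>) \<le> ennreal (exp B / Z) * (\<integral>\<^sup>+ x. ennreal (h x * exp (- W x)) \<partial>\<nu>)"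
    and "(\<integral>\<^sup>+ x. ennreal (h x * exp (- W x)) \<partial>\<nu>) \<le> ennreal (exp B * Z) * (\<integral>\<^sup>+ x. ennreal (h x) \<partial>\<mu>)"
proof -
  note [measurable] = meas
  have eq: "(\<integral>\<^sup>+ x. ennreal (h x) \<partial>\<mu>) = (\<integral>\<^sup>+ x. ennreal (exp (- W x - V x) / Z * h x) \<partial>\<nu>)"
    unfolding \<mu> using h Z by (subst nn_integral_density) (simp_all flip: ennreal_mult)
  have "(\<integral>\<^sup>+ x. ennreal (h x) \<partial>\<mu>) \<le> (\<integral>\<^sup>+ x. ennreal (exp B / Z) * ennreal (h x * exp (- W x)) \<partial>\<nu>)"
    unfolding eq
  proof (rule nn_integral_mono)
    fix x
    have "exp (- V x) \<le> exp B" using V[of x] by (simp add: abs_le_iff)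
    then have "exp (- V x) * (h x * exp (- W x) / Z) \<le> exp B * (h x * exp (- W x) / Z)"
      using h[of x] Z by (intro mult_right_mono) auto
    then have "exp (- W x - V x) / Z * h x \<le> exp B / Z * (h x * exp (- W x))"
      by (simp add: exp_diff exp_minus field_simps)
    then show "ennreal (exp (- W x - V x) / Z * h x) \<le> ennreal (exp B / Z) * ennreal (h x * exp (- W x))"
      using h[of x] Z by (simp add: ennreal_leI flip: ennreal_mult)
  qed
  then show "(\<integral>\<^sup>+ x. ennreal (h x) \<partial>\<mu>) \<le> ennreal (exp B / Z) * (\<integral>\<^sup>+ x. ennreal (h x * exp (- W x)) \<partial>\<nu>)"
    by (simp add: nn_integral_cmult)
  have "(\<integral>\<^sup>+ x. ennreal (h x * exp (- W x)) \<partial>\<nu>)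
      \<le> (\<integral>\<^sup>+ x. ennreal (exp B * Z) * ennreal (exp (- W x - V x) / Z * h x) \<partial>\<nu>)"
  proof (rule nn_integral_mono)
    fix x
    have "1 \<le> exp (B - V x)" using V[of x] by (simp add: abs_le_iff)
    then have "1 * (h x * exp (- W x)) \<le> exp (B - V x) * (h x * exp (- W x))"
      using h[of x] by (intro mult_right_mono) auto
    also have "\<dots> = exp B * Z * (exp (- W x - V x) / Z * h x)"
      using Z by (simp add: exp_diff exp_minus field_simps)
    finally show "ennreal (h x * exp (- W x)) \<le> ennreal (exp B * Z) * ennreal (exp (- W x - V x) / Z * h x)"
      using h[of x] Z by (simp add: ennreal_leI flip: ennreal_mult)
  qed
  also have "\<dots> = ennreal (exp B * Z) * (\<integral>\<^sup>+ x. ennreal (h x) \<partial>\<mu>)"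
    unfolding eq by (rule nn_integral_cmult) measurable
  finally show "(\<integral>\<^sup>+ x. ennreal (h x * exp (- W x)) \<partial>\<nu>) \<le> ennreal (exp B * Z) * (\<integral>\<^sup>+ x. ennreal (h x) \<partial>\<mu>)" .
qed

theorem theorem2p2:
  fixes X :: "'k::finite \<Rightarrow> real ^ 'n \<Rightarrow> real ^ 'n"
    and \<rho> :: "real ^ 'n \<Rightarrow> real ^ 'n \<Rightarrow> real"
    and x0 :: "real ^ 'n"
    and d W V :: "real ^ 'n \<Rightarrow> real"
    and p \<beta> \<sigma> K \<epsilon> C D \<delta> \<gamma> Z Z' :: real
    and \<mu>p \<mu> :: "(real ^ 'n) measure"
  assumes X_smooth: "\<And>i. smooth (X i)"
    and X_div: "\<And>i x. vf_div (X i) x = 0"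
    and metric: "Metric_space UNIV \<rho>"
    and d_def: "\<And>x. d x = \<rho> x0 x"
    and d_L: "d \<in> class_L X"
    and balls: "\<And>R. compact {x. d x \<le> R}"
    and p: "1 < p" and \<beta>: "0 < \<beta>"
    and \<mu>p_def: "\<mu>p = density lebesgue (\<lambda>x. ennreal (exp (- \<beta> * d x powr p) / Z))"
    and \<mu>p_prob: "prob_space \<mu>p"
    and \<sigma>: "1 \<le> \<sigma>"
    and grad_d: "AE x in lebesgue. 1 / \<sigma> \<le> norm (grad X d x) \<and> norm (grad X d x) \<le> 1"
    and K: "0 \<le> K"
    and \<epsilon>: "0 \<le> \<epsilon>" "\<epsilon> < 1 / \<sigma>\<^sup>2"
    and laplacian_d:
      "distr_laplacian_le X {x. d x > 1} d (\<lambda>x. K + \<beta> * p * \<epsilon> * d x powr (p - 1))"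
    and CD: "0 < C" "0 < D"
    and ineq_\<mu>p: "\<And>f. f \<in> class_L X \<Longrightarrow>
      (\<integral>\<^sup>+ x. ennreal (\<bar>f x\<bar> * d x powr (p - 1)) \<partial>\<mu>p)
        \<le> ennreal C * (\<integral>\<^sup>+ x. ennreal (norm (grad X f x)) \<partial>\<mu>p)
          + ennreal D * (\<integral>\<^sup>+ x. ennreal \<bar>f x\<bar> \<partial>\<mu>p)"
    and \<mu>_def: "\<mu> = density \<mu>p (\<lambda>x. ennreal (exp (- W x - V x) / Z'))"
    and \<mu>_prob: "prob_space \<mu>"
    and W_diff: "\<And>x. W differentiable (at x)"
    and \<delta>: "\<delta> < 1 / C" and \<gamma>: "0 < \<gamma>"
    and grad_W: "\<And>x. norm (classical_grad X W x) \<le> \<delta> * d x powr (p - 1) + \<gamma>"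
    and V_meas: "V \<in> borel_measurable lebesgue"
    and V_osc: "osc V < \<infinity>"
  shows "\<exists>C' D' :: real. 0 < C' \<and> 0 < D' \<and> (\<forall>f \<in> class_L X.
      (\<integral>\<^sup>+ x. ennreal (\<bar>f x\<bar> * d x powr (p - 1)) \<partial>\<mu>)
        \<le> ennreal C' * (\<integral>\<^sup>+ x. ennreal (norm (grad X f x)) \<partial>\<mu>)
          + ennreal D' * (\<integral>\<^sup>+ x. ennreal \<bar>f x\<bar> \<partial>\<mu>))"
proof -
  interpret divergence_free_frame X by unfold_locales (fact X_smooth, fact X_div)
  have d0: "0 \<le> d x" for x
    using metric by (simp add: d_def Metric_space.nonneg)
  have cd: "continuous_on UNIV d" using d_L by (simp add: class_L_def)
  define q where "q x = d x powr (p - 1)" for x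
  have cq: "continuous_on UNIV q"
    unfolding q_def[abs_def] using p d0 by (intro continuous_on_powr' cd continuous_intros) auto
  have q0: "0 \<le> q x" for x by (simp add: q_def)
  have cdp: "continuous_on UNIV (\<lambda>x. d x powr p)"
    using p d0 by (intro continuous_on_powr' cd continuous_intros) auto
  have e: "(\<lambda>x. ennreal (exp (- \<beta> * d x powr p) / Z)) \<in> borel_measurable lebesgue"
    by (intro measurable_compose[OF _ measurable_ennreal] borel_measurable_divide borel_measurable_const
        continuous_imp_lebesgue_measurable continuous_on_exp continuous_on_mult continuous_on_const cdp)
  \<comment> \<open>Absorption needs a nonnegative coefficient, whereas \<open>\<delta>\<close> may
    be negative; enlarging it to 0 preserves both the gradient bound and
    \<open>C * \<delta>' < 1\<close>.\<close>
  define \<delta>' where "\<delta>' = max \<delta> 0"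
  have \<delta>': "0 \<le> \<delta>'" "C * \<delta>' < 1"
    using \<delta> CD by (auto simp: \<delta>'_def max_def field_simps)
  have grad_W': "norm (classical_grad X W x) \<le> \<delta>' * q x + \<gamma>" for x
    using grad_W[of x] mult_right_mono[of \<delta> \<delta>' "q x"] q0[of x] by (simp add: q_def \<delta>'_def)
  have gd: "AE x in lebesgue. norm (grad X d x) \<le> 1" using grad_d by eventually_elim auto
  have ineq_q: "(\<integral>\<^sup>+ x. ennreal (\<bar>f x\<bar> * q x) \<partial>\<mu>p)
        \<le> ennreal C * (\<integral>\<^sup>+ x. ennreal (norm (grad X f x)) \<partial>\<mu>p)
          + ennreal D * (\<integral>\<^sup>+ x. ennreal \<bar>f x\<bar> \<partial>\<mu>p)" if "f \<in> class_L X" for f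
    unfolding q_def using that by (rule ineq_\<mu>p)
  obtain C1 D1 where CD1: "0 < C1" "0 < D1" and main: "\<And>f. f \<in> class_L X \<Longrightarrow>
      (\<integral>\<^sup>+ x. ennreal (\<bar>f x\<bar> * q x * exp (- W x)) \<partial>\<mu>p)
        \<le> ennreal C1 * (\<integral>\<^sup>+ x. ennreal (norm (grad X f x) * exp (- W x)) \<partial>\<mu>p)
          + ennreal D1 * (\<integral>\<^sup>+ x. ennreal (\<bar>f x\<bar> * exp (- W x)) \<partial>\<mu>p)"
    using exp_weighted_inequality[OF d_L balls gd cq q0 \<mu>p_def e \<mu>p_prob CD ineq_q W_diff \<delta>' \<gamma> grad_W']
    by blast
  obtain B where B: "\<And>x. \<bar>V x\<bar> \<le> B" using osc_finite_bounded[OF V_osc] by metis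
  \<comment> \<open>Division by 0 yields 0 and \<open>ennreal\<close> truncates negative values to
    0, so any other \<open>Z'\<close> would make \<mu> the zero measure.\<close>
  have Z': "0 < Z'"
  proof (rule ccontr)
    assume "\<not> 0 < Z'"
    then have "ennreal (exp (- W x - V x) / Z') = 0" for x
      by (intro ennreal_neg) (simp add: divide_nonneg_nonpos)
    then have "emeasure \<mu> (space \<mu>) = 0"
      unfolding \<mu>_def by (subst emeasure_density) auto
    then show False using prob_space.emeasure_space_1[OF \<mu>_prob] by simp
  qed
  have meas: "k \<in> borel_measurable \<mu>p" if "k \<in> borel_measurable lebesgue" for k :: "real ^ 'n \<Rightarrow> real"
    using that by (simp add: \<mu>p_def)
  have cW: "continuous_on UNIV W"
    using W_diff by (intro differentiable_imp_continuous_on) (simp add: differentiable_on_def)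
  note pert = bounded_perturbation_nn_integral[OF \<mu>_def Z'
      meas[OF continuous_imp_lebesgue_measurable[OF cW]] meas[OF V_meas] meas B]
  show ?thesis
  proof (intro exI conjI ballI)
    \<comment> \<open>The factor \<open>exp B / Z'\<close> is the cost of leaving \<mu> and
      \<open>exp B * Z'\<close> that of returning to it, so the normalisation cancels and the
      constants are exp(2B) \<open>C1\<close> and exp(2B) \<open>D1\<close>.\<close>
    show "0 < exp B / Z' * C1 * (exp B * Z')" "0 < exp B / Z' * D1 * (exp B * Z')"
      using CD1 Z' by auto
    fix f assume f: "f \<in> class_L X"
    then have cf: "continuous_on UNIV f" by (simp add: class_L_def)
    define G where "G = (\<integral>\<^sup>+ x. ennreal (norm (grad X f x)) \<partial>\<mu>)"
    define F where "F = (\<integral>\<^sup>+ x. ennreal \<bar>f x\<bar> \<partial>\<mu>)"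
    have "(\<integral>\<^sup>+ x. ennreal (\<bar>f x\<bar> * q x) \<partial>\<mu>)
        \<le> ennreal (exp B / Z') * (\<integral>\<^sup>+ x. ennreal (\<bar>f x\<bar> * q x * exp (- W x)) \<partial>\<mu>p)"
      by (rule pert(1)) (auto intro!: continuous_imp_lebesgue_measurable continuous_intros cf cq mult_nonneg_nonneg q0)
    also have "\<dots> \<le> ennreal (exp B / Z') * (ennreal C1 * (ennreal (exp B * Z') * G) + ennreal D1 * (ennreal (exp B * Z') * F))"
    proof (intro mult_left_mono order_trans[OF main[OF f]] add_mono)
      show "(\<integral>\<^sup>+ x. ennreal (norm (grad X f x) * exp (- W x)) \<partial>\<mu>p) \<le> ennreal (exp B * Z') * G"
        unfolding G_def by (rule pert(2)) (auto intro: norm_grad_measurable f)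
      show "(\<integral>\<^sup>+ x. ennreal (\<bar>f x\<bar> * exp (- W x)) \<partial>\<mu>p) \<le> ennreal (exp B * Z') * F"
        unfolding F_def by (rule pert(2)) (auto intro!: continuous_imp_lebesgue_measurable continuous_intros cf)
    qed auto
    also have "\<dots> = ennreal (exp B / Z' * C1 * (exp B * Z')) * G + ennreal (exp B / Z' * D1 * (exp B * Z')) * F"
    proof -
      have mul: "ennreal (a * k * b) = ennreal a * ennreal k * ennreal b"
        if "0 \<le> a" "0 \<le> k" "0 \<le> b" for a k b
        using that by (simp add: ennreal_mult)
      have n: "0 \<le> exp B / Z'" "0 \<le> exp B * Z'" using Z' by auto
      show ?thesis
        unfolding mul[OF n(1) less_imp_le[OF CD1(1)] n(2)] mul[OF n(1) less_imp_le[OF CD1(2)] n(2)]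
        by (simp only: distrib_left mult.assoc)
    qed
    finally show "(\<integral>\<^sup>+ x. ennreal (\<bar>f x\<bar> * d x powr (p - 1)) \<partial>\<mu>)
        \<le> ennreal (exp B / Z' * C1 * (exp B * Z')) * (\<integral>\<^sup>+ x. ennreal (norm (grad X f x)) \<partial>\<mu>)
          + ennreal (exp B / Z' * D1 * (exp B * Z')) * (\<integral>\<^sup>+ x. ennreal \<bar>f x\<bar> \<partial>\<mu>)"
      by (simp add: q_def G_def F_def)
  qed
qed

end
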